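(* Let $n\ge 1$, $0<s<1$, let $\Omega\subset\mathbb{R}^n$ be a bounded domain, and let $\lambda_1^{s+\ln}(\Omega)\le\lambda_2^{s+\ln}(\Omega)\le\cdots\uparrow+\infty$ be the Dirichlet eigenvalues of the fractional-logarithmic Laplacian $(-\Delta)^{s+\ln}$ on $\Omega$. For $t>0$ put $\Omega_t:=\{x\in\Omega:\operatorname{dist}(x,\partial\Omega)<t\}$, and assume that there exist $t_0>0$ and $C_\Omega>0$ such that $|\Omega_t|\le C_\Omega t$ for all $0<t\le t_0$. Then there exists a constant $C=C(n,s,\Omega)>0$ such that, for every integer $k>\frac{\omega_n|\Omega|}{(2\pi)^n}\exp\left(\frac{n}{n+2s}\right)$, $$\sum_{j=1}^{k}\lambda_j^{s+\ln}(\Omega)\ \le\ \frac{2}{n+2s}(2\pi)^{2s}(\omega_n|\Omega|)^{-2s/n}\,k^{1+2s/n}\ln k+C\,k^{1+2s/n}.$$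
   Context: $\omega_n=\pi^{n/2}/\Gamma(\frac n2+1)$ is the volume of the unit ball of $\mathbb{R}^n$ and $|\cdot|$ is Lebesgue measure on sets. Fourier transform: $\widehat u(\xi)=(2\pi)^{-n/2}\int_{\mathbb{R}^n}u(x)e^{-ix\cdot\xi}\,dx$. The fractional-logarithmic Laplacian $(-\Delta)^{s+\ln}$ is the operator with Fourier symbol $|\xi|^{2s}\ln|\xi|^2$. Its energy space on $\Omega$ is $\mathcal{H}_0^{s+\ln}(\Omega)=\{u\in L^2(\mathbb{R}^n):u=0\text{ a.e. in }\mathbb{R}^n\setminus\Omega,\ \int_{\mathbb{R}^n}|\xi|^{2s}\,|\ln|\xi|^2|\,|\widehat u(\xi)|^2d\xi<\infty\}$, with quadratic form $\mathcal{E}(u,v)=\int_{\mathbb{R}^n}|\xi|^{2s}\ln|\xi|^2\,\widehat u(\xi)\overline{\widehat v(\xi)}\,d\xi$. The Dirichlet eigenvalues $\lambda_j^{s+\ln}(\Omega)$ (known to exist, to form a discrete nondecreasing sequence tending to $+\infty$, and listed with multiplicity) are those of this form: there is an orthonormal basis $\{\phi_j\}_{j\ge1}$ of $L^2(\Omega)$ with $\phi_j\in\mathcal{H}_0^{s+\ln}(\Omega)$ (extended by zero) and $\mathcal{E}(\phi_j,v)=\lambda_j^{s+\ln}(\Omega)\int_\Omega\phi_j\overline v\,dx$ for all $v\in\mathcal{H}_0^{s+\ln}(\Omega)$. *)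

theory Defs
  imports "HOL-Analysis.Analysis"
begin

text \<open>
  Square-integrable functions are handled through Borel representatives; every class of
  Lebesgue-measurable functions modulo null sets contains one.  Thus \<open>L2_fun lborel\<close> stands for
  \<open>L\<^sup>2(\<real>\<^sup>n)\<close> and \<open>L2_fun (restrict_space lborel \<Omega>)\<close> for \<open>L\<^sup>2(\<Omega>)\<close>.
\<close>

definition L2_fun :: "'a measure \<Rightarrow> ('a \<Rightarrow> complex) set" where
  "L2_fun M = {f \<in> borel_measurable M. integrable M (\<lambda>x. (cmod (f x))\<^sup>2)}"

definition L2_inner :: "'a measure \<Rightarrow> ('a \<Rightarrow> complex) \<Rightarrow> ('a \<Rightarrow> complex) \<Rightarrow> complex" where
  "L2_inner M f g = (\<integral>x. f x * cnj (g x) \<partial>M)"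

text \<open>
  The basis is indexed by the positive integers; the value at index \<open>0\<close> is irrelevant.
  Completeness is convergence of the Fourier expansion in the \<open>L\<^sup>2\<close> norm.
\<close>

definition L2_orthonormal_basis :: "'a measure \<Rightarrow> (nat \<Rightarrow> 'a \<Rightarrow> complex) \<Rightarrow> bool" where
  "L2_orthonormal_basis M \<phi> \<longleftrightarrow>
     (\<forall>j\<ge>1. \<phi> j \<in> L2_fun M) \<and>
     (\<forall>i\<ge>1. \<forall>j\<ge>1. L2_inner M (\<phi> i) (\<phi> j) = (if i = j then 1 else 0)) \<and>
     (\<forall>f\<in>L2_fun M.
        (\<lambda>N. \<integral>x. (cmod (f x - (\<Sum>j=1..N. L2_inner M f (\<phi> j) * \<phi> j x)))\<^sup>2 \<partial>M)
          \<longlonglongrightarrow> 0)"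

text \<open>
  The integral formula for the Fourier transform requires \<open>u\<close> to be integrable.  Below it is
  applied only to \<open>L\<^sup>2\<close> functions vanishing a.e. outside a bounded set, which are integrable.
\<close>

definition fourier :: "(real^'n \<Rightarrow> complex) \<Rightarrow> real^'n \<Rightarrow> complex" where
  "fourier u \<xi> =
     complex_of_real ((2 * pi) powr (- (real CARD('n) / 2))) *
     (\<integral>x. u x * exp (- \<i> * complex_of_real (x \<bullet> \<xi>)) \<partial>lborel)"

definition energy_space :: "real \<Rightarrow> (real^'n) set \<Rightarrow> (real^'n \<Rightarrow> complex) set" where
  "energy_space s \<Omega> =
     {u \<in> L2_fun lborel.
        (AE x in lborel. x \<notin> \<Omega> \<longrightarrow> u x = 0) \<and>
        integrable lborel
          (\<lambda>\<xi>. norm \<xi> powr (2 * s) * \<bar>ln ((norm \<xi>)\<^sup>2)\<bar> * (cmod (fourier u \<xi>))\<^sup>2)}"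

definition energy_form ::
    "real \<Rightarrow> (real^'n \<Rightarrow> complex) \<Rightarrow> (real^'n \<Rightarrow> complex) \<Rightarrow> complex" where
  "energy_form s u v =
     (\<integral>\<xi>. complex_of_real (norm \<xi> powr (2 * s) * ln ((norm \<xi>)\<^sup>2)) *
            fourier u \<xi> * cnj (fourier v \<xi>) \<partial>lborel)"

text \<open>
  \<open>lam 1 \<le> lam 2 \<le> \<dots>\<close> is the sequence of Dirichlet eigenvalues, listed with multiplicity, of the
  operator with symbol \<open>|\<xi>|\<^sup>2\<^sup>s ln |\<xi>|\<^sup>2\<close> on \<open>\<Omega>\<close>.  This determines \<open>lam\<close> on the positive integers;
  \<open>lam 0\<close> is irrelevant.
\<close>

definition dirichlet_eigenvalues :: "real \<Rightarrow> (real^'n) set \<Rightarrow> (nat \<Rightarrow> real) \<Rightarrow> bool" where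
  "dirichlet_eigenvalues s \<Omega> lam \<longleftrightarrow>
     mono_on {1..} lam \<and> filterlim lam at_top sequentially \<and>
     (\<exists>\<phi>. L2_orthonormal_basis (restrict_space lborel \<Omega>) \<phi> \<and>
          (\<forall>j\<ge>1. \<phi> j \<in> energy_space s \<Omega> \<and>
             (\<forall>v\<in>energy_space s \<Omega>.
                energy_form s (\<phi> j) v =
                  complex_of_real (lam j) * L2_inner (restrict_space lborel \<Omega>) (\<phi> j) v)))"

definition boundary_layer :: "(real^'n) set \<Rightarrow> real \<Rightarrow> (real^'n) set" where
  "boundary_layer \<Omega> t = {x \<in> \<Omega>. infdist x (frontier \<Omega>) < t}"

end

theory Submission
  imports Defs "HOL-Probability.Characteristic_Functions"
begin

text \<open>
  This is Kroger's averaged variational argument with the modulated cutoffs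
  \<open>g\<^sub>z(x) = w(x) e\<^sup>i\<^sup>x\<^sup>\<cdot>\<^sup>z\<close> as trial functions, where \<open>w\<close> equals 1 on \<open>\<Omega>\<close> outside a boundary layer of width
  \<open>\<sigma> = k\<^sup>-\<^sup>1\<^sup>/\<^sup>n\<close>.  Subtracting from \<open>g\<^sub>z\<close> its projection on the first \<open>k\<close> eigenfunctions \<open>\<phi>\<^sub>j\<close> gives
  \<open>\<E>(g\<^sub>z, g\<^sub>z) \<ge> \<lambda>\<^sub>k\<^sub>+\<^sub>1 \<parallel>w\<parallel>\<^sup>2 + \<Sum>\<^sub>j\<^sub>\<le>\<^sub>k (\<lambda>\<^sub>j - \<lambda>\<^sub>k\<^sub>+\<^sub>1) |\<langle>g\<^sub>z, \<phi>\<^sub>j\<rangle>|\<^sup>2\<close>.  Integrate over \<open>|z| < R\<close>: Bessel's inequality for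
  \<open>w \<phi>\<^sub>j\<close> bounds the integral of each \<open>|\<langle>g\<^sub>z, \<phi>\<^sub>j\<rangle>|\<^sup>2\<close> by \<open>(2\<pi>)\<^sup>n\<close>, and \<open>R\<close> is chosen so that the terms with
  \<open>\<lambda>\<^sub>k\<^sub>+\<^sub>1\<close> cancel, i.e. \<open>\<omega>\<^sub>n R\<^sup>n \<parallel>w\<parallel>\<^sup>2 = (2\<pi>)\<^sup>n k\<close>.  On the other side \<open>\<E>(g\<^sub>z, g\<^sub>z)\<close> exceeds
  \<open>2 ln R |z|\<^sup>2\<^sup>s \<parallel>w\<parallel>\<^sup>2\<close> by at most a multiple of \<open>R\<^sup>2\<^sup>s\<close>, because the layer condition makes
  \<open>\<integral> |\<eta>|\<^sup>2 |\<F>w(\<eta>)|\<^sup>2 d\<eta>\<close> of order \<open>1/\<sigma>\<close>, hence of order \<open>R\<close>.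
\<close>

section \<open>Bessel's inequality for the Fourier transform\<close>

text \<open>The main term carries the factor ln k, so an error that multiplies it must be of
  relative size O(1/ln k); o(1) would not do. This shapes every estimate. The logarithm is isolated
  exactly, by bounding the symbol at frequencies rescaled by R, so that ln R meets only |xi|^(2s).
  The passage from |eta+z|^(2s) to |z|^(2s) costs a relative error R^(-1/2), a power that beats ln
  R. The mass lost in the layer is a relative error of order sigma, again a negative power of k. The
  width is a balance: the second moment of the transform of w is of order 1/sigma and enters with
  the factor R^(2s-1), so sigma of order 1/R gives R^(2s). The leading constant arises because
  |z|^(2s) averages to n/(n+2s) R^(2s) over the ball, while n ln R = ln k + O(1). Bessel's
  inequality suffices, without Plancherel: wherever a norm of a transform is replaced by the norm of
  the function, the sign of the coefficient is the favourable one.\<close>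

text \<open>Lebesgue measure is the image of the product of one-dimensional Lebesgue measures under
  the coordinate map, so functions that factor over the coordinates integrate factor by factor. This
  reduces Gaussians to dimension one.\<close>

lemma
  fixes f :: "'a::euclidean_space \<Rightarrow> real \<Rightarrow> complex"
  assumes f: "\<And>b. b \<in> Basis \<Longrightarrow> integrable lborel (f b)"
  shows integrable_lborel_prod: "integrable lborel (\<lambda>x::'a. \<Prod>b\<in>Basis. f b (x \<bullet> b))"
    and integral_lborel_prod:
      "(\<integral>x. (\<Prod>b\<in>Basis. f b (x \<bullet> b)) \<partial>(lborel :: 'a measure)) = (\<Prod>b\<in>Basis. \<integral>x. f b x \<partial>lborel)"
proof -
  interpret product_sigma_finite "\<lambda>_::'a. lborel :: real measure" ..
  have m: "(\<lambda>x::'a. \<Prod>b\<in>Basis. f b (x \<bullet> b)) \<in> borel_measurable borel"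
    using f by (intro borel_measurable_prod measurable_compose[OF _ borel_measurable_integrable, of _ _ lborel])
      auto
  have eq: "(\<Prod>b\<in>Basis. f b ((\<Sum>c\<in>Basis. g c *\<^sub>R c) \<bullet> b)) = (\<Prod>b\<in>Basis. f b (g b))" for g :: "'a \<Rightarrow> real"
    by (intro prod.cong) auto
  show "integrable lborel (\<lambda>x::'a. \<Prod>b\<in>Basis. f b (x \<bullet> b))"
    by (subst lborel_eq, subst integrable_distr_eq)
      (use m f in \<open>auto simp: eq intro!: product_integrable_prod\<close>)
  show "(\<integral>x. (\<Prod>b\<in>Basis. f b (x \<bullet> b)) \<partial>(lborel :: 'a measure)) = (\<Prod>b\<in>Basis. \<integral>x. f b x \<partial>lborel)"
    by (subst lborel_eq, subst integral_distr)
      (use m f in \<open>auto simp: eq intro!: product_integral_prod\<close>)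
qed

section \<open>Gaussians and their Fourier transforms\<close>

text \<open>The integral is the characteristic function of the standard normal distribution at
  \<open>- t\<close>, up to the factor \<open>sqrt (2 * pi)\<close> that turns the density into the
  plain Gaussian.\<close>

lemma std_gauss_fourier:
  "integrable lborel (\<lambda>x. complex_of_real (exp (- x\<^sup>2 / 2)) * exp (- \<i> * of_real (t * x)))"
  "(\<integral>x. complex_of_real (exp (- x\<^sup>2 / 2)) * exp (- \<i> * of_real (t * x)) \<partial>lborel) =
     of_real (sqrt (2 * pi) * exp (- t\<^sup>2 / 2))"
proof -
  have e: "complex_of_real (exp (- x\<^sup>2 / 2)) * exp (- \<i> * of_real (t * x)) =
      of_real (sqrt (2 * pi)) * (std_normal_density x *\<^sub>R iexp ((- t) * x))" for x
    by (simp add: std_normal_density_def scaleR_conv_of_real)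
  have i: "integrable std_normal_distribution (\<lambda>x. iexp ((- t) * x))"
    by (intro prob_space.integrable_iexp real_distribution.axioms(1) real_dist_normal_dist) auto
  then have i': "integrable lborel (\<lambda>x. std_normal_density x *\<^sub>R iexp ((- t) * x))"
    by (subst (asm) integrable_density) (auto simp: normal_density_nonneg)
  show "integrable lborel (\<lambda>x. complex_of_real (exp (- x\<^sup>2 / 2)) * exp (- \<i> * of_real (t * x)))"
    unfolding e by (intro integrable_mult_right i')
  have eq: "(\<integral>x. std_normal_density x *\<^sub>R iexp ((- t) * x) \<partial>lborel) = of_real (exp (- t\<^sup>2 / 2))"
  proof -
    have "(\<integral>x. std_normal_density x *\<^sub>R iexp ((- t) * x) \<partial>lborel) = char std_normal_distribution (- t)"
      unfolding char_def by (subst integral_density) (auto simp: normal_density_nonneg)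
    also have "\<dots> = of_real (exp (- t\<^sup>2 / 2))"
      by (simp add: char_std_normal_distribution)
    finally show ?thesis .
  qed
  have "(\<integral>x. complex_of_real (exp (- x\<^sup>2 / 2)) * exp (- \<i> * of_real (t * x)) \<partial>lborel) =
     (\<integral>x. of_real (sqrt (2 * pi)) * (std_normal_density x *\<^sub>R iexp ((- t) * x)) \<partial>lborel)"
    by (rule Bochner_Integration.integral_cong[OF refl e])
  also have "\<dots> = of_real (sqrt (2 * pi)) * of_real (exp (- t\<^sup>2 / 2))"
    by (simp only: integral_mult_right_zero eq)
  finally show "(\<integral>x. complex_of_real (exp (- x\<^sup>2 / 2)) * exp (- \<i> * of_real (t * x)) \<partial>lborel) =
     of_real (sqrt (2 * pi) * exp (- t\<^sup>2 / 2))"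
    by (simp only: of_real_mult)
qed

lemma gauss_fourier_real:
  assumes a: "a > 0"
  shows "integrable lborel (\<lambda>x. complex_of_real (exp (- (a * x)\<^sup>2 / 2)) * exp (- \<i> * of_real (t * x)))"
  "(\<integral>x. complex_of_real (exp (- (a * x)\<^sup>2 / 2)) * exp (- \<i> * of_real (t * x)) \<partial>lborel) =
     of_real (sqrt (2 * pi) / a * exp (- (t / a)\<^sup>2 / 2))"
proof -
  let ?f = "\<lambda>x. complex_of_real (exp (- x\<^sup>2 / 2)) * exp (- \<i> * of_real (t / a * x))"
  have e: "complex_of_real (exp (- (a * x)\<^sup>2 / 2)) * exp (- \<i> * of_real (t * x)) = ?f (0 + a * x)" for x
    using a by simp
  show "integrable lborel (\<lambda>x. complex_of_real (exp (- (a * x)\<^sup>2 / 2)) * exp (- \<i> * of_real (t * x)))"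
    unfolding e by (intro lborel_integrable_real_affine std_gauss_fourier) (use a in auto)
  have "integral\<^sup>L lborel ?f = a *\<^sub>R (\<integral>x. ?f (0 + a * x) \<partial>lborel)"
    using lborel_integral_real_affine[of a ?f 0] a by simp
  then show "(\<integral>x. complex_of_real (exp (- (a * x)\<^sup>2 / 2)) * exp (- \<i> * of_real (t * x)) \<partial>lborel) =
     of_real (sqrt (2 * pi) / a * exp (- (t / a)\<^sup>2 / 2))"
    using a unfolding e std_gauss_fourier by (simp add: scaleR_conv_of_real field_simps)
qed

lemma
  fixes t :: "'a::euclidean_space"
  assumes a: "a > 0"
  shows integrable_gauss_fourier:
      "integrable lborel (\<lambda>x::'a. complex_of_real (exp (- (a * norm x)\<^sup>2 / 2)) * exp (- \<i> * of_real (x \<bullet> t)))"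
    and integral_gauss_fourier:
      "(\<integral>x. complex_of_real (exp (- (a * norm x)\<^sup>2 / 2)) * exp (- \<i> * of_real (x \<bullet> t)) \<partial>(lborel :: 'a measure)) =
       of_real ((sqrt (2 * pi) / a) ^ DIM('a) * exp (- (norm t / a)\<^sup>2 / 2))"
proof -
  let ?f = "\<lambda>(b::'a) x. complex_of_real (exp (- (a * x)\<^sup>2 / 2)) * exp (- \<i> * of_real ((t \<bullet> b) * x))"
  have n: "(norm x)\<^sup>2 = (\<Sum>b\<in>Basis. (x \<bullet> b)\<^sup>2)" for x :: 'a
    unfolding power2_norm_eq_inner by (subst euclidean_inner) (simp add: power2_eq_square)
  have e: "exp (- (c * norm x)\<^sup>2 / 2) = (\<Prod>b\<in>Basis. exp (- (c * (x \<bullet> b))\<^sup>2 / 2))" for x :: 'a and c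
    by (simp add: power_mult_distrib n flip: exp_sum)
       (simp add: sum_divide_distrib sum_distrib_left sum_negf)
  have e2: "complex_of_real (exp (- (a * norm x)\<^sup>2 / 2)) * exp (- \<i> * of_real (x \<bullet> t)) =
      (\<Prod>b\<in>Basis. ?f b (x \<bullet> b))" for x
  proof -
    have "exp (- \<i> * of_real (x \<bullet> t)) = (\<Prod>b\<in>Basis. exp (- \<i> * of_real ((t \<bullet> b) * (x \<bullet> b))))"
      by (subst euclidean_inner) (simp add: sum_distrib_left mult.commute sum_negf exp_sum[symmetric])
    then show ?thesis by (simp only: e of_real_prod prod.distrib)
  qed
  show "integrable lborel (\<lambda>x::'a. complex_of_real (exp (- (a * norm x)\<^sup>2 / 2)) * exp (- \<i> * of_real (x \<bullet> t)))"
    unfolding e2 by (intro integrable_lborel_prod gauss_fourier_real a)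
  have "(\<integral>x. complex_of_real (exp (- (a * norm x)\<^sup>2 / 2)) * exp (- \<i> * of_real (x \<bullet> t)) \<partial>(lborel :: 'a measure))
     = (\<Prod>b\<in>(Basis::'a set). of_real (sqrt (2 * pi) / a * exp (- ((t \<bullet> b) / a)\<^sup>2 / 2)))"
    unfolding e2 by (subst integral_lborel_prod) (auto simp only: gauss_fourier_real[OF a])
  also have "\<dots> = of_real ((sqrt (2 * pi) / a) ^ DIM('a) * exp (- (norm t / a)\<^sup>2 / 2))"
  proof -
    have "(\<Prod>b\<in>(Basis::'a set). sqrt (2 * pi) / a * exp (- ((t \<bullet> b) / a)\<^sup>2 / 2)) =
        (sqrt (2 * pi) / a) ^ DIM('a) * (\<Prod>b\<in>(Basis::'a set). exp (- ((t \<bullet> b) / a)\<^sup>2 / 2))"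
      by (simp only: prod.distrib prod_constant)
    also have "(\<Prod>b\<in>(Basis::'a set). exp (- ((t \<bullet> b) / a)\<^sup>2 / 2)) = exp (- (norm t / a)\<^sup>2 / 2)"
      using e[of "1 / a" t] by simp
    finally show ?thesis by (simp only: of_real_prod[symmetric])
  qed
  finally show "(\<integral>x. complex_of_real (exp (- (a * norm x)\<^sup>2 / 2)) * exp (- \<i> * of_real (x \<bullet> t)) \<partial>(lborel :: 'a measure)) =
       of_real ((sqrt (2 * pi) / a) ^ DIM('a) * exp (- (norm t / a)\<^sup>2 / 2))" .
qed

lemma
  assumes a: "a > 0"
  shows integrable_gauss: "integrable lborel (\<lambda>x::'a::euclidean_space. exp (- (a * norm x)\<^sup>2 / 2))"
    and integral_gauss:
      "(\<integral>x. exp (- (a * norm x)\<^sup>2 / 2) \<partial>(lborel :: 'a measure)) = (sqrt (2 * pi) / a) ^ DIM('a)"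
proof -
  have "integrable lborel (\<lambda>x::'a. complex_of_real (exp (- (a * norm x)\<^sup>2 / 2)))"
    using integrable_gauss_fourier[OF a, of 0] by simp
  then show "integrable lborel (\<lambda>x::'a::euclidean_space. exp (- (a * norm x)\<^sup>2 / 2))"
    using complex_of_real_integrable_eq by blast
  show "(\<integral>x. exp (- (a * norm x)\<^sup>2 / 2) \<partial>(lborel :: 'a measure)) = (sqrt (2 * pi) / a) ^ DIM('a)"
    using integral_gauss_fourier[OF a, of "0::'a"] 
    by (simp del: of_real_mult of_real_power of_real_divide)
qed

section \<open>Translation invariance and product integrability\<close>

lemma nn_integral_lborel_shift:
  fixes f :: "'a::euclidean_space \<Rightarrow> ennreal"
  assumes [measurable]: "f \<in> borel_measurable borel"
  shows "(\<integral>\<^sup>+x. f (x + c) \<partial>lborel) = (\<integral>\<^sup>+x. f x \<partial>lborel)"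
proof -
  have "(\<integral>\<^sup>+x. f x \<partial>lborel) = (\<integral>\<^sup>+x. f x \<partial>distr lborel borel ((+) c))"
    by (simp add: lborel_distr_plus)
  also have "\<dots> = (\<integral>\<^sup>+x. f (x + c) \<partial>lborel)"
    by (subst nn_integral_distr) (auto simp: add.commute)
  finally show ?thesis ..
qed

lemma
  fixes f :: "'a::euclidean_space \<Rightarrow> 'b::{banach, second_countable_topology}"
  shows integrable_lborel_shift: "integrable lborel f \<Longrightarrow> integrable lborel (\<lambda>x. f (x + c))"
    and integral_lborel_shift: "(\<integral>x. f (x + c) \<partial>lborel) = (\<integral>x. f x \<partial>lborel)"
proof -
  have i: "integrable lborel (\<lambda>x. f (x + c))" if "integrable lborel f"
      for f :: "'a \<Rightarrow> 'b" and c
  proof -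
    from that have [measurable]: "f \<in> borel_measurable borel"
      by (auto dest: borel_measurable_integrable)
    from that have "integrable (distr lborel borel ((+) c)) f"
      by (simp add: lborel_distr_plus)
    then show "integrable lborel (\<lambda>x. f (x + c))"
      by (subst (asm) integrable_distr_eq) (auto simp: add.commute)
  qed
  then show "integrable lborel f \<Longrightarrow> integrable lborel (\<lambda>x. f (x + c))" .
  show "(\<integral>x. f (x + c) \<partial>lborel) = (\<integral>x. f x \<partial>lborel)"
  proof (cases "integrable lborel f")
    case True
    then have [measurable]: "f \<in> borel_measurable borel"
      by (auto dest: borel_measurable_integrable)
    have "(\<integral>x. f x \<partial>lborel) = (\<integral>x. f x \<partial>distr lborel borel ((+) c))"
      by (simp add: lborel_distr_plus)
    also have "\<dots> = (\<integral>x. f (x + c) \<partial>lborel)"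
      by (subst integral_distr) (auto simp: add.commute)
    finally show ?thesis ..
  next
    case False
    then have "\<not> integrable lborel (\<lambda>x. f (x + c))"
      using i[of "\<lambda>x. f (x + c)" "- c"] by auto
    with False show ?thesis by (simp add: not_integrable_integral_eq)
  qed
qed

lemma (in pair_sigma_finite) integrable_prod_mult:
  fixes f :: "'a \<Rightarrow> 'c::{real_normed_algebra, banach, second_countable_topology}"
  assumes f: "integrable M1 f" and g: "integrable M2 g"
  shows "integrable (M1 \<Otimes>\<^sub>M M2) (\<lambda>(x, y). f x * g y)"
proof (rule integrableI_bounded)
  have [measurable]: "f \<in> borel_measurable M1" "g \<in> borel_measurable M2"
    using f g by auto
  show "(\<lambda>(x, y). f x * g y) \<in> borel_measurable (M1 \<Otimes>\<^sub>M M2)" by measurable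
  have "(\<integral>\<^sup>+z. norm (case z of (x, y) \<Rightarrow> f x * g y) \<partial>(M1 \<Otimes>\<^sub>M M2)) \<le>
    (\<integral>\<^sup>+z. (case z of (x, y) \<Rightarrow> ennreal (norm (f x)) * ennreal (norm (g y))) \<partial>(M1 \<Otimes>\<^sub>M M2))"
    by (intro nn_integral_mono) (auto simp: norm_mult_ineq ennreal_leI simp flip: ennreal_mult)
  also have "\<dots> = (\<integral>\<^sup>+x. norm (f x) \<partial>M1) * (\<integral>\<^sup>+y. norm (g y) \<partial>M2)"
    by (simp add: M2.nn_integral_fst[symmetric] nn_integral_cmult nn_integral_multc)
  also have "\<dots> < \<infinity>"
    using f g by (auto simp: integrable_iff_bounded ennreal_mult_less_top)
  finally show "(\<integral>\<^sup>+z. norm (case z of (x, y) \<Rightarrow> f x * g y) \<partial>(M1 \<Otimes>\<^sub>M M2)) < \<infinity>" .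
qed

lemma borel_measurable_cnj [measurable (raw)]:
  "f \<in> borel_measurable M \<Longrightarrow> (\<lambda>x. cnj (f x)) \<in> borel_measurable M"
  by (rule measurable_compose[OF _ borel_measurable_continuous_onI[OF continuous_on_cnj[OF continuous_on_id]]])

section \<open>Bessel's inequality by Gaussian damping\<close>

lemma fourier_measurable [measurable]:
  fixes u :: "real^'n \<Rightarrow> complex"
  assumes [measurable]: "u \<in> borel_measurable borel"
  shows "fourier u \<in> borel_measurable borel"
proof -
  have "(\<lambda>\<xi>. \<integral>x. u x * exp (- \<i> * complex_of_real (x \<bullet> \<xi>)) \<partial>lborel) \<in> borel_measurable borel"
    by (rule lborel.borel_measurable_lebesgue_integral) measurable
  then show ?thesis
    unfolding fourier_def[abs_def] by measurable
qed

lemma integrable_fourier_integrand: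
  fixes u :: "real^'n \<Rightarrow> complex"
  assumes "integrable lborel u"
  shows "integrable lborel (\<lambda>x. u x * exp (- \<i> * complex_of_real (x \<bullet> \<xi>)))"
  by (rule Bochner_Integration.integrable_bound[OF assms])
    (use assms in \<open>auto simp: norm_mult dest: borel_measurable_integrable\<close>)

lemma norm_integral_le_nn_integral:
  fixes f :: "'a \<Rightarrow> 'b::{banach, second_countable_topology}"
  shows "ennreal (norm (\<integral>x. f x \<partial>M)) \<le> (\<integral>\<^sup>+x. norm (f x) \<partial>M)"
  by (cases "integrable M f") (auto intro: integral_norm_bound_ennreal simp: not_integrable_integral_eq)

text \<open>Schur's test: the product of the two moduli is at most half the sum of their squares,
  and the kernel is symmetric with the same total mass \<open>(sqrt (2 * pi) * a) ^ DIM('a)\<close>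
  in either variable, so each half contributes equally.\<close>

lemma gauss_quadratic_form_bound:
  fixes u :: "'a::euclidean_space \<Rightarrow> complex"
  assumes a: "a > 0" and [measurable]: "u \<in> borel_measurable borel"
  shows "(\<integral>\<^sup>+x. \<integral>\<^sup>+y. cmod (u x) * cmod (u y) * exp (- (norm (x - y) / a)\<^sup>2 / 2) \<partial>lborel \<partial>lborel)
    \<le> (sqrt (2 * pi) * a) ^ DIM('a) * (\<integral>\<^sup>+x. (cmod (u x))\<^sup>2 \<partial>lborel)"
proof -
  define K where "K z = exp (- (norm z / a)\<^sup>2 / 2)" for z :: 'a
  have K_int: "(\<integral>\<^sup>+y. K (x - y) \<partial>lborel) = (sqrt (2 * pi) * a) ^ DIM('a)" for x
  proof -
    have "K (x - y) = K (y + (- x))" for y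
      by (simp add: K_def norm_minus_commute)
    then have "(\<integral>\<^sup>+y. K (x - y) \<partial>lborel) = (\<integral>\<^sup>+y. K (y + (- x)) \<partial>lborel)" by simp
    also have "\<dots> = (\<integral>\<^sup>+y. K y \<partial>lborel)"
      by (intro nn_integral_lborel_shift) (simp add: K_def)
    also have "\<dots> = ennreal (\<integral>y. K y \<partial>lborel)"
      using integrable_gauss[of "1 / a", where 'a='a] a
      by (intro nn_integral_eq_integral) (auto simp: K_def)
    also have "\<dots> = (sqrt (2 * pi) * a) ^ DIM('a)"
      using integral_gauss[of "1 / a", where 'a='a] a by (simp add: K_def)
    finally show ?thesis .
  qed
  have K_int': "(\<integral>\<^sup>+x. K (x - y) \<partial>lborel) = (sqrt (2 * pi) * a) ^ DIM('a)" for y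
    using K_int[of y] by (simp add: K_def norm_minus_commute)
  have [measurable]: "K \<in> borel_measurable borel" unfolding K_def[abs_def] by measurable
  have [simp]: "0 \<le> K z" for z by (simp add: K_def)
  let ?I = "\<integral>\<^sup>+x. (cmod (u x))\<^sup>2 \<partial>lborel"
  have "(\<integral>\<^sup>+x. \<integral>\<^sup>+y. cmod (u x) * cmod (u y) * K (x - y) \<partial>lborel \<partial>lborel) \<le>
    (\<integral>\<^sup>+x. \<integral>\<^sup>+y. ennreal ((cmod (u x))\<^sup>2 / 2) * K (x - y) + ennreal ((cmod (u y))\<^sup>2 / 2) * K (x - y) \<partial>lborel \<partial>lborel)"
  proof (intro nn_integral_mono)
    fix x y
    have "cmod (u x) * cmod (u y) * K (x - y) \<le> ((cmod (u x))\<^sup>2 / 2 + (cmod (u y))\<^sup>2 / 2) * K (x - y)"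
      using sum_squares_bound[of "cmod (u x)" "cmod (u y)"] by (intro mult_right_mono) auto
    then show "ennreal (cmod (u x) * cmod (u y) * K (x - y)) \<le>
        ennreal ((cmod (u x))\<^sup>2 / 2) * K (x - y) + ennreal ((cmod (u y))\<^sup>2 / 2) * K (x - y)"
      by (simp add: ennreal_leI distrib_right flip: ennreal_mult ennreal_plus)
  qed
  also have "\<dots> = (\<integral>\<^sup>+x. ennreal ((cmod (u x))\<^sup>2 / 2) * (\<integral>\<^sup>+y. K (x - y) \<partial>lborel) \<partial>lborel) +
      (\<integral>\<^sup>+x. \<integral>\<^sup>+y. ennreal ((cmod (u y))\<^sup>2 / 2) * K (x - y) \<partial>lborel \<partial>lborel)"
    by (simp add: nn_integral_add nn_integral_cmult)
  also have "(\<integral>\<^sup>+x. \<integral>\<^sup>+y. ennreal ((cmod (u y))\<^sup>2 / 2) * K (x - y) \<partial>lborel \<partial>lborel) =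
      (\<integral>\<^sup>+y. \<integral>\<^sup>+x. ennreal ((cmod (u y))\<^sup>2 / 2) * K (x - y) \<partial>lborel \<partial>lborel)"
    by (rule lborel_pair.Fubini') measurable
  also have "\<dots> = (\<integral>\<^sup>+y. ennreal ((cmod (u y))\<^sup>2 / 2) * (\<integral>\<^sup>+x. K (x - y) \<partial>lborel) \<partial>lborel)"
    by (simp add: nn_integral_cmult)
  also have "(\<integral>\<^sup>+x. ennreal ((cmod (u x))\<^sup>2 / 2) * (\<integral>\<^sup>+y. K (x - y) \<partial>lborel) \<partial>lborel) + \<dots> =
      ((\<integral>\<^sup>+x. ennreal ((cmod (u x))\<^sup>2 / 2) \<partial>lborel) + (\<integral>\<^sup>+x. ennreal ((cmod (u x))\<^sup>2 / 2) \<partial>lborel)) * (sqrt (2 * pi) * a) ^ DIM('a)"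
    unfolding K_int K_int' by (simp add: nn_integral_multc distrib_right)
  also have "(\<integral>\<^sup>+x. ennreal ((cmod (u x))\<^sup>2 / 2) \<partial>lborel) + (\<integral>\<^sup>+x. ennreal ((cmod (u x))\<^sup>2 / 2) \<partial>lborel) = ?I"
    by (subst nn_integral_add[symmetric]) (auto simp flip: ennreal_plus)
  finally show ?thesis by (simp add: K_def mult.commute)
qed

text \<open>The damping factor makes the double integral hidden in the squared modulus of the
  transform absolutely convergent. Fubini then lets the frequency be integrated out first, which
  leaves a quadratic form in \<open>u\<close> with the Gaussian kernel \<open>K (x - y)\<close>, and
  Schur's test bounds it. The right-hand side does not depend on \<open>a\<close>, which is what
  allows the damping to be removed.\<close>

lemma fourier_gauss_bound:
  fixes u :: "real^'n \<Rightarrow> complex"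
  assumes u: "integrable lborel u" and a: "a > 0"
  shows "(\<integral>\<^sup>+\<xi>. exp (- (a * norm \<xi>)\<^sup>2 / 2) * (cmod (fourier u \<xi>))\<^sup>2 \<partial>lborel) \<le> (\<integral>\<^sup>+x. (cmod (u x))\<^sup>2 \<partial>lborel)"
proof -
  define n where "n = CARD('n)"
  define F where "F \<xi> = (\<integral>x. u x * exp (- \<i> * complex_of_real (x \<bullet> \<xi>)) \<partial>lborel)" for \<xi>
  define h where "h \<xi> = complex_of_real (exp (- (a * norm \<xi>)\<^sup>2 / 2))" for \<xi> :: "real^'n"
  define K where "K z = (\<integral>\<xi>. h \<xi> * exp (- \<i> * complex_of_real (\<xi> \<bullet> z)) \<partial>lborel)" for z :: "real^'n"
  have K: "K z = of_real ((sqrt (2 * pi) / a) ^ n * exp (- (norm z / a)\<^sup>2 / 2))" for z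
    unfolding K_def h_def n_def by (subst integral_gauss_fourier[OF a]) simp
  have [measurable]: "u \<in> borel_measurable borel" using u by (auto dest: borel_measurable_integrable)
  have [measurable]: "h \<in> borel_measurable borel" unfolding h_def[abs_def] by measurable
  have [measurable]: "F \<in> borel_measurable borel"
    unfolding F_def[abs_def] by (rule lborel.borel_measurable_lebesgue_integral) measurable
  have h_int: "integrable lborel h"
    using integrable_gauss[OF a, where 'a="real^'n"] by (simp add: h_def[abs_def])
  define B where "B = (\<integral>x. cmod (u x) \<partial>lborel)"
  have F_le: "cmod (F \<xi>) \<le> B" for \<xi>
    using integral_norm_bound[of lborel "\<lambda>x. u x * exp (- \<i> * complex_of_real (x \<bullet> \<xi>))"]
    by (simp add: F_def B_def norm_mult)
  have F_le': "cmod (F \<xi>) \<le> \<bar>B\<bar>" for \<xi>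
    using F_le[of \<xi>] by linarith
  have hF_int: "integrable lborel (\<lambda>\<xi>. h \<xi> * cnj (F \<xi>))"
  proof (rule Bochner_Integration.integrable_bound)
    show "integrable lborel (\<lambda>\<xi>. of_real B * h \<xi>)" using h_int by simp
    show "AE \<xi> in lborel. norm (h \<xi> * cnj (F \<xi>)) \<le> norm (of_real B * h \<xi>)"
      using F_le' by (auto simp: norm_mult mult.commute[of "\<bar>B\<bar>"] intro!: mult_left_mono)
  qed measurable
  have I1: "integrable (lborel \<Otimes>\<^sub>M lborel) (\<lambda>(\<xi>, x). (h \<xi> * cnj (F \<xi>)) * (u x * exp (- \<i> * complex_of_real (x \<bullet> \<xi>))))"
    by (rule Bochner_Integration.integrable_bound[OF lborel_pair.integrable_prod_mult[OF hF_int u]])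
      (auto simp: norm_mult)
  have I2: "integrable (lborel \<Otimes>\<^sub>M lborel)
      (\<lambda>(\<xi>, y). (h \<xi> * exp (- \<i> * complex_of_real (x \<bullet> \<xi>))) * (cnj (u y * exp (- \<i> * complex_of_real (y \<bullet> \<xi>)))))" for x :: "real^'n"
    by (rule Bochner_Integration.integrable_bound[OF lborel_pair.integrable_prod_mult[OF h_int u]])
      (auto simp: norm_mult)
  have conv: "(\<integral>\<xi>. h \<xi> * cnj (F \<xi>) * exp (- \<i> * complex_of_real (x \<bullet> \<xi>)) \<partial>lborel) =
      (\<integral>y. cnj (u y) * K (x - y) \<partial>lborel)" for x
  proof -
    have "(\<integral>\<xi>. h \<xi> * cnj (F \<xi>) * exp (- \<i> * complex_of_real (x \<bullet> \<xi>)) \<partial>lborel) =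
       (\<integral>\<xi>. \<integral>y. (h \<xi> * exp (- \<i> * complex_of_real (x \<bullet> \<xi>))) * (cnj (u y * exp (- \<i> * complex_of_real (y \<bullet> \<xi>)))) \<partial>lborel \<partial>lborel)"
      unfolding integral_mult_right_zero Bochner_Integration.integral_cnj F_def by (simp only: mult_ac)
    also have "\<dots> = (\<integral>y. \<integral>\<xi>. (h \<xi> * exp (- \<i> * complex_of_real (x \<bullet> \<xi>))) * (cnj (u y * exp (- \<i> * complex_of_real (y \<bullet> \<xi>)))) \<partial>lborel \<partial>lborel)"
      by (rule lborel_pair.Fubini_integral[OF I2, symmetric])
    also have "\<dots> = (\<integral>y. \<integral>\<xi>. cnj (u y) * (h \<xi> * exp (- \<i> * complex_of_real (\<xi> \<bullet> (x - y)))) \<partial>lborel \<partial>lborel)"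
    proof (intro Bochner_Integration.integral_cong refl)
      fix y \<xi> :: "real^'n"
      have c: "cnj (exp (- \<i> * complex_of_real (y \<bullet> \<xi>))) = exp (\<i> * complex_of_real (y \<bullet> \<xi>))"
        by (simp add: exp_cnj)
      have d: "exp (- \<i> * complex_of_real (x \<bullet> \<xi>)) * exp (\<i> * complex_of_real (y \<bullet> \<xi>)) =
          exp (- \<i> * complex_of_real (\<xi> \<bullet> (x - y)))"
        unfolding exp_add[symmetric] by (simp add: inner_diff_right inner_commute[of \<xi>] right_diff_distrib)
      have "(h \<xi> * exp (- \<i> * complex_of_real (x \<bullet> \<xi>))) * (cnj (u y * exp (- \<i> * complex_of_real (y \<bullet> \<xi>)))) =
          cnj (u y) * (h \<xi> * (exp (- \<i> * complex_of_real (x \<bullet> \<xi>)) * exp (\<i> * complex_of_real (y \<bullet> \<xi>))))"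
        unfolding complex_cnj_mult c by (simp only: mult_ac)
      then show "(h \<xi> * exp (- \<i> * complex_of_real (x \<bullet> \<xi>))) * (cnj (u y * exp (- \<i> * complex_of_real (y \<bullet> \<xi>)))) =
          cnj (u y) * (h \<xi> * exp (- \<i> * complex_of_real (\<xi> \<bullet> (x - y))))"
        unfolding d .
    qed
    also have "\<dots> = (\<integral>y. cnj (u y) * K (x - y) \<partial>lborel)"
      unfolding integral_mult_right_zero K_def ..
    finally show ?thesis .
  qed
  have main: "(\<integral>\<xi>. h \<xi> * (F \<xi> * cnj (F \<xi>)) \<partial>lborel) = (\<integral>x. u x * (\<integral>y. cnj (u y) * K (x - y) \<partial>lborel) \<partial>lborel)"
  proof -
    have "(\<integral>\<xi>. h \<xi> * (F \<xi> * cnj (F \<xi>)) \<partial>lborel) =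
        (\<integral>\<xi>. \<integral>x. (h \<xi> * cnj (F \<xi>)) * (u x * exp (- \<i> * complex_of_real (x \<bullet> \<xi>))) \<partial>lborel \<partial>lborel)"
      unfolding integral_mult_right_zero F_def by (simp only: mult_ac)
    also have "\<dots> = (\<integral>x. \<integral>\<xi>. (h \<xi> * cnj (F \<xi>)) * (u x * exp (- \<i> * complex_of_real (x \<bullet> \<xi>))) \<partial>lborel \<partial>lborel)"
      by (rule lborel_pair.Fubini_integral[OF I1, symmetric])
    also have "\<dots> = (\<integral>x. \<integral>\<xi>. u x * (h \<xi> * cnj (F \<xi>) * exp (- \<i> * complex_of_real (x \<bullet> \<xi>))) \<partial>lborel \<partial>lborel)"
      by (simp only: mult_ac)
    also have "\<dots> = (\<integral>x. u x * (\<integral>y. cnj (u y) * K (x - y) \<partial>lborel) \<partial>lborel)"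
      unfolding integral_mult_right_zero conv ..
    finally show ?thesis .
  qed
  define c where "c = (2 * pi) powr (- (real n / 2))"
  \<comment> \<open>The squared normalisation of the transform cancels exactly against the height of
    the kernel \<open>K\<close> and the mass of its Gaussian profile, so Bessel's inequality comes
    out with constant 1.\<close>
  have c2: "c\<^sup>2 * (sqrt (2 * pi) / a) ^ n * (sqrt (2 * pi) * a) ^ n = 1"
  proof -
    have "c\<^sup>2 = (2 * pi) powr (- real n)"
      unfolding c_def power2_eq_square powr_add[symmetric] by simp
    also have "\<dots> = inverse ((2 * pi) ^ n)"
      by (simp add: powr_minus powr_realpow)
    finally have "c\<^sup>2 * (2 * pi) ^ n = 1" by (metis left_inverse power_not_zero pi_gt_zero mult_pos_pos zero_less_numeral less_irrefl)
    moreover have "2 * pi = (sqrt (2 * pi) / a) * (sqrt (2 * pi) * a)" using a by simp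
    ultimately show ?thesis by (metis power_mult_distrib mult.assoc)
  qed
  define P where "P \<xi> = exp (- (a * norm \<xi>)\<^sup>2 / 2) * (cmod (F \<xi>))\<^sup>2" for \<xi>
  have P: "complex_of_real (P \<xi>) = h \<xi> * (F \<xi> * cnj (F \<xi>))" for \<xi>
    by (simp only: P_def h_def complex_norm_square of_real_mult)
  have [measurable]: "P \<in> borel_measurable borel" unfolding P_def[abs_def] by measurable
  have P_nonneg [simp]: "0 \<le> P \<xi>" for \<xi> by (simp add: P_def)
  have P_int: "integrable lborel P"
  proof (rule Bochner_Integration.integrable_bound)
    show "integrable lborel (\<lambda>\<xi>::real^'n. B\<^sup>2 * exp (- (a * norm \<xi>)\<^sup>2 / 2))"
      using integrable_gauss[OF a, where 'a="real^'n"] by simp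
    have "P \<xi> \<le> B\<^sup>2 * exp (- (a * norm \<xi>)\<^sup>2 / 2)" for \<xi>
      unfolding P_def mult.commute[of "B\<^sup>2"] by (intro mult_left_mono power_mono F_le) auto
    then show "AE \<xi> in lborel. norm (P \<xi>) \<le> norm (B\<^sup>2 * exp (- (a * norm \<xi>)\<^sup>2 / 2))" by simp
  qed measurable
  have "cmod (fourier u \<xi>) = c * cmod (F \<xi>)" for \<xi>
    by (simp add: fourier_def F_def norm_mult c_def n_def)
  then have "exp (- (a * norm \<xi>)\<^sup>2 / 2) * (cmod (fourier u \<xi>))\<^sup>2 = c\<^sup>2 * P \<xi>" for \<xi>
    by (simp add: P_def power_mult_distrib)
  then have "(\<integral>\<^sup>+\<xi>. exp (- (a * norm \<xi>)\<^sup>2 / 2) * (cmod (fourier u \<xi>))\<^sup>2 \<partial>lborel) =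
     (\<integral>\<^sup>+\<xi>. ennreal (c\<^sup>2) * P \<xi> \<partial>lborel)"
    by (simp only: ennreal_mult[OF zero_le_power2 P_nonneg])
  also have "\<dots> = ennreal (c\<^sup>2) * (\<integral>\<^sup>+\<xi>. P \<xi> \<partial>lborel)"
    by (simp add: nn_integral_cmult)
  also have "(\<integral>\<^sup>+\<xi>. P \<xi> \<partial>lborel) = ennreal (\<integral>\<xi>. P \<xi> \<partial>lborel)"
    by (intro nn_integral_eq_integral P_int) auto
  also have "(\<integral>\<xi>. P \<xi> \<partial>lborel) = norm (\<integral>\<xi>. h \<xi> * (F \<xi> * cnj (F \<xi>)) \<partial>lborel)"
    unfolding P[symmetric] integral_of_real by simp
  \<comment> \<open>From here on only moduli are kept. This discards the phases of \<open>u\<close>,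
    so the result is an inequality, which is all that is needed later.\<close>
  also have "ennreal \<dots> \<le> (\<integral>\<^sup>+x. norm (u x * (\<integral>y. cnj (u y) * K (x - y) \<partial>lborel)) \<partial>lborel)"
    unfolding main by (rule norm_integral_le_nn_integral)
  also have "\<dots> \<le> (\<integral>\<^sup>+x. \<integral>\<^sup>+y. ennreal ((sqrt (2 * pi) / a) ^ n) * (cmod (u x) * cmod (u y) * exp (- (norm (x - y) / a)\<^sup>2 / 2)) \<partial>lborel \<partial>lborel)"
  proof (intro nn_integral_mono)
    fix x
    have "ennreal (norm (u x * (\<integral>y. cnj (u y) * K (x - y) \<partial>lborel))) = cmod (u x) * ennreal (norm (\<integral>y. cnj (u y) * K (x - y) \<partial>lborel))"
      by (simp add: norm_mult ennreal_mult)
    also have "\<dots> \<le> cmod (u x) * (\<integral>\<^sup>+y. norm (cnj (u y) * K (x - y)) \<partial>lborel)"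
      by (intro mult_left_mono norm_integral_le_nn_integral) auto
    also have "\<dots> = (\<integral>\<^sup>+y. cmod (u x) * ennreal (norm (cnj (u y) * K (x - y))) \<partial>lborel)"
      unfolding K by (subst nn_integral_cmult) auto
    also have "\<dots> = (\<integral>\<^sup>+y. ennreal ((sqrt (2 * pi) / a) ^ n) * (cmod (u x) * cmod (u y) * exp (- (norm (x - y) / a)\<^sup>2 / 2)) \<partial>lborel)"
    proof (intro nn_integral_cong)
      fix y
      have "norm (cnj (u y) * K (x - y)) = cmod (u y) * ((sqrt (2 * pi) / a) ^ n * exp (- (norm (x - y) / a)\<^sup>2 / 2))"
        unfolding K norm_mult norm_of_real complex_mod_cnj using a by (simp add: abs_mult)
      then show "ennreal (cmod (u x)) * ennreal (norm (cnj (u y) * K (x - y))) =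
          ennreal ((sqrt (2 * pi) / a) ^ n) * ennreal (cmod (u x) * cmod (u y) * exp (- (norm (x - y) / a)\<^sup>2 / 2))"
        using a by (simp add: ennreal_mult[symmetric] mult_ac del: power_divide)
    qed
    finally show "ennreal (norm (u x * (\<integral>y. cnj (u y) * K (x - y) \<partial>lborel))) \<le> \<dots>" .
  qed
  also have "\<dots> = ennreal ((sqrt (2 * pi) / a) ^ n) * (\<integral>\<^sup>+x. \<integral>\<^sup>+y. (cmod (u x) * cmod (u y) * exp (- (norm (x - y) / a)\<^sup>2 / 2)) \<partial>lborel \<partial>lborel)"
    by (simp add: nn_integral_cmult)
  also have "\<dots> \<le> ennreal ((sqrt (2 * pi) / a) ^ n) * ((sqrt (2 * pi) * a) ^ n * (\<integral>\<^sup>+x. (cmod (u x))\<^sup>2 \<partial>lborel))"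
    using gauss_quadratic_form_bound[OF a, of u] by (intro mult_left_mono) (auto simp: n_def)
  also have "ennreal (c\<^sup>2) * \<dots> = ennreal (c\<^sup>2 * (sqrt (2 * pi) / a) ^ n * (sqrt (2 * pi) * a) ^ n) * (\<integral>\<^sup>+x. (cmod (u x))\<^sup>2 \<partial>lborel)"
    using a by (simp add: ennreal_mult mult.assoc)
  also have "\<dots> = (\<integral>\<^sup>+x. (cmod (u x))\<^sup>2 \<partial>lborel)" unfolding c2 by simp
  finally show ?thesis by (simp add: mult_left_mono)
qed

text \<open>Fatou's lemma along the damping parameters \<open>1 / Suc m\<close>, which tend to 0
  while the bound stays fixed.\<close>

lemma fourier_bessel_nn:
  fixes u :: "real^'n \<Rightarrow> complex"
  assumes u: "integrable lborel u"
  shows "(\<integral>\<^sup>+\<xi>. (cmod (fourier u \<xi>))\<^sup>2 \<partial>lborel) \<le> (\<integral>\<^sup>+x. (cmod (u x))\<^sup>2 \<partial>lborel)"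
proof -
  have [measurable]: "u \<in> borel_measurable borel" using u by (auto dest: borel_measurable_integrable)
  let ?g = "\<lambda>(m::nat) \<xi>::real^'n. ennreal (exp (- (1 / real (Suc m) * norm \<xi>)\<^sup>2 / 2) * (cmod (fourier u \<xi>))\<^sup>2)"
  have "(\<integral>\<^sup>+\<xi>. (cmod (fourier u \<xi>))\<^sup>2 \<partial>lborel) = (\<integral>\<^sup>+\<xi>. liminf (\<lambda>m. ?g m \<xi>) \<partial>lborel)"
  proof (intro nn_integral_cong)
    fix \<xi> :: "real^'n"
    have "(\<lambda>m. exp (- (1 / real (Suc m) * norm \<xi>)\<^sup>2 / 2) * (cmod (fourier u \<xi>))\<^sup>2) \<longlonglongrightarrow>
       exp (- (0 * norm \<xi>)\<^sup>2 / 2) * (cmod (fourier u \<xi>))\<^sup>2"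
      by (intro tendsto_intros LIMSEQ_inverse_real_of_nat[unfolded inverse_eq_divide]) auto
    then have "(\<lambda>m. ?g m \<xi>) \<longlonglongrightarrow> ennreal ((cmod (fourier u \<xi>))\<^sup>2)"
      by (intro tendsto_ennrealI) simp
    then show "ennreal ((cmod (fourier u \<xi>))\<^sup>2) = liminf (\<lambda>m. ?g m \<xi>)"
      by (intro lim_imp_Liminf[symmetric]) auto
  qed
  also have "\<dots> \<le> liminf (\<lambda>m. \<integral>\<^sup>+\<xi>. ?g m \<xi> \<partial>lborel)"
    by (intro nn_integral_liminf) measurable
  also have "\<dots> \<le> liminf (\<lambda>m::nat. \<integral>\<^sup>+x. (cmod (u x))\<^sup>2 \<partial>lborel)"
    by (intro Liminf_mono always_eventually allI fourier_gauss_bound u) auto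
  also have "\<dots> = (\<integral>\<^sup>+x. (cmod (u x))\<^sup>2 \<partial>lborel)"
    by (simp add: Liminf_const)
  finally show ?thesis .
qed

lemma
  fixes u :: "real^'n \<Rightarrow> complex"
  assumes u: "integrable lborel u" and u2: "integrable lborel (\<lambda>x. (cmod (u x))\<^sup>2)"
  shows integrable_fourier_square: "integrable lborel (\<lambda>\<xi>. (cmod (fourier u \<xi>))\<^sup>2)"
    and fourier_bessel: "(\<integral>\<xi>. (cmod (fourier u \<xi>))\<^sup>2 \<partial>lborel) \<le> (\<integral>x. (cmod (u x))\<^sup>2 \<partial>lborel)"
proof -
  have [measurable]: "u \<in> borel_measurable borel" using u by (auto dest: borel_measurable_integrable)
  have e: "(\<integral>\<^sup>+x. (cmod (u x))\<^sup>2 \<partial>lborel) = ennreal (\<integral>x. (cmod (u x))\<^sup>2 \<partial>lborel)"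
    by (intro nn_integral_eq_integral u2) auto
  have b: "(\<integral>\<^sup>+\<xi>. (cmod (fourier u \<xi>))\<^sup>2 \<partial>lborel) \<le> ennreal (\<integral>x. (cmod (u x))\<^sup>2 \<partial>lborel)"
    using fourier_bessel_nn[OF u] unfolding e .
  show i: "integrable lborel (\<lambda>\<xi>. (cmod (fourier u \<xi>))\<^sup>2)"
    by (rule integrableI_nonneg) (use b in \<open>auto intro: le_less_trans\<close>)
  have "ennreal (\<integral>\<xi>. (cmod (fourier u \<xi>))\<^sup>2 \<partial>lborel) \<le> ennreal (\<integral>x. (cmod (u x))\<^sup>2 \<partial>lborel)"
    using b by (subst (asm) nn_integral_eq_integral[OF i]) auto
  then show "(\<integral>\<xi>. (cmod (fourier u \<xi>))\<^sup>2 \<partial>lborel) \<le> (\<integral>x. (cmod (u x))\<^sup>2 \<partial>lborel)"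
    by simp
qed

section \<open>Cutoff functions\<close>

lemma fourier_shift:
  fixes u :: "real^'n \<Rightarrow> complex"
  shows "fourier (\<lambda>x. u (x + h)) \<xi> = exp (\<i> * complex_of_real (h \<bullet> \<xi>)) * fourier u \<xi>"
proof -
  have e: "exp (- \<i> * complex_of_real ((x - h) \<bullet> \<xi>)) =
      exp (\<i> * complex_of_real (h \<bullet> \<xi>)) * exp (- \<i> * complex_of_real (x \<bullet> \<xi>))" for x
    unfolding exp_add[symmetric] by (simp add: inner_diff_left right_diff_distrib)
  have "(\<integral>x. u (x + h) * exp (- \<i> * complex_of_real (x \<bullet> \<xi>)) \<partial>lborel) =
      (\<integral>x. u (x + h) * exp (- \<i> * complex_of_real ((x + h - h) \<bullet> \<xi>)) \<partial>lborel)"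
    by simp
  also have "\<dots> = (\<integral>x. u x * exp (- \<i> * complex_of_real ((x - h) \<bullet> \<xi>)) \<partial>lborel)"
    by (rule integral_lborel_shift[of "\<lambda>x. u x * exp (- \<i> * complex_of_real ((x - h) \<bullet> \<xi>))"])
  also have "\<dots> = (\<integral>x. exp (\<i> * complex_of_real (h \<bullet> \<xi>)) * (u x * exp (- \<i> * complex_of_real (x \<bullet> \<xi>))) \<partial>lborel)"
    unfolding e by (simp only: mult_ac)
  finally show ?thesis
    unfolding fourier_def integral_mult_right_zero by (simp only: mult_ac)
qed

lemma fourier_modulate:
  fixes u :: "real^'n \<Rightarrow> complex"
  shows "fourier (\<lambda>x. u x * exp (\<i> * complex_of_real (x \<bullet> z))) \<xi> = fourier u (\<xi> - z)"
proof -
  have "u x * exp (\<i> * complex_of_real (x \<bullet> z)) * exp (- \<i> * complex_of_real (x \<bullet> \<xi>)) =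
      u x * exp (- \<i> * complex_of_real (x \<bullet> (\<xi> - z)))" for x
    unfolding mult.assoc exp_add[symmetric] by (simp add: inner_diff_right right_diff_distrib)
  then show ?thesis unfolding fourier_def by (simp only:)
qed

lemma fourier_diff_cmult:
  fixes u v :: "real^'n \<Rightarrow> complex"
  assumes "integrable lborel u" "integrable lborel v"
  shows "fourier (\<lambda>x. u x - c * v x) \<xi> = fourier u \<xi> - c * fourier v \<xi>"
proof -
  have "(\<integral>x. (u x - c * v x) * exp (- \<i> * complex_of_real (x \<bullet> \<xi>)) \<partial>lborel) =
    (\<integral>x. u x * exp (- \<i> * complex_of_real (x \<bullet> \<xi>)) - c * (v x * exp (- \<i> * complex_of_real (x \<bullet> \<xi>))) \<partial>lborel)"
    by (simp only: left_diff_distrib mult_ac)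
  also have "\<dots> = (\<integral>x. u x * exp (- \<i> * complex_of_real (x \<bullet> \<xi>)) \<partial>lborel) -
      c * (\<integral>x. v x * exp (- \<i> * complex_of_real (x \<bullet> \<xi>)) \<partial>lborel)"
    unfolding integral_mult_right_zero[symmetric]
    by (intro Bochner_Integration.integral_diff integrable_mult_right integrable_fourier_integrand assms)
  finally show ?thesis
    unfolding fourier_def by (simp only: right_diff_distrib mult_ac)
qed

text \<open>
  A bound on difference quotients is turned into a bound on the symbol, so no weak derivative
  is needed.
\<close>

lemma fourier_directional_bound:
  fixes u :: "real^'n \<Rightarrow> complex"
  assumes u: "integrable lborel u" and "\<delta> > 0"
    and bound: "\<And>h. 0 < h \<Longrightarrow> h < \<delta> \<Longrightarrow> (\<integral>\<^sup>+x. (cmod (u (x + h *\<^sub>R b) - u x))\<^sup>2 \<partial>lborel) \<le> ennreal (h\<^sup>2 * B)"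
  shows "(\<integral>\<^sup>+\<xi>. (b \<bullet> \<xi>)\<^sup>2 * (cmod (fourier u \<xi>))\<^sup>2 \<partial>lborel) \<le> ennreal B"
proof -
  have [measurable]: "u \<in> borel_measurable borel" using u by (auto dest: borel_measurable_integrable)
  \<comment> \<open>Step sizes tending to 0; the double \<open>Suc\<close> keeps even the first one
    strictly below \<delta>, where \<open>bound\<close> is available.\<close>
  define h where "h m = \<delta> * inverse (real (Suc (Suc m)))" for m
  have h: "0 < h m" "h m < \<delta>" for m
  proof -
    have "inverse (real (Suc (Suc m))) < 1" by (simp add: field_simps)
    then show "0 < h m" "h m < \<delta>" using \<open>\<delta> > 0\<close> by (auto simp: h_def)
  qed
  have h0: "h \<longlonglongrightarrow> 0"
    using tendsto_mult[OF tendsto_const[of \<delta>] LIMSEQ_Suc[OF LIMSEQ_inverse_real_of_nat]]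
    by (simp add: h_def[abs_def])
  \<comment> \<open>This is the squared modulus of the transform of the difference quotient with
    step \<open>h m\<close>. Its pointwise limit is the desired integrand, so Bessel's inequality
    for each \<open>m\<close> and Fatou's lemma finish the argument.\<close>
  define g where "g m \<xi> = (cmod ((exp (\<i> * complex_of_real (h m * (b \<bullet> \<xi>))) - 1) / complex_of_real (h m)))\<^sup>2
     * (cmod (fourier u \<xi>))\<^sup>2" for m \<xi>
  have [measurable]: "g m \<in> borel_measurable borel" for m
    unfolding g_def[abs_def] by measurable
  have lim: "(\<lambda>m. g m \<xi>) \<longlonglongrightarrow> (b \<bullet> \<xi>)\<^sup>2 * (cmod (fourier u \<xi>))\<^sup>2" for \<xi>
  proof -
    let ?w = "\<i> * complex_of_real (b \<bullet> \<xi>)"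
    have "((\<lambda>t. exp (t * ?w)) has_field_derivative ?w) (at 0)"
      by (auto intro!: derivative_eq_intros)
    then have "((\<lambda>t. (exp (t * ?w) - 1) / t) \<longlongrightarrow> ?w) (at 0)"
      by (simp add: has_field_derivative_iff)
    moreover have "filterlim (\<lambda>m. complex_of_real (h m)) (at 0) sequentially"
      unfolding filterlim_at using h(1) h0 tendsto_of_real[OF h0, where 'a=complex]
      by (auto simp: less_le intro!: always_eventually)
    ultimately have "(\<lambda>m. (exp (complex_of_real (h m) * ?w) - 1) / complex_of_real (h m)) \<longlonglongrightarrow> ?w"
      by (rule filterlim_compose)
    then have "(\<lambda>m. (cmod ((exp (complex_of_real (h m) * ?w) - 1) / complex_of_real (h m)))\<^sup>2 * (cmod (fourier u \<xi>))\<^sup>2) \<longlonglongrightarrow>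
       (cmod ?w)\<^sup>2 * (cmod (fourier u \<xi>))\<^sup>2"
      by (intro tendsto_intros)
    then show ?thesis unfolding g_def by (simp add: norm_mult mult_ac)
  qed
  have g_le: "(\<integral>\<^sup>+\<xi>. g m \<xi> \<partial>lborel) \<le> ennreal B" for m
  proof -
    have us: "integrable lborel (\<lambda>x. u (x + h m *\<^sub>R b))" by (intro integrable_lborel_shift u)
    have "fourier (\<lambda>x. u (x + h m *\<^sub>R b) - u x) \<xi> = (exp (\<i> * complex_of_real (h m * (b \<bullet> \<xi>))) - 1) * fourier u \<xi>" for \<xi>
      using fourier_diff_cmult[OF us u, of 1 \<xi>] fourier_shift[of u "h m *\<^sub>R b" \<xi>]
      by (simp add: left_diff_distrib)
    then have "(\<integral>\<^sup>+\<xi>. g m \<xi> \<partial>lborel) =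
        (\<integral>\<^sup>+\<xi>. ennreal (1 / (h m)\<^sup>2) * (cmod (fourier (\<lambda>x. u (x + h m *\<^sub>R b) - u x) \<xi>))\<^sup>2 \<partial>lborel)"
      using h(1)[of m] by (intro nn_integral_cong)
        (simp add: g_def norm_mult norm_divide power_mult_distrib power_divide flip: ennreal_mult)
    also have "\<dots> = ennreal (1 / (h m)\<^sup>2) * (\<integral>\<^sup>+\<xi>. (cmod (fourier (\<lambda>x. u (x + h m *\<^sub>R b) - u x) \<xi>))\<^sup>2 \<partial>lborel)"
      by (simp add: nn_integral_cmult)
    also have "\<dots> \<le> ennreal (1 / (h m)\<^sup>2) * ennreal ((h m)\<^sup>2 * B)"
      using us u by (intro mult_left_mono order_trans[OF fourier_bessel_nn bound] h) auto
    also have "\<dots> = ennreal B"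
      using h(1)[of m] by (subst ennreal_mult'[symmetric]) auto
    finally show ?thesis .
  qed
  have "(\<integral>\<^sup>+\<xi>. (b \<bullet> \<xi>)\<^sup>2 * (cmod (fourier u \<xi>))\<^sup>2 \<partial>lborel) = (\<integral>\<^sup>+\<xi>. liminf (\<lambda>m. ennreal (g m \<xi>)) \<partial>lborel)"
    by (intro nn_integral_cong lim_imp_Liminf[symmetric] tendsto_ennrealI lim) auto
  also have "\<dots> \<le> liminf (\<lambda>m. \<integral>\<^sup>+\<xi>. g m \<xi> \<partial>lborel)"
    by (intro nn_integral_liminf) measurable
  also have "\<dots> \<le> liminf (\<lambda>m::nat. ennreal B)"
    by (intro Liminf_mono always_eventually allI g_le)
  also have "\<dots> = ennreal B"
    by (simp add: Liminf_const)
  finally show ?thesis .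
qed

section \<open>The cutoff: mass, increments and second Fourier moment\<close>

text \<open>The distance is taken to the complement and not to the frontier, so that the function
  vanishes everywhere outside \<Omega> while staying Lipschitz with constant 1/\<sigma>. Since
  \<open>infdist\<close> to the empty set is 0, the value 1 is reached only when the complement is
  nonempty, which boundedness of \<Omega> ensures later.\<close>

definition cutoff :: "'a::euclidean_space set \<Rightarrow> real \<Rightarrow> 'a \<Rightarrow> real" where
  "cutoff \<Omega> \<sigma> x = min 1 (infdist x (- \<Omega>) / \<sigma>)"

lemma cutoff_le_1: "cutoff \<Omega> \<sigma> x \<le> 1"
  by (simp add: cutoff_def)

lemma cutoff_nonneg: "\<sigma> > 0 \<Longrightarrow> 0 \<le> cutoff \<Omega> \<sigma> x"
  by (simp add: cutoff_def infdist_nonneg)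

lemma cutoff_outside: "\<sigma> > 0 \<Longrightarrow> x \<notin> \<Omega> \<Longrightarrow> cutoff \<Omega> \<sigma> x = 0"
  by (simp add: cutoff_def)

lemma cutoff_measurable [measurable]: "cutoff \<Omega> \<sigma> \<in> borel_measurable borel"
  unfolding cutoff_def[abs_def] divide_inverse by (intro borel_measurable_continuous_onI continuous_intros)

lemma cutoff_lipschitz:
  assumes "\<sigma> > 0"
  shows "\<bar>cutoff \<Omega> \<sigma> x - cutoff \<Omega> \<sigma> y\<bar> \<le> dist x y / \<sigma>"
proof -
  have "\<bar>infdist x (- \<Omega>) - infdist y (- \<Omega>)\<bar> \<le> dist x y"
    using infdist_triangle[of x "- \<Omega>" y] infdist_triangle[of y "- \<Omega>" x] by (simp add: dist_commute)
  then have "\<bar>infdist x (- \<Omega>) / \<sigma> - infdist y (- \<Omega>) / \<sigma>\<bar> \<le> dist x y / \<sigma>"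
    using assms by (simp add: divide_right_mono flip: diff_divide_distrib)
  then show ?thesis unfolding cutoff_def by linarith
qed

lemma boundary_layer_measurable [measurable]:
  "open \<Omega> \<Longrightarrow> boundary_layer \<Omega> t \<in> sets borel"
proof -
  assume "open \<Omega>"
  have "open {x. infdist x (frontier \<Omega>) < t}" by (intro open_Collect_less continuous_intros)
  then have "open (\<Omega> \<inter> {x. infdist x (frontier \<Omega>) < t})" using \<open>open \<Omega>\<close> by (rule open_Int[rotated])
  then show ?thesis by (simp add: boundary_layer_def Collect_conj_eq)
qed

text \<open>A segment from a point of \<Omega> to a point outside crosses the frontier. This links
  the cutoff, defined through the complement, to \<open>boundary_layer\<close>, defined through the
  frontier.\<close>

lemma infdist_frontier_le:
  fixes x :: "'a::euclidean_space"
  assumes "x \<in> \<Omega>" "- \<Omega> \<noteq> {}"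
  shows "infdist x (frontier \<Omega>) \<le> infdist x (- \<Omega>)"
proof -
  have "infdist x (frontier \<Omega>) \<le> dist x y" if y: "y \<in> - \<Omega>" for y
  proof -
    have "closed_segment x y \<inter> frontier \<Omega> \<noteq> {}"
      using assms y by (intro connected_Int_frontier) auto
    then obtain z where z: "z \<in> closed_segment x y" "z \<in> frontier \<Omega>" by auto
    have "infdist x (frontier \<Omega>) \<le> dist x z" by (intro infdist_le z)
    also have "\<dots> \<le> dist x y" using segment_bound(1)[OF z(1)] by (simp add: dist_norm norm_minus_commute)
    finally show ?thesis .
  qed
  then show ?thesis
    using assms(2) by (auto simp: infdist_notempty[of "- \<Omega>"] intro!: cINF_greatest)
qed

lemma cutoff_eq_1:
  assumes "\<sigma> > 0" "- \<Omega> \<noteq> {}" "x \<in> \<Omega>" "x \<notin> boundary_layer \<Omega> \<sigma>"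
  shows "cutoff \<Omega> \<sigma> x = 1"
proof -
  have "\<sigma> \<le> infdist x (- \<Omega>)"
    using assms infdist_frontier_le[of x \<Omega>] by (auto simp: boundary_layer_def)
  then show ?thesis using assms(1) by (simp add: cutoff_def)
qed

text \<open>If one endpoint lies in the layer, the Lipschitz bound applies. If neither does, the
  increment is 0: a point of \<Omega> off the layer has its whole \<sigma>-neighbourhood in
  \<Omega>, so both endpoints are inside with value 1 or both outside with value 0.\<close>

lemma cutoff_increment:
  fixes h :: "real^'n"
  assumes \<sigma>: "\<sigma> > 0" and ne: "- \<Omega> \<noteq> {}" and h: "norm h < \<sigma>"
  shows "(cutoff \<Omega> \<sigma> (x + h) - cutoff \<Omega> \<sigma> x)\<^sup>2 \<le>
    (norm h / \<sigma>)\<^sup>2 * (indicator (boundary_layer \<Omega> \<sigma>) x + indicator (boundary_layer \<Omega> \<sigma>) (x + h))"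
proof (cases "x \<in> boundary_layer \<Omega> \<sigma> \<or> x + h \<in> boundary_layer \<Omega> \<sigma>")
  case True
  have "\<bar>cutoff \<Omega> \<sigma> (x + h) - cutoff \<Omega> \<sigma> x\<bar> \<le> norm h / \<sigma>"
    using cutoff_lipschitz[OF \<sigma>, of \<Omega> "x + h" x] by (simp add: dist_norm)
  then have "(cutoff \<Omega> \<sigma> (x + h) - cutoff \<Omega> \<sigma> x)\<^sup>2 \<le> (norm h / \<sigma>)\<^sup>2 * 1"
    using abs_le_square_iff[of "cutoff \<Omega> \<sigma> (x + h) - cutoff \<Omega> \<sigma> x" "norm h / \<sigma>"] \<sigma> by simp
  also have "\<dots> \<le> (norm h / \<sigma>)\<^sup>2 * (indicator (boundary_layer \<Omega> \<sigma>) x + indicator (boundary_layer \<Omega> \<sigma>) (x + h))"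
    using True by (intro mult_left_mono) (auto simp: indicator_def)
  finally show ?thesis .
next
  case False
  have step: "y \<in> \<Omega>" if "x' \<in> \<Omega>" "x' \<notin> boundary_layer \<Omega> \<sigma>" "dist x' y < \<sigma>" for x' y
  proof (rule ccontr)
    assume "y \<notin> \<Omega>"
    then have "infdist x' (- \<Omega>) \<le> dist x' y" by (intro infdist_le) auto
    then have "infdist x' (frontier \<Omega>) < \<sigma>" using infdist_frontier_le[OF that(1) ne] that(3) by linarith
    with that show False by (auto simp: boundary_layer_def)
  qed
  have "x \<in> \<Omega> \<longleftrightarrow> x + h \<in> \<Omega>"
    using step[of x "x + h"] step[of "x + h" x] False h by (auto simp: dist_norm)
  then have "cutoff \<Omega> \<sigma> (x + h) = cutoff \<Omega> \<sigma> x"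
    using False cutoff_eq_1[OF \<sigma> ne, of x] cutoff_eq_1[OF \<sigma> ne, of "x + h"]
      cutoff_outside[OF \<sigma>, of x \<Omega>] cutoff_outside[OF \<sigma>, of "x + h" \<Omega>] by (cases "x \<in> \<Omega>") auto
  then show ?thesis using False by simp
qed

text \<open>The two indicators of the layer have equal integrals by translation invariance, hence
  the factor 2.\<close>

lemma cutoff_increment_integral:
  fixes h :: "real^'n"
  assumes "\<sigma> > 0" "- \<Omega> \<noteq> {}" "norm h < \<sigma>" "open \<Omega>" "bounded \<Omega>"
  shows "(\<integral>\<^sup>+x. (cutoff \<Omega> \<sigma> (x + h) - cutoff \<Omega> \<sigma> x)\<^sup>2 \<partial>lborel) \<le>
    ennreal ((norm h / \<sigma>)\<^sup>2 * (2 * measure lborel (boundary_layer \<Omega> \<sigma>)))"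
proof -
  let ?L = "boundary_layer \<Omega> \<sigma>"
  have [measurable]: "?L \<in> sets borel" using assms by measurable
  have "bounded ?L" using assms(5) by (rule bounded_subset) (auto simp: boundary_layer_def)
  then have fin: "emeasure lborel ?L < \<infinity>" by (rule emeasure_bounded_finite)
  have "(\<integral>\<^sup>+x. (cutoff \<Omega> \<sigma> (x + h) - cutoff \<Omega> \<sigma> x)\<^sup>2 \<partial>lborel) \<le>
     (\<integral>\<^sup>+x. ennreal ((norm h / \<sigma>)\<^sup>2) * (indicator ?L x + indicator ?L (x + h)) \<partial>lborel)"
    using cutoff_increment[OF assms(1,2,3)]
    by (intro nn_integral_mono) (auto simp: ennreal_indicator[symmetric] simp flip: ennreal_plus ennreal_mult intro!: ennreal_leI)
  also have "\<dots> = ennreal ((norm h / \<sigma>)\<^sup>2) * ((\<integral>\<^sup>+x. indicator ?L x \<partial>lborel) + (\<integral>\<^sup>+x. indicator ?L (x + h) \<partial>lborel))"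
    by (simp add: nn_integral_cmult nn_integral_add)
  also have "(\<integral>\<^sup>+x. indicator ?L (x + h) \<partial>lborel) = (\<integral>\<^sup>+x. indicator ?L x \<partial>lborel)"
    by (rule nn_integral_lborel_shift) measurable
  also have "(\<integral>\<^sup>+x. indicator ?L x \<partial>lborel) = ennreal (measure lborel ?L)"
    using fin by (simp add: emeasure_eq_ennreal_measure)
  also have "ennreal ((norm h / \<sigma>)\<^sup>2) * (ennreal (measure lborel ?L) + ennreal (measure lborel ?L)) =
      ennreal ((norm h / \<sigma>)\<^sup>2 * (2 * measure lborel ?L))"
    by (simp flip: ennreal_plus ennreal_mult)
  finally show ?thesis .
qed

lemma integrable_bounded_support:
  fixes f :: "'a::euclidean_space \<Rightarrow> 'b::{banach, second_countable_topology}"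
  assumes [measurable]: "f \<in> borel_measurable borel" and "bounded S" "S \<in> sets borel"
    and "\<And>x. norm (f x) \<le> B" "\<And>x. x \<notin> S \<Longrightarrow> f x = 0"
  shows "integrable lborel f"
proof (rule Bochner_Integration.integrable_bound)
  show "integrable lborel (\<lambda>x. B * indicator S x :: real)"
    using assms(2,3) emeasure_bounded_finite[OF assms(2)] by (simp add: less_top)
  show "AE x in lborel. norm (f x) \<le> norm (B * indicator S x :: real)"
    using assms(4,5) by (auto simp: indicator_def intro: order_trans[OF _ abs_ge_self])
qed simp

text \<open>The squared cutoff lies between the indicator of \<Omega> minus that of the layer and
  the indicator of \<Omega>, so its mass differs from the volume by at most the volume of the
  layer.\<close>

lemma
  fixes \<Omega> :: "(real^'n) set"
  assumes "\<sigma> > 0" "open \<Omega>" "bounded \<Omega>"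
  shows integrable_cutoff: "integrable lborel (\<lambda>x. complex_of_real (cutoff \<Omega> \<sigma> x))"
    and integrable_cutoff_square: "integrable lborel (\<lambda>x. (cutoff \<Omega> \<sigma> x)\<^sup>2)"
    and cutoff_square_le: "(\<integral>x. (cutoff \<Omega> \<sigma> x)\<^sup>2 \<partial>lborel) \<le> measure lborel \<Omega>"
    and cutoff_square_ge: "- \<Omega> \<noteq> {} \<Longrightarrow>
      measure lborel \<Omega> - measure lborel (boundary_layer \<Omega> \<sigma>) \<le> (\<integral>x. (cutoff \<Omega> \<sigma> x)\<^sup>2 \<partial>lborel)"
proof -
  have [measurable]: "\<Omega> \<in> sets borel" using assms by simp
  have le: "(cutoff \<Omega> \<sigma> x)\<^sup>2 \<le> indicator \<Omega> x" for x
    using cutoff_le_1[of \<Omega> \<sigma> x] cutoff_nonneg[OF assms(1), of \<Omega> x] cutoff_outside[OF assms(1), of x \<Omega>]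
    by (auto simp: indicator_def intro: power_le_one)
  show "integrable lborel (\<lambda>x. complex_of_real (cutoff \<Omega> \<sigma> x))"
    using assms by (intro integrable_bounded_support[of _ \<Omega> 1])
      (auto simp: cutoff_outside cutoff_nonneg cutoff_le_1)
  show i: "integrable lborel (\<lambda>x. (cutoff \<Omega> \<sigma> x)\<^sup>2)"
    using assms by (intro integrable_bounded_support[of _ \<Omega> 1])
      (auto simp: cutoff_outside cutoff_nonneg cutoff_le_1 power_le_one)
  have fin: "emeasure lborel \<Omega> < \<infinity>" by (intro emeasure_bounded_finite assms)
  then have iO: "integrable lborel (indicator \<Omega> :: real^'n \<Rightarrow> real)" by (simp add: less_top)
  have "(\<integral>x. (cutoff \<Omega> \<sigma> x)\<^sup>2 \<partial>lborel) \<le> (\<integral>x. indicator \<Omega> x \<partial>lborel)"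
    by (intro integral_mono i iO le)
  then show "(\<integral>x. (cutoff \<Omega> \<sigma> x)\<^sup>2 \<partial>lborel) \<le> measure lborel \<Omega>" by simp
  assume ne: "- \<Omega> \<noteq> {}"
  let ?L = "boundary_layer \<Omega> \<sigma>"
  have [measurable]: "?L \<in> sets borel" using assms by measurable
  have "bounded ?L" using assms(3) by (rule bounded_subset) (auto simp: boundary_layer_def)
  then have iL: "integrable lborel (indicator ?L :: real^'n \<Rightarrow> real)"
    using emeasure_bounded_finite[of ?L] by (simp add: less_top)
  have "(\<integral>x. indicator \<Omega> x - indicator ?L x \<partial>lborel) \<le> (\<integral>x. (cutoff \<Omega> \<sigma> x)\<^sup>2 \<partial>lborel)"
    using cutoff_eq_1[OF assms(1) ne]
    by (intro integral_mono i Bochner_Integration.integrable_diff iO iL) (auto simp: indicator_def intro: order_trans[of _ 0])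
  then show "measure lborel \<Omega> - measure lborel ?L \<le> (\<integral>x. (cutoff \<Omega> \<sigma> x)\<^sup>2 \<partial>lborel)"
    by (subst (asm) Bochner_Integration.integral_diff[OF iO iL]) simp
qed

text \<open>The directional bound is applied to each coordinate vector and summed, hence the factor
  \<open>CARD('n)\<close>. With a layer of volume O(\<sigma>) the right-hand side is
  O(1/\<sigma>).\<close>

lemma
  fixes \<Omega> :: "(real^'n) set"
  assumes "\<sigma> > 0" "open \<Omega>" "bounded \<Omega>"
  defines "u \<equiv> \<lambda>x. complex_of_real (cutoff \<Omega> \<sigma> x)"
  shows integrable_cutoff_fourier_moment: "integrable lborel (\<lambda>\<xi>. (norm \<xi>)\<^sup>2 * (cmod (fourier u \<xi>))\<^sup>2)"
    and cutoff_fourier_moment: "(\<integral>\<xi>. (norm \<xi>)\<^sup>2 * (cmod (fourier u \<xi>))\<^sup>2 \<partial>lborel) \<le>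
      CARD('n) * (2 * measure lborel (boundary_layer \<Omega> \<sigma>) / \<sigma>\<^sup>2)"
proof -
  have ne: "- \<Omega> \<noteq> {}" using assms(3) not_bounded_UNIV by (metis Compl_UNIV_eq double_compl)
  define B where "B = 2 * measure lborel (boundary_layer \<Omega> \<sigma>) / \<sigma>\<^sup>2"
  have B0: "0 \<le> B" by (simp add: B_def)
  have ui: "integrable lborel u" unfolding u_def by (intro integrable_cutoff assms)
  then have [measurable]: "u \<in> borel_measurable borel" by (auto dest: borel_measurable_integrable)
  have b: "(\<integral>\<^sup>+\<xi>. (b \<bullet> \<xi>)\<^sup>2 * (cmod (fourier u \<xi>))\<^sup>2 \<partial>lborel) \<le> ennreal B" if "b \<in> Basis" for b
  proof (rule fourier_directional_bound[OF ui assms(1)])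
    fix h :: real assume h: "0 < h" "h < \<sigma>"
    have "(\<integral>\<^sup>+x. (cmod (u (x + h *\<^sub>R b) - u x))\<^sup>2 \<partial>lborel) =
        (\<integral>\<^sup>+x. (cutoff \<Omega> \<sigma> (x + h *\<^sub>R b) - cutoff \<Omega> \<sigma> x)\<^sup>2 \<partial>lborel)"
      unfolding u_def of_real_diff[symmetric] norm_of_real by simp
    also have "\<dots> \<le> ennreal ((norm (h *\<^sub>R b) / \<sigma>)\<^sup>2 * (2 * measure lborel (boundary_layer \<Omega> \<sigma>)))"
      using assms ne h that by (intro cutoff_increment_integral) auto
    also have "(norm (h *\<^sub>R b) / \<sigma>)\<^sup>2 * (2 * measure lborel (boundary_layer \<Omega> \<sigma>)) = h\<^sup>2 * B"
      using that by (simp add: B_def power_divide)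
    finally show "(\<integral>\<^sup>+x. (cmod (u (x + h *\<^sub>R b) - u x))\<^sup>2 \<partial>lborel) \<le> ennreal (h\<^sup>2 * B)" .
  qed
  have "(\<integral>\<^sup>+\<xi>. (norm \<xi>)\<^sup>2 * (cmod (fourier u \<xi>))\<^sup>2 \<partial>lborel) =
      (\<integral>\<^sup>+\<xi>. (\<Sum>b\<in>Basis. ennreal ((b \<bullet> \<xi>)\<^sup>2 * (cmod (fourier u \<xi>))\<^sup>2)) \<partial>lborel)"
  proof (intro nn_integral_cong)
    fix \<xi> :: "real^'n"
    have "(norm \<xi>)\<^sup>2 = (\<Sum>b\<in>Basis. (b \<bullet> \<xi>)\<^sup>2)"
      unfolding power2_norm_eq_inner by (subst euclidean_inner) (simp add: power2_eq_square inner_commute)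
    then show "ennreal ((norm \<xi>)\<^sup>2 * (cmod (fourier u \<xi>))\<^sup>2) =
        (\<Sum>b\<in>Basis. ennreal ((b \<bullet> \<xi>)\<^sup>2 * (cmod (fourier u \<xi>))\<^sup>2))"
      by (simp add: sum_distrib_right)
  qed
  also have "\<dots> = (\<Sum>b\<in>Basis. \<integral>\<^sup>+\<xi>. (b \<bullet> \<xi>)\<^sup>2 * (cmod (fourier u \<xi>))\<^sup>2 \<partial>lborel)"
    by (rule nn_integral_sum) measurable
  also have "\<dots> \<le> (\<Sum>b\<in>(Basis :: (real^'n) set). ennreal B)"
    by (intro sum_mono b)
  also have "\<dots> = ennreal (CARD('n) * B)"
    using B0 by (simp add: ennreal_of_nat_eq_real_of_nat ennreal_mult)
  finally have le: "(\<integral>\<^sup>+\<xi>. (norm \<xi>)\<^sup>2 * (cmod (fourier u \<xi>))\<^sup>2 \<partial>lborel) \<le> ennreal (CARD('n) * B)" .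
  show i: "integrable lborel (\<lambda>\<xi>. (norm \<xi>)\<^sup>2 * (cmod (fourier u \<xi>))\<^sup>2)"
    by (rule integrableI_nonneg) (use le in \<open>auto intro: le_less_trans\<close>)
  have "ennreal (\<integral>\<xi>. (norm \<xi>)\<^sup>2 * (cmod (fourier u \<xi>))\<^sup>2 \<partial>lborel) \<le> ennreal (CARD('n) * B)"
    using le by (subst (asm) nn_integral_eq_integral[OF i]) auto
  then show "(\<integral>\<xi>. (norm \<xi>)\<^sup>2 * (cmod (fourier u \<xi>))\<^sup>2 \<partial>lborel) \<le>
      CARD('n) * (2 * measure lborel (boundary_layer \<Omega> \<sigma>) / \<sigma>\<^sup>2)"
    using B0 by (subst (asm) ennreal_le_iff) (auto simp: B_def)
qed

section \<open>The quadratic form and its spectral lower bound\<close>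

definition fraclog_symbol :: "real \<Rightarrow> 'a::real_normed_vector \<Rightarrow> real" where
  "fraclog_symbol s \<xi> = norm \<xi> powr (2 * s) * ln ((norm \<xi>)\<^sup>2)"

lemma fraclog_symbol_measurable [measurable]:
  "fraclog_symbol s \<in> borel_measurable (borel :: 'a::euclidean_space measure)"
  unfolding fraclog_symbol_def[abs_def] by measurable

text \<open>With r the norm, the inequality ln y \<le> y - 1 at y = r^(-2s) bounds -2s ln r by
  r^(-2s); multiplying by r^(2s) and dividing by s gives the constant. This is the source of the
  semiboundedness of the form.\<close>

lemma fraclog_symbol_ge:
  assumes "0 < s"
  shows "- (1 / s) \<le> fraclog_symbol s \<xi>"
proof (cases "\<xi> = 0")
  case False
  define r where "r = norm \<xi>"
  have r: "r > 0" using False by (simp add: r_def)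
  have "ln (r powr (- (2 * s))) \<le> r powr (- (2 * s)) - 1"
    using r by (intro ln_le_minus_one) auto
  then have "- (2 * s * ln r) \<le> r powr (- (2 * s))"
    using r by (simp add: ln_powr)
  then have "r powr (2 * s) * (- (2 * s * ln r)) \<le> r powr (2 * s) * r powr (- (2 * s))"
    by (intro mult_left_mono) auto
  also have "\<dots> = 1" using r by (simp flip: powr_add)
  finally have "- 1 \<le> s * (r powr (2 * s) * (2 * ln r))" by (simp add: mult_ac)
  then have "- (1 / s) \<le> r powr (2 * s) * (2 * ln r)"
    using assms by (simp add: field_simps)
  then show ?thesis using r by (simp add: fraclog_symbol_def r_def[symmetric] ln_realpow)
qed (use assms in \<open>simp add: fraclog_symbol_def\<close>)

text \<open>The same logarithm inequality at y = r^(2-2s): the logarithm is absorbed in the gap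
  between the exponents 2s and 2, at the price of the factor 1/(1-s). Hence a finite second moment
  of the transform is enough for finite energy.\<close>

lemma powr_ln_square_le:
  assumes "s < 1" "0 \<le> (r::real)"
  shows "r powr (2 * s) * ln (r\<^sup>2) \<le> r\<^sup>2 / (1 - s)"
proof (cases "r = 0")
  case False
  with assms have r: "r > 0" by simp
  have "ln (r powr (2 - 2 * s)) \<le> r powr (2 - 2 * s) - 1"
    using r by (intro ln_le_minus_one) auto
  then have "(2 - 2 * s) * ln r \<le> r powr (2 - 2 * s)"
    using r by (simp add: ln_powr)
  then have "r powr (2 * s) * ((2 - 2 * s) * ln r) \<le> r powr (2 * s) * r powr (2 - 2 * s)"
    by (intro mult_left_mono) auto
  also have "\<dots> = r\<^sup>2" using r by (simp flip: powr_add)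
  finally have "(r powr (2 * s) * (2 * ln r)) * (1 - s) \<le> r\<^sup>2" by (simp add: algebra_simps)
  then show ?thesis using r assms by (simp add: ln_realpow field_simps)
qed (use assms in simp)

lemma abs_fraclog_symbol_le:
  assumes "0 < s" "s < 1"
  shows "\<bar>fraclog_symbol s \<xi>\<bar> \<le> 1 / s + (norm \<xi>)\<^sup>2 / (1 - s)"
proof -
  have "fraclog_symbol s \<xi> \<le> (norm \<xi>)\<^sup>2 / (1 - s)"
    unfolding fraclog_symbol_def using assms by (intro powr_ln_square_le) auto
  moreover have "- (1 / s) \<le> fraclog_symbol s \<xi>" by (intro fraclog_symbol_ge assms)
  moreover have "0 \<le> 1 / s" "0 \<le> (norm \<xi>)\<^sup>2 / (1 - s)" using assms by auto
  ultimately show ?thesis unfolding abs_le_iff by linarith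
qed

lemma energy_space_iff:
  "u \<in> energy_space s \<Omega> \<longleftrightarrow> u \<in> borel_measurable borel \<and> integrable lborel (\<lambda>x. (cmod (u x))\<^sup>2) \<and>
    (AE x in lborel. x \<notin> \<Omega> \<longrightarrow> u x = 0) \<and>
    integrable lborel (\<lambda>\<xi>. \<bar>fraclog_symbol s \<xi>\<bar> * (cmod (fourier u \<xi>))\<^sup>2)"
  by (simp add: energy_space_def L2_fun_def fraclog_symbol_def abs_mult)

lemma energy_form_eq:
  "energy_form s u v = (\<integral>\<xi>. of_real (fraclog_symbol s \<xi>) * (fourier u \<xi> * cnj (fourier v \<xi>)) \<partial>lborel)"
  by (simp add: energy_form_def fraclog_symbol_def mult.assoc)

lemma cmod_diff_cmult_square_le:
  "(cmod (a - c * b))\<^sup>2 \<le> 2 * (cmod a)\<^sup>2 + 2 * (cmod c)\<^sup>2 * (cmod b)\<^sup>2"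
proof -
  have "(cmod (a - c * b))\<^sup>2 \<le> (cmod a + cmod c * cmod b)\<^sup>2"
    using norm_triangle_ineq4[of a "c * b"] by (intro power_mono) (auto simp: norm_mult)
  also have "\<dots> \<le> 2 * (cmod a)\<^sup>2 + 2 * (cmod c * cmod b)\<^sup>2"
    using sum_squares_bound[of "cmod a" "cmod c * cmod b"] by (simp add: power2_sum)
  finally show ?thesis by (simp add: power_mult_distrib)
qed

lemma cmod_mult_cnj_le: "cmod (a * cnj b) \<le> (cmod a)\<^sup>2 + (cmod b)\<^sup>2"
  using sum_squares_bound[of "cmod a" "cmod b"] mult_nonneg_nonneg[OF norm_ge_zero[of a] norm_ge_zero[of b]]
  unfolding norm_mult complex_mod_cnj by linarith

section \<open>The energy space and its two Hermitian forms\<close>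

context
  fixes \<Omega> :: "(real^'n) set" and s :: real
  assumes open_dom: "open \<Omega>" and bounded_dom: "bounded \<Omega>"
begin

text \<open>The modulus is at most its square plus the indicator of \<Omega>, and \<Omega> has
  finite volume. Integrability is what makes the integral defining \<open>fourier\<close> meaningful
  and linear on the energy space.\<close>

lemma energy_space_integrable:
  assumes "u \<in> energy_space s \<Omega>"
  shows "integrable lborel u"
proof (rule Bochner_Integration.integrable_bound)
  have fin: "emeasure lborel \<Omega> < \<infinity>" by (intro emeasure_bounded_finite bounded_dom)
  show "integrable lborel (\<lambda>x. (cmod (u x))\<^sup>2 + indicator \<Omega> x)"
    using assms fin open_dom by (auto simp: energy_space_iff less_top)
  show "u \<in> borel_measurable lborel" using assms by (simp add: energy_space_iff)
  have "AE x in lborel. x \<notin> \<Omega> \<longrightarrow> u x = 0" using assms by (simp add: energy_space_iff)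
  then show "AE x in lborel. norm (u x) \<le> norm ((cmod (u x))\<^sup>2 + indicator \<Omega> x :: real)"
  proof eventually_elim
    case (elim x)
    have "2 * cmod (u x) \<le> (cmod (u x))\<^sup>2 + 1" using sum_squares_bound[of "cmod (u x)" 1] by simp
    then have "cmod (u x) \<le> (cmod (u x))\<^sup>2 + 1" using norm_ge_zero[of "u x"] by linarith
    with elim show ?case by (cases "x \<in> \<Omega>") auto
  qed
qed

lemma energy_space_diff_cmult:
  assumes u: "u \<in> energy_space s \<Omega>" and v: "v \<in> energy_space s \<Omega>"
  shows "(\<lambda>x. u x - c * v x) \<in> energy_space s \<Omega>"
proof -
  have [measurable]: "u \<in> borel_measurable borel" "v \<in> borel_measurable borel"
    using u v by (auto simp: energy_space_iff)
  have F: "fourier (\<lambda>x. u x - c * v x) \<xi> = fourier u \<xi> - c * fourier v \<xi>" for \<xi>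
    by (intro fourier_diff_cmult energy_space_integrable u v)
  have "integrable lborel (\<lambda>x. (cmod (u x - c * v x))\<^sup>2)"
  proof (rule Bochner_Integration.integrable_bound)
    show "integrable lborel (\<lambda>x. 2 * (cmod (u x))\<^sup>2 + 2 * (cmod c)\<^sup>2 * (cmod (v x))\<^sup>2)"
      using u v by (auto simp: energy_space_iff)
    show "AE x in lborel. norm ((cmod (u x - c * v x))\<^sup>2) \<le> norm (2 * (cmod (u x))\<^sup>2 + 2 * (cmod c)\<^sup>2 * (cmod (v x))\<^sup>2)"
      by (auto intro: order_trans[OF cmod_diff_cmult_square_le])
  qed measurable
  moreover have "integrable lborel (\<lambda>\<xi>. \<bar>fraclog_symbol s \<xi>\<bar> * (cmod (fourier u \<xi> - c * fourier v \<xi>))\<^sup>2)"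
  proof (rule Bochner_Integration.integrable_bound)
    show "integrable lborel (\<lambda>\<xi>. 2 * (\<bar>fraclog_symbol s \<xi>\<bar> * (cmod (fourier u \<xi>))\<^sup>2) +
        2 * (cmod c)\<^sup>2 * (\<bar>fraclog_symbol s \<xi>\<bar> * (cmod (fourier v \<xi>))\<^sup>2))"
      using u v by (auto simp: energy_space_iff)
    have "\<bar>fraclog_symbol s \<xi>\<bar> * (cmod (fourier u \<xi> - c * fourier v \<xi>))\<^sup>2 \<le>
       2 * (\<bar>fraclog_symbol s \<xi>\<bar> * (cmod (fourier u \<xi>))\<^sup>2) +
        2 * (cmod c)\<^sup>2 * (\<bar>fraclog_symbol s \<xi>\<bar> * (cmod (fourier v \<xi>))\<^sup>2)" for \<xi>
      using mult_left_mono[OF cmod_diff_cmult_square_le[of "fourier u \<xi>" c "fourier v \<xi>"], of "\<bar>fraclog_symbol s \<xi>\<bar>"]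
      by (simp add: algebra_simps)
    then show "AE \<xi> in lborel. norm (\<bar>fraclog_symbol s \<xi>\<bar> * (cmod (fourier u \<xi> - c * fourier v \<xi>))\<^sup>2) \<le>
       norm (2 * (\<bar>fraclog_symbol s \<xi>\<bar> * (cmod (fourier u \<xi>))\<^sup>2) +
        2 * (cmod c)\<^sup>2 * (\<bar>fraclog_symbol s \<xi>\<bar> * (cmod (fourier v \<xi>))\<^sup>2))"
      by (auto intro: order_trans)
  qed measurable
  moreover have "AE x in lborel. x \<notin> \<Omega> \<longrightarrow> u x - c * v x = 0"
    using u v unfolding energy_space_iff by (auto elim!: AE_mp)
  ultimately show ?thesis
    unfolding energy_space_iff F by simp
qed

lemma integrable_energy_form:
  assumes u: "u \<in> energy_space s \<Omega>" and v: "v \<in> energy_space s \<Omega>"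
  shows "integrable lborel (\<lambda>\<xi>. of_real (fraclog_symbol s \<xi>) * (fourier u \<xi> * cnj (fourier v \<xi>)))"
proof (rule Bochner_Integration.integrable_bound)
  have [measurable]: "u \<in> borel_measurable borel" "v \<in> borel_measurable borel"
    using u v by (auto simp: energy_space_iff)
  show "integrable lborel (\<lambda>\<xi>. \<bar>fraclog_symbol s \<xi>\<bar> * (cmod (fourier u \<xi>))\<^sup>2 + \<bar>fraclog_symbol s \<xi>\<bar> * (cmod (fourier v \<xi>))\<^sup>2)"
    using u v by (auto simp: energy_space_iff)
  show "(\<lambda>\<xi>. of_real (fraclog_symbol s \<xi>) * (fourier u \<xi> * cnj (fourier v \<xi>))) \<in> borel_measurable lborel"
    by measurable
  show "AE \<xi> in lborel. norm (of_real (fraclog_symbol s \<xi>) * (fourier u \<xi> * cnj (fourier v \<xi>)))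
      \<le> norm (\<bar>fraclog_symbol s \<xi>\<bar> * (cmod (fourier u \<xi>))\<^sup>2 + \<bar>fraclog_symbol s \<xi>\<bar> * (cmod (fourier v \<xi>))\<^sup>2)"
  proof (intro AE_I2)
    fix \<xi>
    have "norm (of_real (fraclog_symbol s \<xi>) * (fourier u \<xi> * cnj (fourier v \<xi>))) \<le>
        \<bar>fraclog_symbol s \<xi>\<bar> * ((cmod (fourier u \<xi>))\<^sup>2 + (cmod (fourier v \<xi>))\<^sup>2)"
      unfolding norm_mult[of "of_real (fraclog_symbol s \<xi>)"] norm_of_real
      by (intro mult_left_mono cmod_mult_cnj_le) auto
    then show "norm (of_real (fraclog_symbol s \<xi>) * (fourier u \<xi> * cnj (fourier v \<xi>)))
      \<le> norm (\<bar>fraclog_symbol s \<xi>\<bar> * (cmod (fourier u \<xi>))\<^sup>2 + \<bar>fraclog_symbol s \<xi>\<bar> * (cmod (fourier v \<xi>))\<^sup>2)"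
      by (simp add: distrib_left)
  qed
qed

lemma energy_form_diff_cmult:
  assumes u: "u \<in> energy_space s \<Omega>" and v: "v \<in> energy_space s \<Omega>" and w: "w \<in> energy_space s \<Omega>"
  shows "energy_form s (\<lambda>x. u x - c * v x) w = energy_form s u w - c * energy_form s v w"
proof -
  have F: "fourier (\<lambda>x. u x - c * v x) \<xi> = fourier u \<xi> - c * fourier v \<xi>" for \<xi>
    by (intro fourier_diff_cmult energy_space_integrable u v)
  have "energy_form s (\<lambda>x. u x - c * v x) w =
     (\<integral>\<xi>. of_real (fraclog_symbol s \<xi>) * (fourier u \<xi> * cnj (fourier w \<xi>)) -
       c * (of_real (fraclog_symbol s \<xi>) * (fourier v \<xi> * cnj (fourier w \<xi>))) \<partial>lborel)"
    unfolding energy_form_eq F by (simp only: left_diff_distrib right_diff_distrib mult_ac)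
  also have "\<dots> = energy_form s u w - c * energy_form s v w"
    unfolding energy_form_eq integral_mult_right_zero[symmetric]
    by (intro Bochner_Integration.integral_diff integrable_mult_right integrable_energy_form u v w)
  finally show ?thesis .
qed

text \<open>The second factor vanishes almost everywhere off \<Omega>, so the inner product over
  \<Omega> is an integral over the whole space, where Fourier arguments apply.\<close>

lemma L2_inner_restrict:
  assumes "v \<in> energy_space s \<Omega>" and "u \<in> borel_measurable borel"
  shows "L2_inner (restrict_space lborel \<Omega>) u v = (\<integral>x. u x * cnj (v x) \<partial>lborel)"
proof -
  have [measurable]: "\<Omega> \<in> sets borel" "u \<in> borel_measurable borel" "v \<in> borel_measurable borel"
    using open_dom assms by (auto simp: energy_space_iff)
  have "AE x in lborel. x \<notin> \<Omega> \<longrightarrow> v x = 0" using assms(1) by (simp add: energy_space_iff)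
  then have "AE x in lborel. indicator \<Omega> x *\<^sub>R (u x * cnj (v x)) = u x * cnj (v x)"
    by eventually_elim (auto simp: indicator_def)
  then show ?thesis
    unfolding L2_inner_def by (subst integral_restrict_space) (auto intro!: integral_cong_AE)
qed

lemma integrable_L2_inner:
  assumes u: "u \<in> energy_space s \<Omega>" and v: "v \<in> energy_space s \<Omega>"
  shows "integrable lborel (\<lambda>x. u x * cnj (v x))"
proof (rule Bochner_Integration.integrable_bound)
  have [measurable]: "u \<in> borel_measurable borel" "v \<in> borel_measurable borel"
    using u v by (auto simp: energy_space_iff)
  show "integrable lborel (\<lambda>x. (cmod (u x))\<^sup>2 + (cmod (v x))\<^sup>2)"
    using u v by (auto simp: energy_space_iff)
  show "(\<lambda>x. u x * cnj (v x)) \<in> borel_measurable lborel" by measurable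
  show "AE x in lborel. norm (u x * cnj (v x)) \<le> norm ((cmod (u x))\<^sup>2 + (cmod (v x))\<^sup>2)"
    using cmod_mult_cnj_le by auto
qed

lemma L2_inner_diff_cmult:
  assumes u: "u \<in> energy_space s \<Omega>" and v: "v \<in> energy_space s \<Omega>" and w: "w \<in> energy_space s \<Omega>"
  shows "L2_inner (restrict_space lborel \<Omega>) (\<lambda>x. u x - c * v x) w =
     L2_inner (restrict_space lborel \<Omega>) u w - c * L2_inner (restrict_space lborel \<Omega>) v w"
proof -
  have [measurable]: "u \<in> borel_measurable borel" "v \<in> borel_measurable borel"
    using u v by (auto simp: energy_space_iff)
  have "L2_inner (restrict_space lborel \<Omega>) (\<lambda>x. u x - c * v x) w =
     (\<integral>x. u x * cnj (w x) - c * (v x * cnj (w x)) \<partial>lborel)"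
    by (subst L2_inner_restrict[OF w]) (simp_all add: left_diff_distrib mult.assoc)
  also have "\<dots> = L2_inner (restrict_space lborel \<Omega>) u w - c * L2_inner (restrict_space lborel \<Omega>) v w"
    unfolding L2_inner_restrict[OF w \<open>u \<in> borel_measurable borel\<close>]
      L2_inner_restrict[OF w \<open>v \<in> borel_measurable borel\<close>] integral_mult_right_zero[symmetric]
    by (intro Bochner_Integration.integral_diff integrable_mult_right integrable_L2_inner u v w)
  finally show ?thesis .
qed

text \<open>The symbol is at least -1/s, and since this constant is negative, Bessel's inequality
  for the transform goes in the required direction.\<close>

lemma energy_form_lower_bound:
  assumes u: "u \<in> energy_space s \<Omega>" and s: "0 < s"
  shows "- (1 / s) * (\<integral>x. (cmod (u x))\<^sup>2 \<partial>lborel) \<le> Re (energy_form s u u)"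
proof -
  have ui: "integrable lborel u" "integrable lborel (\<lambda>x. (cmod (u x))\<^sup>2)"
    using energy_space_integrable[OF u] u by (auto simp: energy_space_iff)
  have [measurable]: "u \<in> borel_measurable borel" using u by (auto simp: energy_space_iff)
  have i: "integrable lborel (\<lambda>\<xi>. fraclog_symbol s \<xi> * (cmod (fourier u \<xi>))\<^sup>2)"
    using u by (intro integrable_norm_cancel[of lborel "\<lambda>\<xi>. fraclog_symbol s \<xi> * (cmod (fourier u \<xi>))\<^sup>2"])
      (auto simp: energy_space_iff abs_mult)
  have "- (1 / s) * (\<integral>x. (cmod (u x))\<^sup>2 \<partial>lborel) \<le> - (1 / s) * (\<integral>\<xi>. (cmod (fourier u \<xi>))\<^sup>2 \<partial>lborel)"
    using fourier_bessel[OF ui] s by (simp add: divide_right_mono)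
  also have "\<dots> = (\<integral>\<xi>. - (1 / s) * (cmod (fourier u \<xi>))\<^sup>2 \<partial>lborel)"
    by simp
  also have "\<dots> \<le> (\<integral>\<xi>. fraclog_symbol s \<xi> * (cmod (fourier u \<xi>))\<^sup>2 \<partial>lborel)"
    by (intro integral_mono i integrable_mult_right integrable_fourier_square ui mult_right_mono fraclog_symbol_ge s) auto
  also have "\<dots> = Re (energy_form s u u)"
  proof -
    have "of_real (fraclog_symbol s \<xi>) * (fourier u \<xi> * cnj (fourier u \<xi>)) =
        complex_of_real (fraclog_symbol s \<xi> * (cmod (fourier u \<xi>))\<^sup>2)" for \<xi>
      by (simp only: complex_norm_square of_real_mult)
    then show ?thesis unfolding energy_form_eq by (simp del: of_real_mult)
  qed
  finally show ?thesis .
qed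

end

section \<open>Expansion in eigenfunctions\<close>

lemma energy_form_hermitian: "energy_form s v u = cnj (energy_form s u v)"
  unfolding energy_form_eq Bochner_Integration.integral_cnj[symmetric] by (simp add: mult_ac)

lemma L2_inner_hermitian: "L2_inner M v u = cnj (L2_inner M u v)"
  unfolding L2_inner_def Bochner_Integration.integral_cnj[symmetric] by (simp add: mult_ac)

text \<open>Components are removed one at a time: the new remainder is \<open>P\<close>-orthogonal
  to the eigenfunction just removed, and the eigenvalue equation turns this into
  \<open>B\<close>-orthogonality, so each step subtracts one diagonal term. The two forms are
  abstract because the lemma is used twice: with \<open>B\<close> the energy and with
  \<open>B\<close> equal to the inner product itself, all eigenvalues then being 1.\<close>

lemma hermitian_form_remainder:
  fixes H :: "('a \<Rightarrow> complex) set" and B P :: "('a \<Rightarrow> complex) \<Rightarrow> ('a \<Rightarrow> complex) \<Rightarrow> complex"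
    and \<mu> :: "nat \<Rightarrow> real" and g :: "'a \<Rightarrow> complex"
  assumes closed: "\<And>u v c. u \<in> H \<Longrightarrow> v \<in> H \<Longrightarrow> (\<lambda>x. u x - c * v x) \<in> H"
    and B_lin: "\<And>u v w c. u \<in> H \<Longrightarrow> v \<in> H \<Longrightarrow> w \<in> H \<Longrightarrow> B (\<lambda>x. u x - c * v x) w = B u w - c * B v w"
    and B_herm: "\<And>u v. B v u = cnj (B u v)"
    and P_lin: "\<And>u v w c. u \<in> H \<Longrightarrow> v \<in> H \<Longrightarrow> w \<in> H \<Longrightarrow> P (\<lambda>x. u x - c * v x) w = P u w - c * P v w"
    and P_herm: "\<And>u v. P v u = cnj (P u v)"
    and \<phi>: "\<And>j. j \<ge> 1 \<Longrightarrow> \<phi> j \<in> H"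
    and eig: "\<And>j v. j \<ge> 1 \<Longrightarrow> v \<in> H \<Longrightarrow> B (\<phi> j) v = of_real (\<mu> j) * P (\<phi> j) v"
    and orth: "\<And>i j. i \<ge> 1 \<Longrightarrow> j \<ge> 1 \<Longrightarrow> P (\<phi> i) (\<phi> j) = (if i = j then 1 else 0)"
    and g: "g \<in> H"
  defines "r \<equiv> \<lambda>N x. g x - (\<Sum>j=1..N. P g (\<phi> j) * \<phi> j x)"
  shows "r N \<in> H"
    and "B (r N) (r N) = B g g - of_real (\<Sum>j=1..N. \<mu> j * (cmod (P g (\<phi> j)))\<^sup>2)"
proof -
  \<comment> \<open>The middle conjunct is the extra induction invariant: removing earlier
    components does not change later coefficients, so the coefficient of \<open>r N\<close> at the
    next eigenfunction is that of \<open>g\<close>.\<close>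
  have "r N \<in> H \<and> (\<forall>j>N. P (r N) (\<phi> j) = P g (\<phi> j)) \<and>
      B (r N) (r N) = B g g - of_real (\<Sum>j=1..N. \<mu> j * (cmod (P g (\<phi> j)))\<^sup>2)"
  proof (induction N)
    case 0
    then show ?case using g by (simp add: r_def)
  next
    case (Suc N)
    define c where "c = P g (\<phi> (Suc N))"
    let ?f = "\<phi> (Suc N)"
    have rS: "r (Suc N) = (\<lambda>x. r N x - c * ?f x)"
      by (simp add: r_def c_def fun_eq_iff algebra_simps)
    have rH: "r N \<in> H" and fH: "?f \<in> H" using Suc \<phi>[of "Suc N"] by auto
    have rSH: "r (Suc N) \<in> H" unfolding rS by (intro closed rH fH)
    have Pf: "P (r N) ?f = c" using Suc by (simp add: c_def)
    have P_rest: "P (r (Suc N)) (\<phi> j) = P g (\<phi> j)" if "j > Suc N" for j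
      unfolding rS using that Suc \<phi>[of j] orth[of "Suc N" j] by (subst P_lin[OF rH fH]) auto
    have "P (r (Suc N)) ?f = 0"
      unfolding rS using orth[of "Suc N" "Suc N"] by (subst P_lin[OF rH fH fH]) (simp add: Pf)
    then have Bf: "B ?f (r (Suc N)) = 0"
      using eig[of "Suc N" "r (Suc N)"] rSH P_herm[of ?f "r (Suc N)"] by simp
    have "B (r (Suc N)) (r (Suc N)) = B (r N) (r (Suc N)) - c * B ?f (r (Suc N))"
      by (subst rS) (rule B_lin[OF rH fH rSH])
    also have "\<dots> = cnj (B (r (Suc N)) (r N))" using Bf B_herm[of "r N" "r (Suc N)"] by simp
    also have "B (r (Suc N)) (r N) = B (r N) (r N) - c * B ?f (r N)"
      by (subst rS) (rule B_lin[OF rH fH rH])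
    also have "B ?f (r N) = of_real (\<mu> (Suc N)) * cnj c"
      using eig[of "Suc N" "r N"] rH P_herm[of ?f "r N"] Pf by simp
    also have "cnj (B (r N) (r N) - c * (of_real (\<mu> (Suc N)) * cnj c)) =
        B (r N) (r N) - of_real (\<mu> (Suc N)) * (c * cnj c)"
      using B_herm[of "r N" "r N"] by (simp add: mult_ac)
    also have "\<dots> = B g g - of_real (\<Sum>j=1..Suc N. \<mu> j * (cmod (P g (\<phi> j)))\<^sup>2)"
      using Suc unfolding complex_norm_square[symmetric] by (simp add: c_def algebra_simps)
    finally show ?case using rSH P_rest by blast
  qed
  then show "r N \<in> H" "B (r N) (r N) = B g g - of_real (\<Sum>j=1..N. \<mu> j * (cmod (P g (\<phi> j)))\<^sup>2)"
    by auto
qed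

text \<open>
  The form is only semibounded, so Parseval's identity for it is replaced by an inequality: the
  energy of the remainder of the eigenfunction expansion is at least a negative multiple of its
  squared norm, which tends to zero.
\<close>

lemma energy_form_ge_spectral:
  fixes \<Omega> :: "(real^'n) set"
  assumes s: "0 < s" and dom: "open \<Omega>" "bounded \<Omega>"
    and mono: "mono_on {1..} lam"
    and basis: "L2_orthonormal_basis (restrict_space lborel \<Omega>) \<phi>"
    and \<phi>: "\<And>j. j \<ge> 1 \<Longrightarrow> \<phi> j \<in> energy_space s \<Omega>"
    and eig: "\<And>j v. j \<ge> 1 \<Longrightarrow> v \<in> energy_space s \<Omega> \<Longrightarrow>
      energy_form s (\<phi> j) v = of_real (lam j) * L2_inner (restrict_space lborel \<Omega>) (\<phi> j) v"
    and g: "g \<in> energy_space s \<Omega>"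
  shows "lam (Suc k) * (\<integral>x. (cmod (g x))\<^sup>2 \<partial>lborel) +
      (\<Sum>j=1..k. (lam j - lam (Suc k)) * (cmod (L2_inner (restrict_space lborel \<Omega>) g (\<phi> j)))\<^sup>2)
    \<le> Re (energy_form s g g)"
proof -
  let ?M = "restrict_space lborel \<Omega>"
  let ?H = "energy_space s \<Omega>"
  define c where "c j = (cmod (L2_inner ?M g (\<phi> j)))\<^sup>2" for j
  define r where "r N x = g x - (\<Sum>j=1..N. L2_inner ?M g (\<phi> j) * \<phi> j x)" for N x
  define p where "p N = (\<integral>x. (cmod (r N x))\<^sup>2 \<partial>lborel)" for N
  define G where "G = (\<integral>x. (cmod (g x))\<^sup>2 \<partial>lborel)"
  have orth: "L2_inner ?M (\<phi> i) (\<phi> j) = (if i = j then 1 else 0)" if "i \<ge> 1" "j \<ge> 1" for i j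
    using basis that by (auto simp: L2_orthonormal_basis_def)
  note rem = hermitian_form_remainder[where H = ?H and P = "L2_inner ?M" and \<phi> = \<phi> and g = g]
  have r: "r N \<in> ?H" for N
    unfolding r_def[abs_def]
    by (rule rem(1)[where B = "energy_form s" and \<mu> = lam,
      OF energy_space_diff_cmult[OF dom] energy_form_diff_cmult[OF dom] energy_form_hermitian
        L2_inner_diff_cmult[OF dom] L2_inner_hermitian \<phi> eig orth g])
  have E: "energy_form s (r N) (r N) = energy_form s g g - of_real (\<Sum>j=1..N. lam j * c j)" for N
    unfolding r_def[abs_def] c_def
    by (rule rem(2)[where B = "energy_form s" and \<mu> = lam,
      OF energy_space_diff_cmult[OF dom] energy_form_diff_cmult[OF dom] energy_form_hermitian
        L2_inner_diff_cmult[OF dom] L2_inner_hermitian \<phi> eig orth g])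
  \<comment> \<open>The inner product satisfies the eigenvalue equation relative to itself with
    eigenvalue 1; the remainder lemma then yields the Pythagorean identity for
    \<open>p N\<close>.\<close>
  have triv: "L2_inner ?M (\<phi> j) v = of_real 1 * L2_inner ?M (\<phi> j) v" for j v by simp
  have P: "L2_inner ?M (r N) (r N) = L2_inner ?M g g - of_real (\<Sum>j=1..N. 1 * c j)" for N
    unfolding r_def[abs_def] c_def
    by (rule rem(2)[where B = "L2_inner ?M" and \<mu> = "\<lambda>_. 1",
      OF energy_space_diff_cmult[OF dom] L2_inner_diff_cmult[OF dom] L2_inner_hermitian
        L2_inner_diff_cmult[OF dom] L2_inner_hermitian \<phi> triv orth g])
  have self: "L2_inner ?M u u = of_real (\<integral>x. (cmod (u x))\<^sup>2 \<partial>lborel)" if "u \<in> ?H" for u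
  proof -
    have "u \<in> borel_measurable borel" using that by (simp add: energy_space_iff)
    then show ?thesis
      unfolding L2_inner_restrict[OF dom that \<open>u \<in> borel_measurable borel\<close>] complex_norm_square[symmetric]
      by (simp del: of_real_power)
  qed
  have pN: "p N = G - (\<Sum>j=1..N. c j)" for N
  proof -
    have "complex_of_real (p N) = of_real (G - (\<Sum>j=1..N. c j))"
      using P[of N] unfolding self[OF r[of N]] self[OF g] by (simp add: p_def G_def)
    then show ?thesis by (simp only: of_real_eq_iff)
  qed
  have p0: "p \<longlonglongrightarrow> 0"
  proof -
    have [measurable]: "\<Omega> \<in> sets borel" using dom by simp
    have "g \<in> L2_fun ?M"
    proof -
      have "integrable lborel (\<lambda>x. (cmod (g x))\<^sup>2)" "g \<in> borel_measurable borel"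
        using g by (auto simp: energy_space_iff)
      then show ?thesis
        using integrable_mult_indicator[of \<Omega> lborel "\<lambda>x. (cmod (g x))\<^sup>2"]
        by (auto simp: L2_fun_def integrable_restrict_space measurable_restrict_space1)
    qed
    then have "(\<lambda>N. \<integral>x. (cmod (r N x))\<^sup>2 \<partial>?M) \<longlonglongrightarrow> 0"
      using basis unfolding L2_orthonormal_basis_def r_def by blast
    moreover have "(\<integral>x. (cmod (r N x))\<^sup>2 \<partial>?M) = p N" for N
    proof -
      have [measurable]: "r N \<in> borel_measurable borel" using r[of N] by (simp add: energy_space_iff)
      have "AE x in lborel. x \<notin> \<Omega> \<longrightarrow> r N x = 0" using r[of N] by (simp add: energy_space_iff)
      then have "AE x in lborel. indicator \<Omega> x *\<^sub>R (cmod (r N x))\<^sup>2 = (cmod (r N x))\<^sup>2"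
        by eventually_elim (auto simp: indicator_def)
      then show ?thesis
        unfolding p_def by (subst integral_restrict_space) (auto intro!: integral_cong_AE)
    qed
    ultimately show ?thesis by simp
  qed
  define A where "A = lam (Suc k) * G + (\<Sum>j=1..k. (lam j - lam (Suc k)) * c j)"
  \<comment> \<open>The projection goes onto the first \<open>N\<close> eigenfunctions with
    \<open>N\<close> at least \<open>k\<close>, and \<open>N\<close> tends to infinity afterwards.
    The error is a fixed multiple of \<open>p N\<close>: it collects the negative lower bound of the
    energy and the part of the mass of \<open>g\<close> not yet captured.\<close>
  have ineq: "A - (lam (Suc k) + 1 / s) * p N \<le> Re (energy_form s g g)" if N: "N \<ge> k" for N
  proof -
    have "- (1 / s) * p N \<le> Re (energy_form s (r N) (r N))"
      unfolding p_def by (rule energy_form_lower_bound[OF dom r s])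
    also have "\<dots> = Re (energy_form s g g) - (\<Sum>j=1..N. lam j * c j)"
      unfolding E by simp
    finally have 1: "(\<Sum>j=1..N. lam j * c j) - (1 / s) * p N \<le> Re (energy_form s g g)" by simp
    \<comment> \<open>Beyond \<open>k\<close> the differences of eigenvalues are nonnegative by
      monotonicity, so extending the sum can only increase it.\<close>
    have "(\<Sum>j=1..k. (lam j - lam (Suc k)) * c j) \<le> (\<Sum>j=1..N. (lam j - lam (Suc k)) * c j)"
    proof (rule sum_mono2)
      fix j assume "j \<in> {1..N} - {1..k}"
      then have "lam (Suc k) \<le> lam j" by (intro mono_onD[OF mono]) auto
      then show "0 \<le> (lam j - lam (Suc k)) * c j" by (simp add: c_def)
    qed (use N in auto)
    also have "\<dots> = (\<Sum>j=1..N. lam j * c j) - lam (Suc k) * (\<Sum>j=1..N. c j)"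
      by (simp add: left_diff_distrib sum_subtractf sum_distrib_left)
    also have "(\<Sum>j=1..N. c j) = G - p N" using pN[of N] by simp
    finally show ?thesis using 1 by (simp add: A_def algebra_simps)
  qed
  have "(\<lambda>N. A - (lam (Suc k) + 1 / s) * p N) \<longlonglongrightarrow> A - (lam (Suc k) + 1 / s) * 0"
    by (intro tendsto_intros p0)
  then have "A \<le> Re (energy_form s g g)"
    by (intro LIMSEQ_le_const2[of _ A]) (use ineq in auto)
  then show ?thesis by (simp add: A_def G_def c_def)
qed

section \<open>Estimates for the symbol\<close>

text \<open>A fraction in [0,1] is at most its s-th power; apply this to the shares of
  \<open>a\<close> and \<open>b\<close> in \<open>a + b\<close>, which sum to 1.\<close>

lemma powr_add_le_add_powr:
  fixes a b :: real
  assumes "0 \<le> a" "0 \<le> b" "0 < s" "s \<le> 1"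
  shows "(a + b) powr s \<le> a powr s + b powr s"
proof (cases "a + b = 0")
  case False
  then have ab: "a + b > 0" using assms by linarith
  have *: "c / (a + b) * (a + b) powr s \<le> c powr s" if c: "0 \<le> c" "c \<le> a + b" for c
  proof (cases "c = 0")
    case False
    have "c / (a + b) \<le> (c / (a + b)) powr s"
      using powr_mono'[of s 1 "c / (a + b)"] assms ab c False by simp
    then have "c / (a + b) * (a + b) powr s \<le> (c / (a + b)) powr s * (a + b) powr s"
      by (intro mult_right_mono) auto
    also have "\<dots> = c powr s" using ab c by (simp flip: powr_mult)
    finally show ?thesis .
  qed simp
  have "(a + b) powr s = (a / (a + b) + b / (a + b)) * (a + b) powr s"
    using ab by (simp flip: add_divide_distrib)
  also have "\<dots> \<le> a powr s + b powr s"
    unfolding distrib_right using assms by (intro add_mono *) auto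
  finally show ?thesis .
qed (use assms in simp)

text \<open>The quadratic bound on r^(2s) ln r^2 is applied at r/R and scaled back. The logarithm
  then appears only as the exact multiple \<open>2 * ln R\<close> of the homogeneous symbol, and the
  remainder is free of logarithms.\<close>

lemma fraclog_symbol_le_scaled:
  assumes "s < 1" "R > 0"
  shows "fraclog_symbol s \<xi> \<le> 2 * ln R * norm \<xi> powr (2 * s) + R powr (2 * s - 2) * (norm \<xi>)\<^sup>2 / (1 - s)"
proof (cases "\<xi> = 0")
  case False
  define r where "r = norm \<xi>"
  have r: "r > 0" using False by (simp add: r_def)
  have "R powr (2 * s) * ((r / R) powr (2 * s) * ln ((r / R)\<^sup>2)) \<le> R powr (2 * s) * ((r / R)\<^sup>2 / (1 - s))"
    using assms r by (intro mult_left_mono powr_ln_square_le) auto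
  also have "R powr (2 * s) * ((r / R) powr (2 * s) * ln ((r / R)\<^sup>2)) = r powr (2 * s) * (2 * ln r - 2 * ln R)"
    using assms r by (simp add: ln_realpow ln_div powr_divide)
  also have "R powr (2 * s) * ((r / R)\<^sup>2 / (1 - s)) = R powr (2 * s - 2) * r\<^sup>2 / (1 - s)"
    using assms r by (simp add: powr_diff power_divide)
  finally show ?thesis
    using r by (simp add: fraclog_symbol_def r_def[symmetric] ln_realpow algebra_simps)
qed (simp add: fraclog_symbol_def)

text \<open>Young's inequality with weight e = R^(-1/2), followed by subadditivity of the s-th
  power. The aim is a bound that survives multiplication by ln R: the coefficient of the main term
  exceeds 1 only by a negative power of R, and the remainder falls short of R^(2s) + R^(2s-1)
  |eta|^2 by the factor R^(s/2), which absorbs the logarithm.\<close>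

lemma norm_add_powr_le:
  fixes z \<eta> :: "'a::real_inner"
  assumes s: "0 < s" "s < 1" and R: "R \<ge> 1"
  shows "norm (\<eta> + z) powr (2 * s) \<le> (1 + R powr (-1/2)) * norm z powr (2 * s) +
    2 * R powr (s / 2) * (R powr s + R powr (s - 1) * (norm \<eta>)\<^sup>2)"
proof -
  define e where "e = R powr (-1/2)"
  have e: "0 < e" "e \<le> 1" and e': "1 / e = R powr (1/2)"
  proof -
    show "0 < e" "e \<le> 1" using R powr_mono[of "-1/2" 0 R] by (auto simp: e_def)
    show "1 / e = R powr (1/2)" using R by (simp add: e_def powr_minus_divide)
  qed
  have sq: "x powr (2 * s) = (x\<^sup>2) powr s" if "0 \<le> x" for x :: real
    using that powr_powr[of x 2 s] by (cases "x = 0") auto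
  have "2 * (norm z * norm \<eta>) \<le> e * (norm z)\<^sup>2 + (norm \<eta>)\<^sup>2 / e"
  proof -
    have "0 \<le> (e * norm z - norm \<eta>)\<^sup>2 / e" using e by simp
    also have "\<dots> = e * (norm z)\<^sup>2 + (norm \<eta>)\<^sup>2 / e - 2 * (norm z * norm \<eta>)"
      using e by (simp add: power2_eq_square field_simps)
    finally show ?thesis by simp
  qed
  moreover have "(norm (\<eta> + z))\<^sup>2 \<le> (norm \<eta> + norm z)\<^sup>2"
    by (intro power_mono norm_triangle_ineq) auto
  ultimately have "(norm (\<eta> + z))\<^sup>2 \<le> (1 + e) * (norm z)\<^sup>2 + (1 + 1 / e) * (norm \<eta>)\<^sup>2"
    by (simp add: power2_sum algebra_simps)
  then have "((norm (\<eta> + z))\<^sup>2) powr s \<le> ((1 + e) * (norm z)\<^sup>2 + (1 + 1 / e) * (norm \<eta>)\<^sup>2) powr s"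
    using s by (intro powr_mono2) auto
  also have "\<dots> \<le> ((1 + e) * (norm z)\<^sup>2) powr s + ((1 + 1 / e) * (norm \<eta>)\<^sup>2) powr s"
    using e s by (intro powr_add_le_add_powr) auto
  also have "((1 + e) * (norm z)\<^sup>2) powr s = (1 + e) powr s * norm z powr (2 * s)"
    using e by (simp add: powr_mult sq)
  also have "((1 + 1 / e) * (norm \<eta>)\<^sup>2) powr s = (1 + 1 / e) powr s * norm \<eta> powr (2 * s)"
    using e by (simp add: powr_mult sq)
  also have "(1 + e) powr s * norm z powr (2 * s) \<le> (1 + e) * norm z powr (2 * s)"
    using powr_mono[of s 1 "1 + e"] e s by (intro mult_right_mono) auto
  also have "(1 + 1 / e) powr s * norm \<eta> powr (2 * s) \<le>
      (2 * R powr (s / 2)) * (R powr s + R powr (s - 1) * (norm \<eta>)\<^sup>2)"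
  proof (intro mult_mono)
    have "1 \<le> R powr (1/2)" using R by (simp add: ge_one_powr_ge_zero)
    then have "(1 + 1 / e) powr s \<le> (2 * R powr (1/2)) powr s"
      unfolding e' using s by (intro powr_mono2) auto
    also have "\<dots> = 2 powr s * R powr (s / 2)" by (simp add: powr_mult powr_powr)
    also have "\<dots> \<le> 2 * R powr (s / 2)"
      using powr_mono[of s 1 "2::real"] s by (intro mult_right_mono) auto
    finally show "(1 + 1 / e) powr s \<le> 2 * R powr (s / 2)" .
    show "norm \<eta> powr (2 * s) \<le> R powr s + R powr (s - 1) * (norm \<eta>)\<^sup>2"
    \<comment> \<open>Splitting at |eta|^2 = R: below it the power is at most R^s, above it one
      factor |eta|^2 is kept and the remaining power has the negative exponent s - 1.\<close>
    proof (cases "(norm \<eta>)\<^sup>2 \<le> R")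
      case True
      then have "((norm \<eta>)\<^sup>2) powr s \<le> R powr s" using s by (intro powr_mono2) auto
      then show ?thesis by (simp add: sq add_increasing2)
    next
      case False
      then have "((norm \<eta>)\<^sup>2) powr (s - 1) \<le> R powr (s - 1)"
        using s R by (intro powr_mono2') auto
      then have "((norm \<eta>)\<^sup>2) powr (s - 1) * (norm \<eta>)\<^sup>2 \<le> R powr (s - 1) * (norm \<eta>)\<^sup>2"
        by (intro mult_right_mono) auto
      moreover have "((norm \<eta>)\<^sup>2) powr s = ((norm \<eta>)\<^sup>2) powr (s - 1) * (norm \<eta>)\<^sup>2"
        using False R by (simp add: powr_diff)
      ultimately show ?thesis by (simp add: sq add_increasing)
    qed
  qed auto
  finally show ?thesis by (simp add: sq e_def)
qed

text \<open>The three parts of the constant come from three error terms: 4 from ln R \<le> 2 R^(1/2)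
  against the weight R^(-1/2), 8/s from ln R \<le> (2/s) R^(s/2), and 2/(1-s) from the quadratic
  remainder of the rescaled symbol. The bracket has the size R^(2s) once it is averaged against a
  transform whose second moment is O(R).\<close>

lemma fraclog_symbol_shift_le:
  fixes z \<eta> :: "'a::real_inner"
  assumes s: "0 < s" "s < 1" and R: "R \<ge> 1" and z: "norm z \<le> R"
  shows "fraclog_symbol s (\<eta> + z) \<le> 2 * ln R * norm z powr (2 * s) +
    (4 + 8 / s + 2 / (1 - s)) * (R powr (2 * s) + R powr (2 * s - 1) * (norm \<eta>)\<^sup>2)"
proof -
  define T where "T = R powr (2 * s) + R powr (2 * s - 1) * (norm \<eta>)\<^sup>2"
  have T1: "R powr (2 * s) \<le> T" by (simp add: T_def)
  have ln0: "0 \<le> ln R" using R by simp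
  have A: "R powr (2 * s - 2) * (norm (\<eta> + z))\<^sup>2 \<le> 2 * T"
  proof -
    have "(norm (\<eta> + z))\<^sup>2 \<le> (norm \<eta> + norm z)\<^sup>2"
      by (intro power_mono norm_triangle_ineq) auto
    also have "\<dots> \<le> 2 * (norm \<eta>)\<^sup>2 + 2 * (norm z)\<^sup>2"
      using sum_squares_bound[of "norm \<eta>" "norm z"] by (simp add: power2_sum)
    also have "\<dots> \<le> 2 * (norm \<eta>)\<^sup>2 + 2 * R\<^sup>2" using z by (simp add: power_mono)
    finally have "R powr (2 * s - 2) * (norm (\<eta> + z))\<^sup>2 \<le> R powr (2 * s - 2) * (2 * (norm \<eta>)\<^sup>2 + 2 * R\<^sup>2)"
      by (intro mult_left_mono) auto
    also have "\<dots> = 2 * (R powr (2 * s - 2) * (norm \<eta>)\<^sup>2) + 2 * R powr (2 * s)"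
      using R by (simp add: powr_diff field_simps)
    also have "R powr (2 * s - 2) * (norm \<eta>)\<^sup>2 \<le> R powr (2 * s - 1) * (norm \<eta>)\<^sup>2"
      using R by (intro mult_right_mono powr_mono) auto
    finally show ?thesis by (simp add: T_def)
  qed
  have B1: "2 * ln R * (R powr (-1/2) * norm z powr (2 * s)) \<le> 4 * T"
  proof -
    have "2 * ln R * (R powr (-1/2) * norm z powr (2 * s)) \<le> 2 * (2 * R powr (1/2)) * (R powr (-1/2) * R powr (2 * s))"
    proof (rule mult_mono)
      show "2 * ln R \<le> 2 * (2 * R powr (1/2))" using ln_powr_bound[of R "1/2"] R by simp
      show "R powr (-1/2) * norm z powr (2 * s) \<le> R powr (-1/2) * R powr (2 * s)"
        using s z by (intro mult_left_mono powr_mono2) auto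
    qed auto
    also have "\<dots> = 4 * R powr (2 * s)" using R by (simp flip: powr_add)
    finally show ?thesis using T1 by simp
  qed
  have B2: "2 * ln R * (2 * R powr (s / 2) * (R powr s + R powr (s - 1) * (norm \<eta>)\<^sup>2)) \<le> 8 / s * T"
  proof -
    have "2 * ln R * (2 * R powr (s / 2) * (R powr s + R powr (s - 1) * (norm \<eta>)\<^sup>2)) \<le>
        2 * (R powr (s / 2) / (s / 2)) * (2 * R powr (s / 2) * (R powr s + R powr (s - 1) * (norm \<eta>)\<^sup>2))"
      using ln_powr_bound[of R "s / 2"] R s by (intro mult_right_mono) auto
    also have "\<dots> = 8 / s * ((R powr (s / 2) * R powr (s / 2)) * (R powr s + R powr (s - 1) * (norm \<eta>)\<^sup>2))"
      using s by (simp add: field_simps)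
    also have "R powr (s / 2) * R powr (s / 2) = R powr s" by (simp flip: powr_add)
    also have "R powr s * (R powr s + R powr (s - 1) * (norm \<eta>)\<^sup>2) = T"
      by (simp add: T_def distrib_left mult.assoc[symmetric] flip: powr_add)
    finally show ?thesis .
  qed
  have "fraclog_symbol s (\<eta> + z) \<le>
      2 * ln R * norm (\<eta> + z) powr (2 * s) + R powr (2 * s - 2) * (norm (\<eta> + z))\<^sup>2 / (1 - s)"
    using s R by (intro fraclog_symbol_le_scaled) auto
  also have "\<dots> \<le> 2 * ln R * ((1 + R powr (-1/2)) * norm z powr (2 * s) +
      2 * R powr (s / 2) * (R powr s + R powr (s - 1) * (norm \<eta>)\<^sup>2)) + 2 * T / (1 - s)"
    using s A ln0 by (intro add_mono mult_left_mono norm_add_powr_le R divide_right_mono) auto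
  also have "\<dots> = 2 * ln R * norm z powr (2 * s) + 2 * ln R * (R powr (-1/2) * norm z powr (2 * s)) +
      2 * ln R * (2 * R powr (s / 2) * (R powr s + R powr (s - 1) * (norm \<eta>)\<^sup>2)) + 2 / (1 - s) * T"
    by (simp only: distrib_left distrib_right mult_1_left add.assoc times_divide_eq_left)
  also have "\<dots> \<le> 2 * ln R * norm z powr (2 * s) + (4 + 8 / s + 2 / (1 - s)) * T"
    using B1 B2 unfolding distrib_right by linarith
  finally show ?thesis unfolding T_def .
qed

section \<open>Powers of the norm over balls\<close>

lemma nn_integral_powr_Icc:
  assumes "a > -1" "0 \<le> c"
  shows "(\<integral>\<^sup>+t. ennreal (t powr a) * indicator {0..c} t \<partial>lborel) = ennreal (c powr (a + 1) / (a + 1))"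
  by (rule nn_integral_has_integral_lebesgue'[OF _ has_integral_powr_from_0[OF assms]]) simp

text \<open>Layer cake: the p-th power of the norm is the integral of p t^(p-1) over t from 0 to the
  norm. After exchanging integrals the inner one is the volume of the shell between the radii t and
  R, so only the volume of balls is needed and no polar coordinates.\<close>

lemma nn_integral_norm_powr_ball:
  fixes p R :: real
  assumes p: "0 < p" and R: "0 < R"
  shows "(\<integral>\<^sup>+z. ennreal (norm z powr p) * indicator (ball 0 R) z \<partial>(lborel :: 'a::euclidean_space measure)) =
    ennreal (DIM('a) / (DIM('a) + p) * unit_ball_vol DIM('a) * R powr (DIM('a) + p))"
proof -
  define d where "d = real DIM('a)"
  define V where "V = unit_ball_vol (real DIM('a))"
  have d: "0 < d" and V: "0 \<le> V" by (auto simp: d_def V_def)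
  define f where "f z t = (if 0 \<le> t \<and> t \<le> norm z \<and> norm z < R then ennreal (p * t powr (p - 1)) else 0)"
    for z :: 'a and t :: real
  have f_meas [measurable]: "case_prod f \<in> borel_measurable (lborel \<Otimes>\<^sub>M lborel)"
    unfolding f_def[abs_def] by measurable
  have "ennreal (norm z powr p) * indicator (ball 0 R) z = (\<integral>\<^sup>+t. f z t \<partial>lborel)" for z :: 'a
  proof (cases "norm z < R")
    case True
    have "(\<integral>\<^sup>+t. f z t \<partial>lborel) = (\<integral>\<^sup>+t. ennreal p * (ennreal (t powr (p - 1)) * indicator {0..norm z} t) \<partial>lborel)"
      using True p by (intro nn_integral_cong) (auto simp: f_def indicator_def ennreal_mult)
    also have "\<dots> = ennreal p * ennreal (norm z powr p / p)"
      using p by (subst nn_integral_cmult) (auto simp: nn_integral_powr_Icc)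
    also have "\<dots> = ennreal (norm z powr p)"
      using p by (simp flip: ennreal_mult)
    finally show ?thesis using True by simp
  qed (simp add: f_def)
  then have "(\<integral>\<^sup>+z. ennreal (norm z powr p) * indicator (ball 0 R) z \<partial>(lborel :: 'a measure)) =
      (\<integral>\<^sup>+z. \<integral>\<^sup>+t. f z t \<partial>lborel \<partial>lborel)" by simp
  also have "\<dots> = (\<integral>\<^sup>+t. \<integral>\<^sup>+z. f z t \<partial>lborel \<partial>lborel)"
    by (rule lborel_pair.Fubini'[symmetric, OF f_meas])
  also have "\<dots> = (\<integral>\<^sup>+t. ennreal (p * V * (R ^ DIM('a) * t powr (p - 1) - t powr (d + p - 1))) * indicator {0..R} t \<partial>lborel)"
  proof (intro nn_integral_cong)
    fix t :: real
    show "(\<integral>\<^sup>+z. f z t \<partial>lborel) = ennreal (p * V * (R ^ DIM('a) * t powr (p - 1) - t powr (d + p - 1))) * indicator {0..R} t"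
    proof (cases "t \<in> {0..R}")
      case True
      have "{z::'a. norm z < R \<and> t \<le> norm z} = ball 0 R - ball 0 t" by (auto simp: dist_norm)
      then have "emeasure lborel {z::'a. norm z < R \<and> t \<le> norm z} = emeasure lborel (ball 0 R :: 'a set) - emeasure lborel (ball 0 t :: 'a set)"
      proof (simp only:, intro emeasure_Diff)
        show "emeasure lborel (ball 0 t :: 'a set) \<noteq> \<infinity>" using True by (subst emeasure_ball) auto
        show "ball 0 t \<subseteq> (ball 0 R :: 'a set)" using True by (intro subset_ball) auto
      qed auto
      also have "\<dots> = ennreal (V * R ^ DIM('a) - V * t ^ DIM('a))"
      proof -
        have "0 \<le> V * t ^ DIM('a)" using True V by simp
        moreover have "0 \<le> t" "0 \<le> R" using True R by auto
        ultimately show ?thesis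
          unfolding emeasure_ball[OF \<open>0 \<le> t\<close>] emeasure_ball[OF \<open>0 \<le> R\<close>] V_def by (intro ennreal_minus)
      qed
      finally have em: "emeasure lborel {z::'a. norm z < R \<and> t \<le> norm z} = ennreal (V * (R ^ DIM('a) - t ^ DIM('a)))"
        by (simp only: right_diff_distrib)
      have "(\<integral>\<^sup>+z. f z t \<partial>lborel) = ennreal p * ennreal (t powr (p - 1)) * emeasure lborel {z::'a. norm z < R \<and> t \<le> norm z}"
      proof -
        have "(\<integral>\<^sup>+z. f z t \<partial>lborel) =
            (\<integral>\<^sup>+z. ennreal p * ennreal (t powr (p - 1)) * indicator {z::'a. norm z < R \<and> t \<le> norm z} z \<partial>lborel)"
          using True p by (intro nn_integral_cong) (auto simp: f_def indicator_def ennreal_mult)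
        then show ?thesis by (subst (asm) nn_integral_cmult_indicator) auto
      qed
      also have "\<dots> = ennreal (p * V * (t powr (p - 1) * (R ^ DIM('a) - t ^ DIM('a))))"
      proof -
        have "0 \<le> V * (R ^ DIM('a) - t ^ DIM('a))" using V True by (simp add: power_mono)
        then have "ennreal p * ennreal (t powr (p - 1)) * ennreal (V * (R ^ DIM('a) - t ^ DIM('a))) =
            ennreal ((p * t powr (p - 1)) * (V * (R ^ DIM('a) - t ^ DIM('a))))"
          using p by (simp add: ennreal_mult)
        also have "(p * t powr (p - 1)) * (V * (R ^ DIM('a) - t ^ DIM('a))) = p * V * (t powr (p - 1) * (R ^ DIM('a) - t ^ DIM('a)))"
          by (simp only: mult_ac)
        finally show ?thesis unfolding em .
      qed
      also have "t powr (p - 1) * (R ^ DIM('a) - t ^ DIM('a)) = R ^ DIM('a) * t powr (p - 1) - t powr (d + p - 1)"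
      proof (cases "t = 0")
        case False
        with True have t: "t > 0" by simp
        have "t powr (d + p - 1) = t powr d * t powr (p - 1)" by (simp only: powr_add[symmetric] add_diff_eq)
        also have "t powr d = t ^ DIM('a)" using t by (simp add: d_def powr_realpow)
        finally show ?thesis by (simp only: right_diff_distrib mult.commute)
      qed simp
      finally show ?thesis using True by simp
    next
      case False
      then have "f z t = 0" for z by (auto simp: f_def)
      with False show ?thesis by simp
    qed
  qed
  also have "\<dots> = ennreal (p * V * (R ^ DIM('a) * (R powr (p - 1 + 1) / (p - 1 + 1)) - R powr (d + p - 1 + 1) / (d + p - 1 + 1)))"
  proof (rule nn_integral_has_integral_lebesgue')
    show "((\<lambda>t. p * V * (R ^ DIM('a) * t powr (p - 1) - t powr (d + p - 1))) has_integral
      p * V * (R ^ DIM('a) * (R powr (p - 1 + 1) / (p - 1 + 1)) - R powr (d + p - 1 + 1) / (d + p - 1 + 1))) {0..R}"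
      using p d R by (intro has_integral_mult_right has_integral_diff has_integral_powr_from_0) auto
    fix t assume t: "t \<in> {0..R}"
    have "t powr (d + p - 1) \<le> R ^ DIM('a) * t powr (p - 1)"
    proof (cases "t = 0")
      case False
      with t have "t > 0" by simp
      have "t powr (d + p - 1) = t powr d * t powr (p - 1)" by (simp only: powr_add[symmetric] add_diff_eq)
      also have "t powr d = t ^ DIM('a)" using \<open>t > 0\<close> by (simp add: d_def powr_realpow)
      also have "\<dots> * t powr (p - 1) \<le> R ^ DIM('a) * t powr (p - 1)"
        using t by (intro mult_right_mono power_mono) auto
      finally show ?thesis .
    qed simp
    then show "0 \<le> p * V * (R ^ DIM('a) * t powr (p - 1) - t powr (d + p - 1))"
      using p V by simp
  qed
  also have "p * V * (R ^ DIM('a) * (R powr (p - 1 + 1) / (p - 1 + 1)) - R powr (d + p - 1 + 1) / (d + p - 1 + 1)) =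
      d / (d + p) * V * R powr (d + p)"
  proof -
    have "R ^ DIM('a) = R powr d" using R by (simp add: d_def powr_realpow)
    then have "R ^ DIM('a) * R powr p = R powr (d + p)" by (simp add: powr_add)
    then have "p * V * (R ^ DIM('a) * (R powr (p - 1 + 1) / (p - 1 + 1)) - R powr (d + p - 1 + 1) / (d + p - 1 + 1)) =
        V * R powr (d + p) * (p * (1 / p - 1 / (d + p)))"
      by (simp add: right_diff_distrib)
    also have "p * (1 / p - 1 / (d + p)) = d / (d + p)"
    proof -
      have "d + p \<noteq> 0" using p d by simp
      then have "1 - p / (d + p) = d / (d + p)" by (simp add: diff_divide_eq_iff)
      then show ?thesis using p by (simp add: right_diff_distrib)
    qed
    finally show ?thesis by (simp only: mult_ac)
  qed
  finally show ?thesis by (simp add: d_def V_def)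
qed

section \<open>Averaging over frequencies\<close>

text \<open>Modulation translates the transform by \<open>z\<close>, so after substitution the
  energy is the integral of the symbol at \<eta> + z against the squared transform of
  \<open>u\<close>. Pointwise bounds on the shifted symbol therefore integrate directly.\<close>

lemma
  fixes u :: "real^'n \<Rightarrow> complex" and \<Omega> :: "(real^'n) set"
  assumes s: "0 < s" "s < 1"
    and u: "integrable lborel u" "integrable lborel (\<lambda>x. (cmod (u x))\<^sup>2)"
    and moment: "integrable lborel (\<lambda>\<xi>. (norm \<xi>)\<^sup>2 * (cmod (fourier u \<xi>))\<^sup>2)"
    and supp: "\<And>x. x \<notin> \<Omega> \<Longrightarrow> u x = 0"
  defines "g \<equiv> \<lambda>z x. u x * exp (\<i> * complex_of_real (x \<bullet> z))"
  shows modulate_in_energy_space: "g z \<in> energy_space s \<Omega>"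
    and modulate_energy_le: "1 \<le> R \<Longrightarrow> norm z \<le> R \<Longrightarrow> Re (energy_form s (g z) (g z)) \<le>
      2 * ln R * norm z powr (2 * s) * (\<integral>x. (cmod (u x))\<^sup>2 \<partial>lborel) +
      (4 + 8 / s + 2 / (1 - s)) * (R powr (2 * s) * (\<integral>x. (cmod (u x))\<^sup>2 \<partial>lborel) +
        R powr (2 * s - 1) * (\<integral>\<xi>. (norm \<xi>)\<^sup>2 * (cmod (fourier u \<xi>))\<^sup>2 \<partial>lborel))"
proof -
  have [measurable]: "u \<in> borel_measurable borel" using u by (auto dest: borel_measurable_integrable)
  have F: "fourier (g z) \<xi> = fourier u (\<xi> - z)" for \<xi>
    unfolding g_def by (rule fourier_modulate)
  note fi = integrable_fourier_square[OF u]
  \<comment> \<open>A crude bound whose constants depend on \<open>z\<close>; it serves only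
    membership in the energy space and integrability. The quantitative estimate uses
    \<open>fraclog_symbol_shift_le\<close>.\<close>
  have bnd: "\<bar>fraclog_symbol s (\<eta> + z)\<bar> * (cmod (fourier u \<eta>))\<^sup>2 \<le>
      (1 / s + 2 * (norm z)\<^sup>2 / (1 - s)) * (cmod (fourier u \<eta>))\<^sup>2 + 2 / (1 - s) * ((norm \<eta>)\<^sup>2 * (cmod (fourier u \<eta>))\<^sup>2)" for \<eta>
  proof -
    have "(norm (\<eta> + z))\<^sup>2 \<le> (norm \<eta> + norm z)\<^sup>2"
      by (intro power_mono norm_triangle_ineq) auto
    also have "\<dots> \<le> 2 * (norm \<eta>)\<^sup>2 + 2 * (norm z)\<^sup>2"
      using sum_squares_bound[of "norm \<eta>" "norm z"] by (simp add: power2_sum)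
    finally have "(norm (\<eta> + z))\<^sup>2 / (1 - s) \<le> (2 * (norm \<eta>)\<^sup>2 + 2 * (norm z)\<^sup>2) / (1 - s)"
      using s by (intro divide_right_mono) auto
    then have "\<bar>fraclog_symbol s (\<eta> + z)\<bar> \<le> 1 / s + (2 * (norm \<eta>)\<^sup>2 + 2 * (norm z)\<^sup>2) / (1 - s)"
      using abs_fraclog_symbol_le[OF s, of "\<eta> + z"] by linarith
    then have "\<bar>fraclog_symbol s (\<eta> + z)\<bar> * (cmod (fourier u \<eta>))\<^sup>2 \<le>
       (1 / s + (2 * (norm \<eta>)\<^sup>2 + 2 * (norm z)\<^sup>2) / (1 - s)) * (cmod (fourier u \<eta>))\<^sup>2"
      by (intro mult_right_mono) auto
    also have "\<dots> = (1 / s + 2 * (norm z)\<^sup>2 / (1 - s)) * (cmod (fourier u \<eta>))\<^sup>2 +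
        2 / (1 - s) * ((norm \<eta>)\<^sup>2 * (cmod (fourier u \<eta>))\<^sup>2)"
      by (simp add: add_divide_distrib distrib_right)
    finally show ?thesis .
  qed
  have i0: "integrable lborel (\<lambda>\<eta>. \<bar>fraclog_symbol s (\<eta> + z)\<bar> * (cmod (fourier u \<eta>))\<^sup>2)"
  proof (rule Bochner_Integration.integrable_bound)
    show "integrable lborel (\<lambda>\<eta>. (1 / s + 2 * (norm z)\<^sup>2 / (1 - s)) * (cmod (fourier u \<eta>))\<^sup>2 +
        2 / (1 - s) * ((norm \<eta>)\<^sup>2 * (cmod (fourier u \<eta>))\<^sup>2))"
      by (intro Bochner_Integration.integrable_add integrable_mult_right fi moment)
    show "AE \<eta> in lborel. norm (\<bar>fraclog_symbol s (\<eta> + z)\<bar> * (cmod (fourier u \<eta>))\<^sup>2) \<le>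
        norm ((1 / s + 2 * (norm z)\<^sup>2 / (1 - s)) * (cmod (fourier u \<eta>))\<^sup>2 +
        2 / (1 - s) * ((norm \<eta>)\<^sup>2 * (cmod (fourier u \<eta>))\<^sup>2))"
    proof (intro AE_I2)
      fix \<eta>
      have "norm (\<bar>fraclog_symbol s (\<eta> + z)\<bar> * (cmod (fourier u \<eta>))\<^sup>2) = \<bar>fraclog_symbol s (\<eta> + z)\<bar> * (cmod (fourier u \<eta>))\<^sup>2"
        by simp
      with bnd[of \<eta>] show "norm (\<bar>fraclog_symbol s (\<eta> + z)\<bar> * (cmod (fourier u \<eta>))\<^sup>2) \<le>
        norm ((1 / s + 2 * (norm z)\<^sup>2 / (1 - s)) * (cmod (fourier u \<eta>))\<^sup>2 +
        2 / (1 - s) * ((norm \<eta>)\<^sup>2 * (cmod (fourier u \<eta>))\<^sup>2))"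
        unfolding real_norm_def by linarith
    qed
  qed measurable
  have sq: "(cmod (g z x))\<^sup>2 = (cmod (u x))\<^sup>2" for x by (simp add: g_def norm_mult)
  show gE: "g z \<in> energy_space s \<Omega>"
    unfolding energy_space_iff F sq
  proof (intro conjI)
    show "g z \<in> borel_measurable borel" unfolding g_def by measurable
    show "integrable lborel (\<lambda>\<xi>. \<bar>fraclog_symbol s \<xi>\<bar> * (cmod (fourier u (\<xi> - z)))\<^sup>2)"
      using integrable_lborel_shift[OF i0, of "- z"] by simp
  qed (use u supp in \<open>auto simp: g_def\<close>)
  assume R: "1 \<le> R" and z: "norm z \<le> R"
  define C where "C = 4 + 8 / s + 2 / (1 - s)"
  have C: "0 \<le> C" using s by (simp add: C_def)
  define P where "P = (\<integral>\<xi>. (cmod (fourier u \<xi>))\<^sup>2 \<partial>lborel)"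
  define W where "W = (\<integral>x. (cmod (u x))\<^sup>2 \<partial>lborel)"
  define Q where "Q = (\<integral>\<xi>. (norm \<xi>)\<^sup>2 * (cmod (fourier u \<xi>))\<^sup>2 \<partial>lborel)"
  have PW: "P \<le> W" unfolding P_def W_def by (rule fourier_bessel[OF u])
  have i1: "integrable lborel (\<lambda>\<eta>. fraclog_symbol s (\<eta> + z) * (cmod (fourier u \<eta>))\<^sup>2)"
    by (rule integrable_norm_cancel) (use i0 in \<open>simp_all add: abs_mult\<close>)
  have "of_real (fraclog_symbol s \<xi>) * (fourier (g z) \<xi> * cnj (fourier (g z) \<xi>)) =
        complex_of_real (fraclog_symbol s \<xi> * (cmod (fourier u (\<xi> - z)))\<^sup>2)" for \<xi>
    unfolding F by (simp only: complex_norm_square of_real_mult)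
  then have "Re (energy_form s (g z) (g z)) = (\<integral>\<xi>. fraclog_symbol s \<xi> * (cmod (fourier u (\<xi> - z)))\<^sup>2 \<partial>lborel)"
    unfolding energy_form_eq by (simp del: of_real_mult)
  also have "\<dots> = (\<integral>\<eta>. fraclog_symbol s (\<eta> + z) * (cmod (fourier u \<eta>))\<^sup>2 \<partial>lborel)"
    using integral_lborel_shift[of "\<lambda>\<xi>. fraclog_symbol s \<xi> * (cmod (fourier u (\<xi> - z)))\<^sup>2" z] by simp
  also have "\<dots> \<le> (\<integral>\<eta>. (2 * ln R * norm z powr (2 * s) + C * R powr (2 * s)) * (cmod (fourier u \<eta>))\<^sup>2 +
      C * R powr (2 * s - 1) * ((norm \<eta>)\<^sup>2 * (cmod (fourier u \<eta>))\<^sup>2) \<partial>lborel)"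
  proof (intro integral_mono i1 Bochner_Integration.integrable_add integrable_mult_right fi moment)
    fix \<eta>
    have "fraclog_symbol s (\<eta> + z) * (cmod (fourier u \<eta>))\<^sup>2 \<le>
      (2 * ln R * norm z powr (2 * s) + C * (R powr (2 * s) + R powr (2 * s - 1) * (norm \<eta>)\<^sup>2)) * (cmod (fourier u \<eta>))\<^sup>2"
      unfolding C_def by (intro mult_right_mono fraclog_symbol_shift_le s R z) auto
    then show "fraclog_symbol s (\<eta> + z) * (cmod (fourier u \<eta>))\<^sup>2 \<le>
      (2 * ln R * norm z powr (2 * s) + C * R powr (2 * s)) * (cmod (fourier u \<eta>))\<^sup>2 +
      C * R powr (2 * s - 1) * ((norm \<eta>)\<^sup>2 * (cmod (fourier u \<eta>))\<^sup>2)"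
      by (simp only: distrib_left distrib_right mult.assoc add.assoc)
  qed
  also have "\<dots> = (2 * ln R * norm z powr (2 * s) + C * R powr (2 * s)) * P + C * R powr (2 * s - 1) * Q"
    unfolding P_def Q_def integral_mult_right_zero[symmetric]
    by (intro Bochner_Integration.integral_add integrable_mult_right fi moment)
  \<comment> \<open>Bessel's inequality replaces \<open>P\<close> by \<open>W\<close>; the
    coefficient is nonnegative because R \<ge> 1 makes the logarithm nonnegative.\<close>
  also have "\<dots> \<le> (2 * ln R * norm z powr (2 * s) + C * R powr (2 * s)) * W + C * R powr (2 * s - 1) * Q"
    using R C by (intro add_right_mono mult_left_mono PW add_nonneg_nonneg mult_nonneg_nonneg) auto
  also have "\<dots> = 2 * ln R * norm z powr (2 * s) * W + C * (R powr (2 * s) * W + R powr (2 * s - 1) * Q)"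
    by (simp only: distrib_left distrib_right mult.assoc add.assoc)
  finally show "Re (energy_form s (g z) (g z)) \<le>
      2 * ln R * norm z powr (2 * s) * (\<integral>x. (cmod (u x))\<^sup>2 \<partial>lborel) +
      (4 + 8 / s + 2 / (1 - s)) * (R powr (2 * s) * (\<integral>x. (cmod (u x))\<^sup>2 \<partial>lborel) +
        R powr (2 * s - 1) * (\<integral>\<xi>. (norm \<xi>)\<^sup>2 * (cmod (fourier u \<xi>))\<^sup>2 \<partial>lborel))"
    unfolding C_def W_def Q_def .
qed

text \<open>Because \<open>w\<close> is real it can be moved onto \<phi>, and the inner product
  becomes the conjugate of the integral defining the transform of w\<phi>; the power of 2\<pi>
  undoes the normalisation. As a function of \<open>z\<close> the coefficient is thus a Fourier
  transform, to which Bessel's inequality applies.\<close>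

lemma cmod_modulate_inner:
  fixes w :: "real^'n \<Rightarrow> real" and \<Omega> :: "(real^'n) set"
  assumes dom: "open \<Omega>" "bounded \<Omega>" and \<phi>: "\<phi> \<in> energy_space s \<Omega>" and [measurable]: "w \<in> borel_measurable borel"
  shows "(cmod (L2_inner (restrict_space lborel \<Omega>) (\<lambda>x. of_real (w x) * exp (\<i> * complex_of_real (x \<bullet> z))) \<phi>))\<^sup>2 =
    (2 * pi) ^ CARD('n) * (cmod (fourier (\<lambda>x. of_real (w x) * \<phi> x) z))\<^sup>2"
proof -
  define I where "I = (\<integral>x. (of_real (w x) * \<phi> x) * exp (- \<i> * complex_of_real (x \<bullet> z)) \<partial>lborel)"
  have "L2_inner (restrict_space lborel \<Omega>) (\<lambda>x. of_real (w x) * exp (\<i> * complex_of_real (x \<bullet> z))) \<phi> =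
      (\<integral>x. of_real (w x) * exp (\<i> * complex_of_real (x \<bullet> z)) * cnj (\<phi> x) \<partial>lborel)"
    by (rule L2_inner_restrict[OF dom \<phi>]) measurable
  also have "\<dots> = (\<integral>x. cnj ((of_real (w x) * \<phi> x) * exp (- \<i> * complex_of_real (x \<bullet> z))) \<partial>lborel)"
    by (simp add: exp_cnj mult_ac)
  also have "\<dots> = cnj I" unfolding I_def by (rule Bochner_Integration.integral_cnj)
  finally have "cmod (L2_inner (restrict_space lborel \<Omega>) (\<lambda>x. of_real (w x) * exp (\<i> * complex_of_real (x \<bullet> z))) \<phi>) = cmod I"
    by simp
  moreover have "cmod (fourier (\<lambda>x. of_real (w x) * \<phi> x) z) = (2 * pi) powr (- (real CARD('n) / 2)) * cmod I"
    by (simp add: fourier_def I_def norm_mult)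
  moreover have "(2 * pi) ^ CARD('n) * ((2 * pi) powr (- (real CARD('n) / 2)))\<^sup>2 = 1"
  proof -
    have "((2 * pi) powr (- (real CARD('n) / 2)))\<^sup>2 = (2 * pi) powr (- real CARD('n))"
      unfolding power2_eq_square powr_add[symmetric] by simp
    moreover have "(2 * pi) ^ CARD('n) = (2 * pi) powr (real CARD('n))"
      by (simp add: powr_realpow)
    ultimately show ?thesis by (simp only: powr_add[symmetric]) simp
  qed
  ultimately show ?thesis by (simp add: power_mult_distrib mult.assoc[symmetric])
qed

text \<open>The spectral lower bound and the energy upper bound hold for every \<open>z\<close> in
  the ball and are integrated over it. The layer enters only through the mass \<open>W\<close> and
  the bound \<open>Q\<close> on the second moment, so the choice of \<sigma> is left open. The
  fraction n/(n+2s) is the average of |z|^(2s) over the ball in units of R^(2s).\<close>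

lemma eigenvalue_sum_le:
  fixes \<Omega> :: "(real^'n) set" and s :: real
  assumes s: "0 < s" "s < 1" and dom: "open \<Omega>" "bounded \<Omega>" and \<sigma>: "\<sigma> > 0" and R: "1 \<le> R"
    and ev: "dirichlet_eigenvalues s \<Omega> lam"
  defines "W \<equiv> \<integral>x. (cutoff \<Omega> \<sigma> x)\<^sup>2 \<partial>lborel"
  assumes W: "0 < W" and Rk: "unit_ball_vol CARD('n) * R ^ CARD('n) * W = (2 * pi) ^ CARD('n) * real k"
    and Q: "2 * CARD('n) * measure lborel (boundary_layer \<Omega> \<sigma>) / \<sigma>\<^sup>2 \<le> Q"
  shows "(\<Sum>j=1..k. lam j) \<le> real k * (2 * ln R * CARD('n) / (CARD('n) + 2 * s) * R powr (2 * s) +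
    (4 + 8 / s + 2 / (1 - s)) * (R powr (2 * s) + R powr (2 * s - 1) * Q / W))"
proof -
  define C where "C = 4 + 8 / s + 2 / (1 - s)"
  have C: "0 \<le> C" using s by (simp add: C_def)
  define n where "n = CARD('n)"
  define V where "V = unit_ball_vol (real n)"
  define M where "M = restrict_space lborel \<Omega>"
  from ev obtain \<phi> where mono: "mono_on {1..} lam" and basis: "L2_orthonormal_basis M \<phi>"
    and \<phi>: "\<And>j. j \<ge> 1 \<Longrightarrow> \<phi> j \<in> energy_space s \<Omega>"
    and eig: "\<And>j v. j \<ge> 1 \<Longrightarrow> v \<in> energy_space s \<Omega> \<Longrightarrow>
      energy_form s (\<phi> j) v = of_real (lam j) * L2_inner M (\<phi> j) v"
    unfolding dirichlet_eigenvalues_def M_def by blast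
  define u where "u x = complex_of_real (cutoff \<Omega> \<sigma> x)" for x
  define g where "g z x = u x * exp (\<i> * complex_of_real (x \<bullet> z))" for z x
  have usq: "(cmod (u x))\<^sup>2 = (cutoff \<Omega> \<sigma> x)\<^sup>2" for x by (simp add: u_def)
  have ui: "integrable lborel u" "integrable lborel (\<lambda>x. (cmod (u x))\<^sup>2)"
    using integrable_cutoff[OF \<sigma> dom] integrable_cutoff_square[OF \<sigma> dom] by (simp_all add: usq u_def[abs_def])
  have um: "integrable lborel (\<lambda>\<xi>. (norm \<xi>)\<^sup>2 * (cmod (fourier u \<xi>))\<^sup>2)"
    using integrable_cutoff_fourier_moment[OF \<sigma> dom] by (simp add: u_def[abs_def])
  have uQ: "(\<integral>\<xi>. (norm \<xi>)\<^sup>2 * (cmod (fourier u \<xi>))\<^sup>2 \<partial>lborel) \<le> Q"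
    using cutoff_fourier_moment[OF \<sigma> dom] Q
    by (simp add: u_def[abs_def] mult.assoc mult.left_commute[of "real CARD('n)" 2])
  have supp: "u x = 0" if "x \<notin> \<Omega>" for x using that cutoff_outside[OF \<sigma>] by (simp add: u_def)
  have uW: "(\<integral>x. (cmod (u x))\<^sup>2 \<partial>lborel) = W" by (simp add: usq W_def)
  have gsq: "(cmod (g z x))\<^sup>2 = (cmod (u x))\<^sup>2" for z x by (simp add: g_def norm_mult)
  \<comment> \<open>The squared coefficient of the trial function at \<open>z\<close>, without its
    factor (2\<pi>)^n. Its integral is at most 1, since the cutoff is bounded by 1 and the
    eigenfunction is normalised.\<close>
  define b where "b j z = (cmod (fourier (\<lambda>x. u x * \<phi> j x) z))\<^sup>2" for j z
  have pw: "lam (Suc k) * W + (\<Sum>j=1..k. (lam j - lam (Suc k)) * ((2 * pi) ^ n * b j z)) \<le>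
      2 * ln R * norm z powr (2 * s) * W + C * (R powr (2 * s) * W + R powr (2 * s - 1) * Q)"
    if z: "norm z \<le> R" for z
  proof -
    have gz: "g z \<in> energy_space s \<Omega>"
      unfolding g_def[abs_def] by (rule modulate_in_energy_space[OF s ui um]) (rule supp)
    have "(cmod (L2_inner M (g z) (\<phi> j)))\<^sup>2 = (2 * pi) ^ n * b j z" if "j \<ge> 1" for j
      using cmod_modulate_inner[OF dom \<phi>[OF that] cutoff_measurable, of \<Omega> \<sigma> z]
      by (simp add: g_def[abs_def] u_def[abs_def] b_def M_def n_def)
    then have "lam (Suc k) * W + (\<Sum>j=1..k. (lam j - lam (Suc k)) * ((2 * pi) ^ n * b j z)) =
      lam (Suc k) * (\<integral>x. (cmod (g z x))\<^sup>2 \<partial>lborel) + (\<Sum>j=1..k. (lam j - lam (Suc k)) * (cmod (L2_inner M (g z) (\<phi> j)))\<^sup>2)"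
      unfolding gsq uW by simp
    also have "\<dots> \<le> Re (energy_form s (g z) (g z))"
      unfolding M_def
      by (rule energy_form_ge_spectral[OF s(1) dom mono basis[unfolded M_def] \<phi> eig[unfolded M_def] gz])
    also have "\<dots> \<le> 2 * ln R * norm z powr (2 * s) * W +
        C * (R powr (2 * s) * W + R powr (2 * s - 1) * (\<integral>\<xi>. (norm \<xi>)\<^sup>2 * (cmod (fourier u \<xi>))\<^sup>2 \<partial>lborel))"
      unfolding g_def[abs_def] C_def
      unfolding uW[symmetric] by (rule modulate_energy_le[OF s ui um]) (rule supp, assumption, rule R, rule z)
    also have "\<dots> \<le> 2 * ln R * norm z powr (2 * s) * W + C * (R powr (2 * s) * W + R powr (2 * s - 1) * Q)"
      by (intro add_left_mono mult_left_mono uQ C) auto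
    finally show ?thesis .
  qed
  let ?B = "ball 0 R :: (real^'n) set"
  have volB: "measure lborel ?B = V * R ^ n"
    using R content_ball[of R "0 :: real^'n"] by (simp add: V_def n_def)
  have iB: "integrable lborel (indicator ?B :: real^'n \<Rightarrow> real)"
    using emeasure_bounded_finite[of ?B] by (simp add: less_top)
  have bi: "integrable lborel (b j)" and b1: "(\<integral>z. b j z \<partial>lborel) \<le> 1" if j: "j \<ge> 1" for j
  proof -
    have \<phi>i: "integrable lborel (\<lambda>x. (cmod (\<phi> j x))\<^sup>2)" "integrable lborel (\<phi> j)"
      using \<phi>[OF j] energy_space_integrable[OF dom \<phi>[OF j]] by (auto simp: energy_space_iff)
    have [measurable]: "\<phi> j \<in> borel_measurable borel" "u \<in> borel_measurable borel"
      using \<phi>[OF j] ui by (auto simp: energy_space_iff dest: borel_measurable_integrable)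
    have u1: "cmod (u x) \<le> 1" for x
      using cutoff_le_1[of \<Omega> \<sigma> x] cutoff_nonneg[OF \<sigma>, of \<Omega> x] by (simp add: u_def)
    have le: "cmod (u x * \<phi> j x) \<le> cmod (\<phi> j x)" for x
      unfolding norm_mult using u1[of x] by (intro mult_left_le_one_le) auto
    have p1: "integrable lborel (\<lambda>x. u x * \<phi> j x)"
      by (rule Bochner_Integration.integrable_bound[OF \<phi>i(2)]) (use le in auto)
    have p2: "integrable lborel (\<lambda>x. (cmod (u x * \<phi> j x))\<^sup>2)"
      by (rule Bochner_Integration.integrable_bound[OF \<phi>i(1)]) (use power_mono[OF le] in auto)
    show "integrable lborel (b j)"
      unfolding b_def[abs_def] by (rule integrable_fourier_square[OF p1 p2])
    have "(\<integral>z. b j z \<partial>lborel) \<le> (\<integral>x. (cmod (u x * \<phi> j x))\<^sup>2 \<partial>lborel)"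
      unfolding b_def by (rule fourier_bessel[OF p1 p2])
    also have "\<dots> \<le> (\<integral>x. (cmod (\<phi> j x))\<^sup>2 \<partial>lborel)"
      by (intro integral_mono p2 \<phi>i power_mono le) auto
    also have "\<dots> = 1"
    proof -
      have "L2_inner M (\<phi> j) (\<phi> j) = 1" using basis j by (auto simp: L2_orthonormal_basis_def)
      then have "(\<integral>x. \<phi> j x * cnj (\<phi> j x) \<partial>lborel) = 1"
        unfolding M_def by (subst (asm) L2_inner_restrict[OF dom \<phi>[OF j]]) auto
      then have "complex_of_real (\<integral>x. (cmod (\<phi> j x))\<^sup>2 \<partial>lborel) = of_real 1"
        unfolding complex_norm_square[symmetric] by (simp del: of_real_power)
      then show ?thesis by (simp only: of_real_eq_iff)
    qed
    finally show "(\<integral>z. b j z \<partial>lborel) \<le> 1" .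
  qed
  define \<beta> where "\<beta> j = (\<integral>z. b j z * indicator ?B z \<partial>lborel)" for j
  have bBi: "integrable lborel (\<lambda>z. b j z * indicator ?B z)" if "j \<ge> 1" for j
    by (intro integrable_real_mult_indicator bi that) auto
  have \<beta>1: "\<beta> j \<le> 1" if "j \<ge> 1" for j
  proof -
    have "\<beta> j \<le> (\<integral>z. b j z \<partial>lborel)"
      unfolding \<beta>_def by (intro integral_mono bBi bi that) (auto simp: indicator_def b_def)
    with b1[OF that] show ?thesis by simp
  qed
  define J where "J = (\<integral>z. norm z powr (2 * s) * indicator ?B z \<partial>lborel)"
  have J: "integrable lborel (\<lambda>z. norm z powr (2 * s) * indicator ?B z)"
    "J = n / (n + 2 * s) * V * R ^ n * R powr (2 * s)"
  proof -
    have nn: "(\<integral>\<^sup>+z. ennreal (norm z powr (2 * s) * indicator ?B z) \<partial>lborel) =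
        ennreal (n / (n + 2 * s) * V * R powr (n + 2 * s))"
      using nn_integral_norm_powr_ball[of "2 * s" R, where 'a="real^'n"] s R
      by (simp add: n_def V_def indicator_mult_ennreal mult.commute[of _ "indicator _ _"])
    have [measurable]: "?B \<in> sets borel" by simp
    have m: "(\<lambda>z. norm z powr (2 * s) * indicator ?B z) \<in> borel_measurable lborel" by measurable
    show "integrable lborel (\<lambda>z. norm z powr (2 * s) * indicator ?B z)"
      by (rule integrableI_nonneg[OF m]) (use nn in auto)
    have "J = n / (n + 2 * s) * V * R powr (n + 2 * s)"
      unfolding J_def by (subst integral_eq_nn_integral[OF m]) (use nn s in \<open>auto simp: V_def\<close>)
    also have "R powr (n + 2 * s) = R ^ n * R powr (2 * s)"
      using R by (simp add: powr_add powr_realpow)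
    finally show "J = n / (n + 2 * s) * V * R ^ n * R powr (2 * s)" by (simp add: mult.assoc)
  qed
  define D where "D = C * (R powr (2 * s) * W + R powr (2 * s - 1) * Q)"
  have "(\<integral>z. lam (Suc k) * W * indicator ?B z +
      (\<Sum>j=1..k. ((lam j - lam (Suc k)) * (2 * pi) ^ n) * (b j z * indicator ?B z)) \<partial>lborel) \<le>
    (\<integral>z. 2 * ln R * W * (norm z powr (2 * s) * indicator ?B z) + D * indicator ?B z \<partial>lborel)"
  proof (intro integral_mono Bochner_Integration.integrable_add integrable_mult_right iB J(1)
      Bochner_Integration.integrable_sum bBi)
    fix z
    show "lam (Suc k) * W * indicator ?B z + (\<Sum>j=1..k. ((lam j - lam (Suc k)) * (2 * pi) ^ n) * (b j z * indicator ?B z)) \<le>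
      2 * ln R * W * (norm z powr (2 * s) * indicator ?B z) + D * indicator ?B z"
    proof (cases "z \<in> ?B")
      case True
      then have "norm z \<le> R" by simp
      from pw[OF this] True show ?thesis by (simp add: D_def mult_ac)
    qed simp
  qed auto
  also have "(\<integral>z. 2 * ln R * W * (norm z powr (2 * s) * indicator ?B z) + D * indicator ?B z \<partial>lborel) =
      2 * ln R * W * J + D * (V * R ^ n)"
    by (subst Bochner_Integration.integral_add) (use iB J(1) in \<open>simp_all add: volB J_def\<close>)
  also have "(\<integral>z. lam (Suc k) * W * indicator ?B z +
      (\<Sum>j=1..k. ((lam j - lam (Suc k)) * (2 * pi) ^ n) * (b j z * indicator ?B z)) \<partial>lborel) =
     lam (Suc k) * W * (V * R ^ n) + (\<Sum>j=1..k. ((lam j - lam (Suc k)) * (2 * pi) ^ n) * \<beta> j)"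
  proof -
    have "(\<integral>z. (\<Sum>j=1..k. ((lam j - lam (Suc k)) * (2 * pi) ^ n) * (b j z * indicator ?B z)) \<partial>lborel) =
       (\<Sum>j=1..k. ((lam j - lam (Suc k)) * (2 * pi) ^ n) * \<beta> j)"
      unfolding \<beta>_def integral_mult_right_zero[symmetric]
      by (intro Bochner_Integration.integral_sum integrable_mult_right bBi) auto
    moreover have "integrable lborel (\<lambda>z. (\<Sum>j=1..k. ((lam j - lam (Suc k)) * (2 * pi) ^ n) * (b j z * indicator ?B z)))"
      by (intro Bochner_Integration.integrable_sum integrable_mult_right bBi) auto
    ultimately show ?thesis
      using iB by (subst Bochner_Integration.integral_add) (simp_all add: volB)
  qed
  finally have main: "lam (Suc k) * W * (V * R ^ n) + (\<Sum>j=1..k. ((lam j - lam (Suc k)) * (2 * pi) ^ n) * \<beta> j) \<le>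
      2 * ln R * W * J + D * (V * R ^ n)" .
  have VW: "V * R ^ n * W = (2 * pi) ^ n * real k" using Rk by (simp add: V_def n_def)
  \<comment> \<open>The condition \<open>Rk\<close> identifies the term with
    \<open>lam (Suc k)\<close> here with the one in \<open>main\<close>. It is an equality and not
    an inequality because the sign of \<open>lam (Suc k)\<close> is unknown.\<close>
  have "(2 * pi) ^ n * (\<Sum>j=1..k. lam j) = lam (Suc k) * ((2 * pi) ^ n * real k) + (\<Sum>j=1..k. (lam j - lam (Suc k)) * (2 * pi) ^ n)"
    by (simp add: sum_subtractf sum_distrib_right[symmetric] algebra_simps)
  also have "\<dots> \<le> lam (Suc k) * W * (V * R ^ n) + (\<Sum>j=1..k. ((lam j - lam (Suc k)) * (2 * pi) ^ n) * \<beta> j)"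
  proof (intro add_mono sum_mono)
    show "lam (Suc k) * ((2 * pi) ^ n * real k) \<le> lam (Suc k) * W * (V * R ^ n)"
      unfolding VW[symmetric] by (simp add: mult_ac)
    fix j assume j: "j \<in> {1..k}"
    \<comment> \<open>The coefficients are nonpositive, so the upper bound 1 on the averaged
      projections is the direction needed.\<close>
    then have "lam j \<le> lam (Suc k)" by (intro mono_onD[OF mono]) auto
    then have "(lam j - lam (Suc k)) * (2 * pi) ^ n \<le> 0" by (intro mult_nonpos_nonneg) auto
    then show "(lam j - lam (Suc k)) * (2 * pi) ^ n \<le> (lam j - lam (Suc k)) * (2 * pi) ^ n * \<beta> j"
      using mult_left_mono_neg[of "\<beta> j" 1 "(lam j - lam (Suc k)) * (2 * pi) ^ n"] \<beta>1[of j] j by simp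
  qed
  also note main
  also have "2 * ln R * W * J + D * (V * R ^ n) =
      (V * R ^ n * W) * (2 * ln R * n / (n + 2 * s) * R powr (2 * s)) + (V * R ^ n * W) * (D / W)"
    using W by (simp add: J(2) mult_ac)
  also have "\<dots> = (2 * pi) ^ n * (real k * (2 * ln R * n / (n + 2 * s) * R powr (2 * s) + D / W))"
    unfolding VW by (simp only: distrib_left mult.assoc)
  finally have "(\<Sum>j=1..k. lam j) \<le> real k * (2 * ln R * n / (n + 2 * s) * R powr (2 * s) + D / W)"
    by (rule mult_left_le_imp_le) simp
  also have "D / W = C * (R powr (2 * s) + R powr (2 * s - 1) * Q / W)"
    using W by (simp add: D_def distrib_left add_divide_distrib)
  finally show ?thesis by (simp add: C_def n_def)
qed

section \<open>Choice of the parameters\<close>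

text \<open>The value \<open>f k\<close> separates the two blocks: the first \<open>k\<close> terms
  sum to at most \<open>k\<close> times it, the remaining \<open>m - k\<close> to at least
  \<open>m - k\<close> times it.\<close>

lemma mono_on_average_le:
  fixes f :: "nat \<Rightarrow> real"
  assumes mono: "mono_on {1..} f" and k: "1 \<le> k" "k \<le> m"
  shows "real m * (\<Sum>j=1..k. f j) \<le> real k * (\<Sum>j=1..m. f j)"
proof -
  have split: "(\<Sum>j=1..m. f j) = (\<Sum>j=1..k. f j) + (\<Sum>j=Suc k..m. f j)"
    using k sum.ub_add_nat[of 1 k f "m - k"] by simp
  have "(\<Sum>j=1..k. f j) \<le> (\<Sum>j=1..k. f k)"
    using k by (intro sum_mono mono_onD[OF mono]) auto
  then have 1: "(\<Sum>j=1..k. f j) \<le> real k * f k" by simp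
  have "(\<Sum>j=Suc k..m. f k) \<le> (\<Sum>j=Suc k..m. f j)"
    using k by (intro sum_mono mono_onD[OF mono]) auto
  then have 2: "real (m - k) * f k \<le> (\<Sum>j=Suc k..m. f j)" by simp
  have "real m * (\<Sum>j=1..k. f j) = real k * (\<Sum>j=1..k. f j) + real (m - k) * (\<Sum>j=1..k. f j)"
    using k by (simp add: of_nat_diff left_diff_distrib)
  also have "real (m - k) * (\<Sum>j=1..k. f j) \<le> real (m - k) * (real k * f k)"
    using 1 by (intro mult_left_mono) auto
  also have "\<dots> = real k * (real (m - k) * f k)" by simp
  also have "\<dots> \<le> real k * (\<Sum>j=Suc k..m. f j)"
    using 2 by (intro mult_left_mono) auto
  finally show ?thesis unfolding split by (simp add: distrib_left)
qed

text \<open>The layer width is k^(-1/n). The lower bounds on \<open>k\<close> say in turn that this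
  width is admissible for the layer condition, that the bound \<delta> for the mass loss is at most
  1, that the radius is at least 1, and that ln k is nonnegative.\<close>

lemma eigenvalue_sum_le_large:
  fixes \<Omega> :: "(real^'n) set" and s t\<^sub>0 A :: real and k :: nat
  defines "n \<equiv> real CARD('n)"
  defines "\<omega> \<equiv> unit_ball_vol n" and "V \<equiv> measure lborel \<Omega>"
  defines "Z \<equiv> (2 * pi) powr (2 * s) * (\<omega> * V) powr (- 2 * s / n)"
  assumes s: "0 < s" "s < 1" and dom: "open \<Omega>" "bounded \<Omega>" "\<Omega> \<noteq> {}"
    and A: "0 < A" and layer: "\<And>t. 0 < t \<Longrightarrow> t \<le> t\<^sub>0 \<Longrightarrow> measure lborel (boundary_layer \<Omega> t) \<le> A * t"
    and t0: "0 < t\<^sub>0"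
    and ev: "dirichlet_eigenvalues s \<Omega> lam"
    and k: "1 / t\<^sub>0 \<le> real k powr (1 / n)" "2 * A / V \<le> real k powr (1 / n)"
      "(\<omega> * V) powr (1 / n) / (2 * pi) \<le> real k powr (1 / n)" "1 \<le> k"
  shows "(\<Sum>j=1..k. lam j) \<le> 2 / (n + 2 * s) * Z * real k powr (1 + 2 * s / n) * ln (real k) +
    Z * (2 / (n + 2 * s) * (6 * n * A / V + 4 * \<bar>ln ((2 * pi) powr n / (\<omega> * (V / 2)))\<bar>) +
      4 * (4 + 8 / s + 2 / (1 - s)) * (1 + 2 * (2 * n * A * (\<omega> * V) powr (1 / n) / (2 * pi)) / V)) * real k powr (1 + 2 * s / n)"
proof -
  define \<kappa> where "\<kappa> = real k powr (1 / n)"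
  define \<sigma> where "\<sigma> = 1 / \<kappa>"
  define W where "W = (\<integral>x. (cutoff \<Omega> \<sigma> x)\<^sup>2 \<partial>lborel)"
  \<comment> \<open>Twice the bound on the relative mass loss: then W \<ge> V (1 - \<delta>/2), and
    (1 + \<delta>)(1 - \<delta>/2) \<ge> 1 for \<delta> in [0,1] gives V/W \<le> 1 +
    \<delta>.\<close>
  define \<delta> where "\<delta> = 2 * A * \<sigma> / V"
  \<comment> \<open>The radius that would be used if the cutoff had full mass \<open>V\<close>. It
    is a fixed multiple of \<kappa> and a lower bound for \<open>R\<close>.\<close>
  define R\<^sub>0 where "R\<^sub>0 = 2 * pi * \<kappa> * (\<omega> * V) powr (- 1 / n)"
  define R where "R = 2 * pi * \<kappa> * (\<omega> * W) powr (- 1 / n)"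
  define C where "C = 4 + 8 / s + 2 / (1 - s)"
  \<comment> \<open>Chosen so that the second-moment bound 2nA\<kappa> equals \<open>q\<close> times
    \<open>R\<^sub>0\<close>, hence is at most \<open>q * R\<close>.\<close>
  define q where "q = 2 * n * A * (\<omega> * V) powr (1 / n) / (2 * pi)"
  \<comment> \<open>Bounds the part of n ln R beyond ln k independently of \<open>k\<close>, because
    \<open>W\<close> is at least V/2.\<close>
  define c where "c = \<bar>ln ((2 * pi) powr n / (\<omega> * (V / 2)))\<bar>"
  have n: "1 \<le> n" by (simp add: n_def Suc_leI)
  have \<omega>: "0 < \<omega>" using n by (simp add: \<omega>_def)
  have V: "0 < V"
  proof -
    have "emeasure lborel \<Omega> \<noteq> 0"
    proof
      assume "emeasure lborel \<Omega> = 0"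
      then have "\<Omega> \<in> null_sets lebesgue" using dom by (auto simp: null_sets_def)
      then have "negligible \<Omega>" by (simp add: negligible_iff_null_sets)
      then show False using dom open_not_negligible by blast
    qed
    moreover have "emeasure lborel \<Omega> < \<infinity>" by (intro emeasure_bounded_finite dom)
    ultimately show ?thesis by (simp add: V_def measure_def enn2real_positive_iff zero_less_iff_neq_zero)
  qed
  have C: "0 \<le> C" using s by (simp add: C_def)
  have \<kappa>: "0 < \<kappa>" using k by (simp add: \<kappa>_def)
  have \<sigma>: "0 < \<sigma>" using \<kappa> by (simp add: \<sigma>_def)
  have \<sigma>t: "\<sigma> \<le> t\<^sub>0"
    using k(1) \<kappa> t0 unfolding \<sigma>_def \<kappa>_def[symmetric] by (simp add: field_simps)
  have L: "measure lborel (boundary_layer \<Omega> \<sigma>) \<le> A * \<sigma>" by (rule layer[OF \<sigma> \<sigma>t])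
  have \<delta>: "0 \<le> \<delta>" "\<delta> \<le> 1"
    using k(2) \<kappa> V A unfolding \<delta>_def \<sigma>_def \<kappa>_def[symmetric] by (auto simp: field_simps)
  have ne: "- \<Omega> \<noteq> {}" using dom(2) not_bounded_UNIV by (metis Compl_UNIV_eq double_compl)
  have WV: "W \<le> V" unfolding W_def V_def by (rule cutoff_square_le[OF \<sigma> dom(1,2)])
  have "V - A * \<sigma> \<le> W"
    using cutoff_square_ge[OF \<sigma> dom(1,2) ne] L unfolding W_def V_def by linarith
  moreover have "A * \<sigma> = V * (\<delta> / 2)" using V by (simp add: \<delta>_def)
  ultimately have W1: "V * (1 - \<delta> / 2) \<le> W" by (simp add: right_diff_distrib)
  moreover have "V * (1 / 2) \<le> V * (1 - \<delta> / 2)" using V \<delta> by (intro mult_left_mono) auto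
  ultimately have W2: "V / 2 \<le> W" by simp
  then have W: "0 < W" using V by linarith
  have VW: "V / W \<le> 1 + \<delta>"
  proof -
    have "\<delta> * \<delta> \<le> \<delta> * 1" using \<delta> by (intro mult_left_mono) auto
    then have "1 \<le> (1 + \<delta>) * (1 - \<delta> / 2)" by (simp add: algebra_simps)
    then have "V * 1 \<le> V * ((1 + \<delta>) * (1 - \<delta> / 2))" using V by (intro mult_left_mono) auto
    also have "\<dots> = (1 + \<delta>) * (V * (1 - \<delta> / 2))" by (simp only: mult_ac)
    also have "\<dots> \<le> (1 + \<delta>) * W" using W1 \<delta> by (intro mult_left_mono) auto
    finally show ?thesis using W by (simp add: pos_divide_le_eq)
  qed
  have R0: "1 \<le> R\<^sub>0"
  proof -
    have "(\<omega> * V) powr (1 / n) \<le> 2 * pi * \<kappa>"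
      using k(3) unfolding \<kappa>_def[symmetric] by (simp add: pos_divide_le_eq mult.commute)
    then have "(\<omega> * V) powr (1 / n) * (\<omega> * V) powr (- 1 / n) \<le> 2 * pi * \<kappa> * (\<omega> * V) powr (- 1 / n)"
      by (intro mult_right_mono) auto
    moreover have "(\<omega> * V) powr (1 / n) * (\<omega> * V) powr (- 1 / n) = 1"
      using \<omega> V by (simp flip: powr_add)
    ultimately show ?thesis by (simp add: R\<^sub>0_def)
  qed
  have RR0: "R\<^sub>0 \<le> R"
    unfolding R_def R\<^sub>0_def using \<kappa> \<omega> W WV n by (intro mult_left_mono powr_mono2') auto
  have R: "1 \<le> R" using R0 RR0 by linarith
  have Rn: "R powr n = (2 * pi) powr n * real k / (\<omega> * W)"
  proof -
    have "\<kappa> powr n = real k" using n k(4) by (simp add: \<kappa>_def powr_powr)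
    moreover have "((\<omega> * W) powr (- 1 / n)) powr n = inverse (\<omega> * W)"
      using n \<omega> W unfolding powr_powr by (simp add: powr_minus)
    ultimately show ?thesis
      unfolding R_def using \<kappa> by (simp add: powr_mult divide_inverse)
  qed
  have R2s: "R powr (2 * s) \<le> Z * real k powr (2 * s / n) * (1 + 3 * \<delta>)"
  proof -
    have "((\<omega> * W) powr (- 1 / n)) powr (2 * s) = (\<omega> * W) powr (- 2 * s / n)"
      by (simp add: powr_powr)
    moreover have "\<kappa> powr (2 * s) = real k powr (2 * s / n)"
      by (simp add: \<kappa>_def powr_powr)
    ultimately have "R powr (2 * s) = (2 * pi) powr (2 * s) * real k powr (2 * s / n) * (\<omega> * W) powr (- 2 * s / n)"
      unfolding R_def using \<kappa> by (simp add: powr_mult)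
    also have "(\<omega> * W) powr (- 2 * s / n) = (\<omega> * V) powr (- 2 * s / n) * (V / W) powr (2 * s / n)"
    proof -
      have "\<omega> * W = \<omega> * V * inverse (V / W)" using V W by simp
      also have "(\<omega> * V * inverse (V / W)) powr (- 2 * s / n) =
          (\<omega> * V) powr (- 2 * s / n) * inverse (V / W) powr (- 2 * s / n)"
        by (rule powr_mult)
      also have "inverse (V / W) powr (- 2 * s / n) = (V / W) powr (2 * s / n)"
        using V W inverse_powr[of "V / W" "- (2 * s / n)"] powr_minus[of "V / W" "2 * s / n"]
        by (simp del: inverse_divide)
      finally show ?thesis .
    qed
    also have "(2 * pi) powr (2 * s) * real k powr (2 * s / n) * ((\<omega> * V) powr (- 2 * s / n) * (V / W) powr (2 * s / n)) =
        Z * real k powr (2 * s / n) * (V / W) powr (2 * s / n)"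
      by (simp only: Z_def mult_ac)
    also have "\<dots> \<le> Z * real k powr (2 * s / n) * (1 + 3 * \<delta>)"
    proof (intro mult_left_mono)
      \<comment> \<open>The exponent is at most 2, so the power is at most the square, and (1 +
        \<delta>)^2 \<le> 1 + 3\<delta> because \<delta> \<le> 1.\<close>
      have sn: "2 * s / n \<le> 2" using s n by (simp add: pos_divide_le_eq)
      have "(V / W) powr (2 * s / n) \<le> (1 + \<delta>) powr (2 * s / n)"
        using VW V W s n by (intro powr_mono2) auto
      also have "\<dots> \<le> (1 + \<delta>) powr 2" using \<delta> sn by (intro powr_mono) auto
      also have "\<dots> = (1 + \<delta>)\<^sup>2" using \<delta> by simp
      also have "\<dots> \<le> 1 + 3 * \<delta>"
        using mult_left_mono[OF \<delta>(2) \<delta>(1)] by (simp add: power2_eq_square algebra_simps)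
      finally show "(V / W) powr (2 * s / n) \<le> 1 + 3 * \<delta>" .
    qed (simp add: Z_def)
    finally show ?thesis .
  qed
  define X where "X = Z * real k powr (2 * s / n)"
  have X: "0 \<le> X" by (simp add: X_def Z_def)
  have sum: "(\<Sum>j=1..k. lam j) \<le> real k * (2 * ln R * n / (n + 2 * s) * R powr (2 * s) +
    C * (R powr (2 * s) + R powr (2 * s - 1) * (2 * n * A * \<kappa>) / W))"
    unfolding C_def n_def W_def
  proof (rule eigenvalue_sum_le[OF s dom(1,2) \<sigma> R ev])
    show "0 < (\<integral>x. (cutoff \<Omega> \<sigma> x)\<^sup>2 \<partial>lborel)" using W by (simp add: W_def)
    have "\<omega> * W * (R powr n) = (2 * pi) powr n * real k"
      unfolding Rn using \<omega> W by simp
    then show "unit_ball_vol (real CARD('n)) * R ^ CARD('n) * (\<integral>x. (cutoff \<Omega> \<sigma> x)\<^sup>2 \<partial>lborel) = (2 * pi) ^ CARD('n) * real k"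
      using R unfolding n_def \<omega>_def W_def by (simp add: powr_realpow mult_ac)
    have "2 * n * measure lborel (boundary_layer \<Omega> \<sigma>) / \<sigma>\<^sup>2 \<le> 2 * n * (A * \<sigma>) / \<sigma>\<^sup>2"
      using L n by (intro divide_right_mono mult_left_mono) auto
    also have "\<dots> = 2 * n * A * \<kappa>"
      using \<sigma> \<kappa> by (simp add: \<sigma>_def power2_eq_square field_simps)
    finally show "real (2 * CARD('n)) * measure lborel (boundary_layer \<Omega> \<sigma>) / \<sigma>\<^sup>2 \<le> 2 * real CARD('n) * A * \<kappa>"
      by (simp add: n_def)
  qed
  have part1: "2 * ln R * n / (n + 2 * s) * R powr (2 * s) \<le>
      X * (2 / (n + 2 * s) * (ln (real k) + (6 * n * A / V + 4 * c)))"
  proof -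
    have lnk: "0 \<le> ln (real k)" using k(4) by simp
    have c: "0 \<le> c" by (simp add: c_def)
    have "n * ln R = ln (R powr n)" using R by (simp add: ln_powr)
    also have "\<dots> = ln (real k * ((2 * pi) powr n / (\<omega> * W)))" unfolding Rn by (simp add: mult.commute)
    also have "\<dots> = ln (real k) + ln ((2 * pi) powr n / (\<omega> * W))"
      using k(4) \<omega> W by (intro ln_mult_pos) auto
    also have "ln ((2 * pi) powr n / (\<omega> * W)) \<le> ln ((2 * pi) powr n / (\<omega> * (V / 2)))"
      using \<omega> W V W2 by (intro ln_mono divide_left_mono mult_left_mono) auto
    finally have lnR: "n * ln R \<le> ln (real k) + c" unfolding c_def by linarith
    have "n * ln R * R powr (2 * s) \<le> (ln (real k) + c) * (X * (1 + 3 * \<delta>))"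
      using R2s lnR lnk c unfolding X_def by (intro mult_mono) auto
    also have "\<dots> = X * (ln (real k) + 3 * (\<delta> * ln (real k)) + c * (1 + 3 * \<delta>))"
      by (simp add: algebra_simps)
    also have "\<dots> \<le> X * (ln (real k) + (6 * n * A / V + 4 * c))"
    proof (intro mult_left_mono X)
      have "c * (1 + 3 * \<delta>) \<le> c * 4" using c \<delta> by (intro mult_left_mono) auto
      \<comment> \<open>The mass loss meets the logarithm here: \<delta> is proportional to
        1/\<kappa>, while ln k is at most n\<kappa>, so the product stays bounded. Three times this
        bound is the term 6nA/V.\<close>
      moreover have "\<delta> * ln (real k) \<le> 2 * n * A / V"
      proof -
        have "ln (real k) \<le> real k powr (1 / n) / (1 / n)"
          using k(4) n by (intro ln_powr_bound) auto
        then have "ln (real k) \<le> n * \<kappa>" by (simp add: \<kappa>_def mult.commute)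
        then have "\<delta> * ln (real k) \<le> \<delta> * (n * \<kappa>)" using \<delta> by (intro mult_left_mono) auto
        also have "\<dots> = 2 * n * A / V" using \<kappa> by (simp add: \<delta>_def \<sigma>_def)
        finally show ?thesis .
      qed
      ultimately show "ln (real k) + 3 * (\<delta> * ln (real k)) + c * (1 + 3 * \<delta>) \<le> ln (real k) + (6 * n * A / V + 4 * c)"
        by simp
    qed
    finally have "2 / (n + 2 * s) * (n * ln R * R powr (2 * s)) \<le> 2 / (n + 2 * s) * (X * (ln (real k) + (6 * n * A / V + 4 * c)))"
      using n s by (intro mult_left_mono) auto
    then show ?thesis by (simp add: mult_ac)
  qed
  have part2: "C * (R powr (2 * s) + R powr (2 * s - 1) * (2 * n * A * \<kappa>) / W) \<le> X * (4 * C * (1 + 2 * q / V))"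
  proof -
    have q: "0 \<le> q" using n A by (simp add: q_def)
    have "2 * n * A * \<kappa> = q * R\<^sub>0"
    proof -
      have "(\<omega> * V) powr (1 / n) * (\<omega> * V) powr (- 1 / n) = 1"
        using \<omega> V by (simp flip: powr_add)
      then show ?thesis by (simp add: q_def R\<^sub>0_def)
    qed
    also have "\<dots> \<le> q * R" using RR0 q by (intro mult_left_mono)
    \<comment> \<open>The factor \<open>R\<close> gained from the second moment raises the exponent
      2s - 1 to 2s, which is the balance behind the choice of \<sigma>.\<close>
    finally have "R powr (2 * s - 1) * (2 * n * A * \<kappa>) \<le> R powr (2 * s - 1) * (q * R)"
      by (intro mult_left_mono) auto
    also have "\<dots> = R powr (2 * s) * q" using R by (simp add: powr_diff)
    finally have "R powr (2 * s - 1) * (2 * n * A * \<kappa>) / W \<le> R powr (2 * s) * q / (V / 2)"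
      using W V W2 q by (intro frac_le) auto
    then have "R powr (2 * s) + R powr (2 * s - 1) * (2 * n * A * \<kappa>) / W \<le> R powr (2 * s) * (1 + 2 * q / V)"
      by (simp add: distrib_left mult_ac)
    also have "\<dots> \<le> (X * (1 + 3 * \<delta>)) * (1 + 2 * q / V)"
      using R2s q V unfolding X_def by (intro mult_right_mono) auto
    also have "\<dots> \<le> (X * 4) * (1 + 2 * q / V)"
      using \<delta> X q V by (intro mult_right_mono mult_left_mono) auto
    finally have "C * (R powr (2 * s) + R powr (2 * s - 1) * (2 * n * A * \<kappa>) / W) \<le> C * ((X * 4) * (1 + 2 * q / V))"
      using C by (rule mult_left_mono)
    then show ?thesis by (simp only: mult_ac)
  qed
  have "(\<Sum>j=1..k. lam j) \<le> real k * (X * (2 / (n + 2 * s) * (ln (real k) + (6 * n * A / V + 4 * c))) + X * (4 * C * (1 + 2 * q / V)))"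
    by (rule order_trans[OF sum]) (intro mult_left_mono add_mono part1 part2, simp)
  also have "\<dots> = (real k * X) * (2 / (n + 2 * s) * ln (real k) + (2 / (n + 2 * s) * (6 * n * A / V + 4 * c) + 4 * C * (1 + 2 * q / V)))"
    by (simp only: distrib_left mult.assoc add.assoc)
  also have "real k * X = Z * real k powr (1 + 2 * s / n)"
    using k(4) by (simp add: X_def powr_add)
  finally show ?thesis
    unfolding c_def[symmetric] C_def[symmetric] q_def[symmetric]
    by (simp only: distrib_left distrib_right mult_ac)
qed

theorem theorem3p2:
  fixes \<Omega> :: "(real^'n) set" and s :: real
  assumes "0 < s" and "s < 1"
    and "open \<Omega>" and "connected \<Omega>" and "\<Omega> \<noteq> {}" and "bounded \<Omega>"
    and "\<exists>t\<^sub>0>0. \<exists>C\<^sub>\<Omega>>0. \<forall>t. 0 < t \<and> t \<le> t\<^sub>0 \<longrightarrow>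
           measure lborel (boundary_layer \<Omega> t) \<le> C\<^sub>\<Omega> * t"
  shows "\<exists>C>0. \<forall>lam. dirichlet_eigenvalues s \<Omega> lam \<longrightarrow>
           (\<forall>k::nat.
              real k > unit_ball_vol (real CARD('n)) * measure lborel \<Omega> / (2 * pi) ^ CARD('n)
                         * exp (real CARD('n) / (real CARD('n) + 2 * s)) \<longrightarrow>
              (\<Sum>j=1..k. lam j)
                \<le> 2 / (real CARD('n) + 2 * s) * (2 * pi) powr (2 * s)
                    * (unit_ball_vol (real CARD('n)) * measure lborel \<Omega>)
                        powr (- 2 * s / real CARD('n))
                    * real k powr (1 + 2 * s / real CARD('n)) * ln (real k)
                  + C * real k powr (1 + 2 * s / real CARD('n)))"
proof -
  define n where "n = real CARD('n)"
  define \<omega> where "\<omega> = unit_ball_vol n"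
  define V where "V = measure lborel \<Omega>"
  define Z where "Z = (2 * pi) powr (2 * s) * (\<omega> * V) powr (- 2 * s / n)"
  have n: "1 \<le> n" by (simp add: n_def Suc_leI)
  from assms(7) obtain t\<^sub>0 A where t0: "0 < t\<^sub>0" and A: "0 < A"
    and layer: "\<And>t. 0 < t \<Longrightarrow> t \<le> t\<^sub>0 \<Longrightarrow> measure lborel (boundary_layer \<Omega> t) \<le> A * t"
    by blast
  define C\<^sub>1 where "C\<^sub>1 = Z * (2 / (n + 2 * s) * (6 * n * A / V + 4 * \<bar>ln ((2 * pi) powr n / (\<omega> * (V / 2)))\<bar>) +
      4 * (4 + 8 / s + 2 / (1 - s)) * (1 + 2 * (2 * n * A * (\<omega> * V) powr (1 / n) / (2 * pi)) / V))"
  define F where "F k = 2 / (n + 2 * s) * Z * real k powr (1 + 2 * s / n) * ln (real k)" for k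
  \<comment> \<open>Collects the three thresholds for k^(1/n) demanded by the estimate for large
    \<open>k\<close>; the entry 1 keeps \<open>K\<close> positive, so that the n-th root of
    \<open>K powr n\<close> is \<open>K\<close>.\<close>
  define K where "K = max 1 (max (1 / t\<^sub>0) (max (2 * A / V) ((\<omega> * V) powr (1 / n) / (2 * pi))))"
  have K: "1 \<le> K" "1 / t\<^sub>0 \<le> K" "2 * A / V \<le> K" "(\<omega> * V) powr (1 / n) / (2 * pi) \<le> K"
    unfolding K_def by linarith+
  \<comment> \<open>An integer above \<open>K powr n\<close>, so every \<open>k\<close> from
    \<open>m\<close> on passes the thresholds; the added 1 makes \<open>m\<close> positive, as
    averaging over the first \<open>m\<close> eigenvalues requires.\<close>
  define m where "m = nat \<lceil>K powr n\<rceil> + 1"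
  have large: "(\<Sum>j=1..k. lam j) \<le> F k + C\<^sub>1 * real k powr (1 + 2 * s / n)"
    if ev: "dirichlet_eigenvalues s \<Omega> lam" and mk: "m \<le> k" for lam k
  proof -
    have "K powr n \<le> real m" unfolding m_def by linarith
    also have "\<dots> \<le> real k" using mk by simp
    finally have "(K powr n) powr (1 / n) \<le> real k powr (1 / n)" using n by (intro powr_mono2) auto
    moreover have "(K powr n) powr (1 / n) = K" using n K(1) by (simp add: powr_powr)
    ultimately have Kk: "K \<le> real k powr (1 / n)" by simp
    have k: "1 / t\<^sub>0 \<le> real k powr (1 / n)" "2 * A / V \<le> real k powr (1 / n)"
      "(\<omega> * V) powr (1 / n) / (2 * pi) \<le> real k powr (1 / n)" "1 \<le> k"
      using Kk K(2-) mk unfolding m_def by linarith+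
    show ?thesis
      unfolding F_def C\<^sub>1_def Z_def \<omega>_def V_def n_def
      by (rule eigenvalue_sum_le_large[OF assms(1-3,6,5) A layer t0 ev k[unfolded \<omega>_def V_def n_def]])
  qed
  have Z0: "0 \<le> Z" by (simp add: Z_def)
  have V0: "0 \<le> V" "0 \<le> \<omega>" using n by (auto simp: V_def \<omega>_def)
  have C1: "0 \<le> C\<^sub>1"
    unfolding C\<^sub>1_def using Z0 n A V0 assms(1,2) by (intro mult_nonneg_nonneg add_nonneg_nonneg divide_nonneg_nonneg) auto
  have F0: "0 \<le> F k" if "1 \<le> k" for k
    unfolding F_def using Z0 n assms(1) that by (intro mult_nonneg_nonneg) auto
  define B where "B = F m + C\<^sub>1 * real m powr (1 + 2 * s / n)"
  have m1: "1 \<le> m" by (simp add: m_def)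
  have B0: "0 \<le> B" unfolding B_def using F0[OF m1] C1 by simp
  text \<open>
    The remaining finitely many \<open>k\<close> need a bound independent of \<open>lam\<close>; averages of a monotone sequence
    increase, so the bound at \<open>m\<close> provides one.
  \<close>
  have all: "(\<Sum>j=1..k. lam j) \<le> F k + (C\<^sub>1 + B + 1) * real k powr (1 + 2 * s / n)"
    if ev: "dirichlet_eigenvalues s \<Omega> lam" and k: "1 \<le> k" for lam k
  proof (cases "m \<le> k")
    case True
    have "C\<^sub>1 * real k powr (1 + 2 * s / n) \<le> (C\<^sub>1 + B + 1) * real k powr (1 + 2 * s / n)"
      using B0 by (intro mult_right_mono) auto
    with large[OF ev True] show ?thesis by linarith
  next
    case False
    have mono: "mono_on {1..} lam" using ev by (simp add: dirichlet_eigenvalues_def)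
    have "real m * (\<Sum>j=1..k. lam j) \<le> real k * (\<Sum>j=1..m. lam j)"
      using False k by (intro mono_on_average_le[OF mono]) auto
    also have "\<dots> \<le> real k * B"
      unfolding B_def by (intro mult_left_mono large[OF ev]) auto
    also have "\<dots> \<le> real m * (real k * B)"
    proof -
      have "1 * (real k * B) \<le> real m * (real k * B)" using m1 B0 by (intro mult_right_mono) auto
      then show ?thesis by (simp only: mult_1_left)
    qed
    finally have "(\<Sum>j=1..k. lam j) \<le> real k * B"
      by (rule mult_left_le_imp_le) (use m1 in simp)
    also have "\<dots> \<le> B * real k powr (1 + 2 * s / n)"
    proof -
      have "real k powr 1 \<le> real k powr (1 + 2 * s / n)"
        using k n assms(1) by (intro powr_mono) auto
      then have "real k \<le> real k powr (1 + 2 * s / n)" using k by simp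
      from mult_left_mono[OF this B0] show ?thesis by (simp only: mult.commute)
    qed
    also have "\<dots> \<le> (C\<^sub>1 + B + 1) * real k powr (1 + 2 * s / n)"
      using C1 by (intro mult_right_mono) auto
    finally show ?thesis using F0[OF k] by linarith
  qed
  show ?thesis
  proof (intro exI[of _ "C\<^sub>1 + B + 1"] conjI allI impI)
    \<comment> \<open>Both \<open>C\<^sub>1\<close> and \<open>B\<close> are only shown to be
      nonnegative; the summand 1 makes the constant strictly positive.\<close>
    show "0 < C\<^sub>1 + B + 1" using C1 B0 by linarith
    fix lam and k :: nat
    assume ev: "dirichlet_eigenvalues s \<Omega> lam"
      and "unit_ball_vol (real CARD('n)) * measure lborel \<Omega> / (2 * pi) ^ CARD('n)
         * exp (real CARD('n) / (real CARD('n) + 2 * s)) < real k"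
    moreover have "0 \<le> unit_ball_vol (real CARD('n)) * measure lborel \<Omega> / (2 * pi) ^ CARD('n)
         * exp (real CARD('n) / (real CARD('n) + 2 * s))"
      by simp
    ultimately have "0 < real k" by linarith
    then have "1 \<le> k" by simp
    from all[OF ev this] show "(\<Sum>j=1..k. lam j)
                \<le> 2 / (real CARD('n) + 2 * s) * (2 * pi) powr (2 * s)
                    * (unit_ball_vol (real CARD('n)) * measure lborel \<Omega>)
                        powr (- 2 * s / real CARD('n))
                    * real k powr (1 + 2 * s / real CARD('n)) * ln (real k)
                  + (C\<^sub>1 + B + 1) * real k powr (1 + 2 * s / real CARD('n))"
      unfolding F_def Z_def \<omega>_def V_def n_def by (simp only: mult.assoc)
  qed
qed

end
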